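(* Let $N$ be a positive integer and $i\in\{0,1,\ldots,N-1\}$. Suppose that $K$ is a compact interval with non-empty interior contained in $$\Lambda=\Big\{x\in\mathbb{R} : \lim_{j\to\infty}\operatorname{discr}X_{jN+i}(x)\text{ exists and is negative}\Big\}.$$ Assume that $$\lim_{j\to\infty}\frac{a_{(j+1)N+i-1}}{a_{jN+i-1}}=1\quad\text{and}\quad (X_{jN+i} : j\in\mathbb{N})\in\mathcal{D}_1\big(K,\mathrm{GL}(2,\mathbb{R})\big).$$ Let $\mathcal{X}$ denote the limit of $(X_{jN+i} : j\in\mathbb{N})$. Then there is a probability measure $\nu$ such that $(p_n : n\in\mathbb{N}_0)$ are orthonormal in $L^2(\mathbb{R},\nu)$ which is purely absolutely continuous with continuous and positive density $\nu'$ on $K$. Moreover, there are $M>0$, $c>0$ and a real continuous function $\eta:K\to\mathbb{R}$ such that for all $k\ge M$ and $x \in K$, $$\sqrt{a_{(k+1)N+i-1}}\,p_{kN+i}(x)=\sqrt{\frac{2|[\mathcal{X}(x)]_{2,1}|}{\pi\nu'(x)\sqrt{-\operatorname{discr}\mathcal{X}(x)}}}\ \sin\Big(\sum_{j=M+1}^k\theta_{jN+i}(x)+\eta(x)\Big)+E_{kN+i}(x),$$ where $$\sup_{x\in K}|E_{kN+i}(x)|\le c\sum_{j=k}^\infty\sup_{x\in K}\big\|X_{(j+1)N+i}(x)-X_{jN+i}(x)\big\|,$$ and $$\theta_n(x)=\arccos\bigg(\frac{\operatorname{tr}X_n(x)}{2\sqrt{\det X_n(x)}}\bigg).$$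
   Context: $(a_n)_{n\ge 0}$ is a sequence of positive numbers and $(b_n)_{n\ge0}$ a sequence of real numbers. The polynomials $(p_n)_{n\ge 0}$ are defined by $p_0(x)=1$, $p_1(x)=(x-b_0)/a_0$, and $x p_n(x) = a_n p_{n+1}(x)+b_n p_n(x)+a_{n-1}p_{n-1}(x)$ for $n\ge1$. The $N$-step transfer matrix is $X_n(x)=B_{n+N-1}(x)\cdots B_n(x)$, where $B_j(x)=\begin{pmatrix}0&1\\ -\frac{a_{j-1}}{a_j}&\frac{x-b_j}{a_j}\end{pmatrix}$. For a $2\times2$ matrix $Y$: $[Y]_{k,l}$ is its $(k,l)$ entry, $\operatorname{discr}Y=(\operatorname{tr}Y)^2-4\det Y$, and $\|Y\|$ is the spectral norm. $(X_{jN+i}:j\in\mathbb{N})\in\mathcal{D}_1(K,\mathrm{GL}(2,\mathbb{R}))$ means: the maps $X_{jN+i}$ are continuous from $K$ to invertible real $2\times 2$ matrices, are bounded in supremum norm over $K$ uniformly in $j$, and $\sum_{j=1}^\infty\sup_{x\in K}\|X_{(j+1)N+i}(x)-X_{jN+i}(x)\|<\infty$. *)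

theory Defs
  imports "HOL-Probability.Probability" "HOL-Computational_Algebra.Polynomial"
begin

fun orth_poly :: "(nat \<Rightarrow> real) \<Rightarrow> (nat \<Rightarrow> real) \<Rightarrow> nat \<Rightarrow> real poly" where
  "orth_poly a b 0 = 1"
| "orth_poly a b (Suc 0) = smult (1 / a 0) [:- b 0, 1:]"
| "orth_poly a b (Suc (Suc n)) =
     smult (1 / a (Suc n)) ([:- b (Suc n), 1:] * orth_poly a b (Suc n) - smult (a n) (orth_poly a b n))"

lemma orth_poly_1:
  "poly (orth_poly a b 1) x = (x - b 0) / a 0"
  by (simp add: diff_divide_distrib)

lemma orth_poly_recurrence:
  assumes "a n > 0" "n \<ge> 1"
  shows "x * poly (orth_poly a b n) x =
    a n * poly (orth_poly a b (n + 1)) x + b n * poly (orth_poly a b n) x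
      + a (n - 1) * poly (orth_poly a b (n - 1)) x"
  using assms by (cases n) (auto simp: field_simps)

text \<open>Since \<open>0 - 1 = 0\<close> on natural numbers, the entry \<open>a (j - 1)\<close> has its intended
  meaning only for \<open>j \<ge> 1\<close>; the matrix with \<open>j = 0\<close> is not to be used.\<close>

definition transfer_matrix :: "(nat \<Rightarrow> real) \<Rightarrow> (nat \<Rightarrow> real) \<Rightarrow> nat \<Rightarrow> real \<Rightarrow> real^2^2" where
  "transfer_matrix a b j x =
     vector [vector [0, 1], vector [- (a (j - 1) / a j), (x - b j) / a j]]"

text \<open>The product \<open>B\<^sub>n\<^sub>+\<^sub>N\<^sub>-\<^sub>1(x) \<cdots> B\<^sub>n(x)\<close>, the factor with the largest index
  being leftmost.\<close>

fun step_matrix :: "(nat \<Rightarrow> real) \<Rightarrow> (nat \<Rightarrow> real) \<Rightarrow> nat \<Rightarrow> nat \<Rightarrow> real \<Rightarrow> real^2^2" where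
  "step_matrix a b 0 n x = mat 1"
| "step_matrix a b (Suc N) n x = transfer_matrix a b (n + N) x ** step_matrix a b N n x"

definition discr :: "real^2^2 \<Rightarrow> real" where
  "discr Y = (trace Y)\<^sup>2 - 4 * det Y"

definition spectral_norm :: "real^2^2 \<Rightarrow> real" where
  "spectral_norm Y = onorm (\<lambda>v. Y *v v)"

definition GL2 :: "(real^2^2) set" where
  "GL2 = {Y. invertible Y}"

text \<open>The class \<open>\<D>\<^sub>1(K, G)\<close>. Sequences are indexed by \<open>j \<ge> 1\<close>; the value \<open>F 0\<close>
  is not constrained. The uniform bound makes all suprema below finite.\<close>

definition stolz_class_1 :: "real set \<Rightarrow> (real^2^2) set \<Rightarrow> (nat \<Rightarrow> real \<Rightarrow> real^2^2) \<Rightarrow> bool" where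
  "stolz_class_1 K G F \<longleftrightarrow>
     (\<forall>j\<ge>1. continuous_on K (F j) \<and> F j ` K \<subseteq> G) \<and>
     (\<exists>C. \<forall>j\<ge>1. \<forall>x\<in>K. spectral_norm (F j x) \<le> C) \<and>
     summable (\<lambda>j. SUP x\<in>K. spectral_norm (F (Suc j + 1) x - F (Suc j) x))"

definition orthonormal_L2 :: "real measure \<Rightarrow> (nat \<Rightarrow> real \<Rightarrow> real) \<Rightarrow> bool" where
  "orthonormal_L2 \<nu> f \<longleftrightarrow>
     (\<forall>n. f n \<in> borel_measurable \<nu> \<and> integrable \<nu> (\<lambda>x. (f n x)\<^sup>2)) \<and>
     (\<forall>m n. (\<integral>x. f m x * f n x \<partial>\<nu>) = (if m = n then 1 else 0))"

text \<open>On \<open>K\<close> the measure \<open>\<nu>\<close> coincides with \<open>w(x) dx\<close>: it has no singular part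
  there, in particular no atoms at boundary points of \<open>K\<close>.\<close>

definition abs_cont_density_on :: "real measure \<Rightarrow> real set \<Rightarrow> (real \<Rightarrow> real) \<Rightarrow> bool" where
  "abs_cont_density_on \<nu> K w \<longleftrightarrow>
     restrict_space \<nu> K = density (restrict_space lborel K) (\<lambda>x. ennreal (w x))"

definition transfer_angle :: "(nat \<Rightarrow> real) \<Rightarrow> (nat \<Rightarrow> real) \<Rightarrow> nat \<Rightarrow> nat \<Rightarrow> real \<Rightarrow> real" where
  "transfer_angle a b N n x =
     arccos (trace (step_matrix a b N n x) / (2 * sqrt (det (step_matrix a b N n x))))"

end

theory Submission
  imports Defs "HOL-Complex_Analysis.Cauchy_Integral_Theorem"
begin

text \<open>
  Asymptotics. After normalising the determinant, the transfer matrices become a sequence of bounded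
  variation of elliptic elements of \<open>SL\<^sub>2\<close>. Applying the left eigenvector of the \<open>k\<close>-th matrix
  to the \<open>k\<close>-th vector \<open>(p\<^sub>k\<^sub>N\<^sub>+\<^sub>i\<^sub>-\<^sub>1, p\<^sub>k\<^sub>N\<^sub>+\<^sub>i)\<close> gives a complex sequence that is
  multiplied by a phase in each step, up to a summable relative error. Dividing by the accumulated
  phase yields a nonvanishing continuous limit \<open>\<zeta>\<close>, with the error controlled by the tail of the variation.

  The measure. For a fixed \<open>\<rho>\<close> off the real axis, the Bernstein-Szego weight
  \<open>\<bar>Im \<rho>\<bar> / (\<pi> a\<^sub>n\<^sub>-\<^sub>1 \<bar>p\<^sub>n\<^sub>-\<^sub>1 + \<rho> p\<^sub>n\<bar>\<^sup>2)\<close> makes \<open>p\<^sub>0, \<dots>, p\<^sub>n\<^sub>-\<^sub>1\<close> orthonormal,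
  so every weak limit of averages of these weights is an orthogonality measure. Along \<open>n = k N + i\<close>
  the weight is a function of the direction of \<open>\<zeta>\<close> times the accumulated phase; averaging over \<open>k\<close>
  equidistributes the phase and the limit density is \<open>\<bar>\<X>\<^sub>2\<^sub>1\<bar> sin \<theta> / (\<pi> \<bar>\<zeta>\<bar>\<^sup>2)\<close>, for almost all
  \<open>x\<close>. Equidistribution fails only where \<open>\<theta> / \<pi>\<close> is rational. The limit \<open>\<X>\<close> is polynomial in \<open>x\<close>,
  so this is a null set unless the trace of \<open>\<X>\<close> is constant; but then \<open>\<X>\<close> itself is constant, and
  choosing \<open>\<rho>\<close> from its eigenvector makes the weights converge without averaging. (If the moment
  problem is indeterminate, this choice of \<open>\<rho>\<close> is what selects the right measure.)
\<close>

section \<open>Rational functions on the real line\<close>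

text \<open>One function \<zeta> governs both halves of the theorem: the amplitude of the
  oscillation is \<open>norm (\<zeta> x) / \<sigma> x\<close>, and eliminating
  \<open>norm (\<zeta> x)\<close> between this and the density yields the square root of the
  statement. The measure has to be built, and weak limits see only integrals over \<open>x\<close>,
  so almost everywhere convergence of the averaged weights under a uniform bound suffices. The
  delicate point is that a constant trace forces a constant \<X>, because \<X> is only a limit of
  products of transfer matrices. The derivative of such a product is governed by a positive
  semidefinite matrix, and the derivative of its trace pairs this matrix with a quadratic form that
  is definite where the discriminant is negative. So the derivative of the trace bounds all
  derivatives, by an inequality whose constants stay bounded; the inequality survives the limit,
  which a bare implication for each product would not.\<close>

lemma poly_divide_tendsto_coeff:
  fixes p q :: "'a::real_normed_field poly"
  assumes "degree p \<le> degree q" "q \<noteq> 0"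
  shows "((\<lambda>x. poly p x / poly q x) \<longlongrightarrow> coeff p (degree q) / lead_coeff q) at_infinity"
proof (cases "degree p = degree q")
  case True
  have "((\<lambda>x. (poly p x / x ^ degree q) / (poly q x / x ^ degree q)) \<longlongrightarrow> lead_coeff p / lead_coeff q) at_infinity"
    using poly_divide_tendsto_aux[of p] poly_divide_tendsto_aux[of q] assms True
    by (intro tendsto_divide) auto
  moreover have "\<forall>\<^sub>F x in at_infinity. (poly p x / x ^ degree q) / (poly q x / x ^ degree q) = poly p x / poly q x"
    by (rule eventually_at_infinityI[of 1]) auto
  ultimately show ?thesis unfolding True using tendsto_cong by fast
next
  case False
  then show ?thesis using poly_divide_tendsto_0_at_infinity[of p q] assms
    by (simp add: coeff_eq_0)
qed

text \<open>Cauchy's theorem on the segment closed by the upper semicircle: there are no poles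
  inside, and on the arc \<open>z * h z\<close> tends to \<open>c\<close>, which gives the arc
  integral the limit \<open>\<i> * pi * c\<close>. With a degree gap of one the integral over the
  line may exist only as a limit over symmetric segments.\<close>

lemma half_plane_quotient_integral:
  fixes g D :: "complex poly"
  assumes deg: "degree g < degree D" and D0: "\<And>z. Im z \<ge> 0 \<Longrightarrow> poly D z \<noteq> 0"
  shows "((\<lambda>R. integral {-R..R} (\<lambda>x. poly g (of_real x) / poly D (of_real x)))
     \<longlongrightarrow> - (\<i> * pi * (coeff g (degree D - 1) / lead_coeff D))) at_top"
proof -
  define h where "h z = poly g z / poly D z" for z
  define c where "c = coeff g (degree D - 1) / lead_coeff D"
  define S where "S = {z. Im z \<ge> 0}"
  have convS: "convex S" unfolding S_def by (simp add: convex_halfspace_Im_ge)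
  have hol: "h holomorphic_on S"
    unfolding h_def S_def by (intro holomorphic_intros) (use D0 in auto)
  have "D \<noteq> 0" using deg by auto
  have lim: "((\<lambda>z. z * h z) \<longlongrightarrow> c) at_infinity"
  proof -
    have "degree (pCons 0 g) \<le> degree D" using degree_pCons_le[of 0 g] deg by linarith
    moreover have "coeff (pCons 0 g) (degree D) = coeff g (degree D - 1)"
      using deg by (cases "degree D") auto
    ultimately show ?thesis
      using poly_divide_tendsto_coeff[of "pCons 0 g" D] \<open>D \<noteq> 0\<close> by (simp add: h_def c_def)
  qed
  define A where "A R = integral {0..pi} (\<lambda>t. h (R * cis t) * R * \<i> * cis t)" for R :: real
  have eq: "integral {-R..R} (\<lambda>x. h (of_real x)) = - A R" if "R > 0" for R
  proof -
    let ?l = "linepath (- of_real R :: complex) (of_real R)" and ?a = "part_circlepath 0 R 0 pi"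
    have sub1: "path_image ?l \<subseteq> S"
      using closed_segment_subset[of "- of_real R :: complex" S "of_real R"] convS by (auto simp: S_def)
    have sub2: "path_image ?a \<subseteq> S"
      using \<open>R > 0\<close> by (auto simp: path_image_part_circlepath' closed_segment_eq_real_ivl S_def
         intro!: mult_nonneg_nonneg sin_ge_zero)
    have fin: "pathfinish ?l = pathstart ?a" by simp
    have fin2: "pathfinish ?a = pathstart ?l"
      by (simp add: exp_Euler)
    have int0: "(h has_contour_integral 0) (?l +++ ?a)"
      by (rule Cauchy_theorem_convex_simple[OF hol convS])
        (use sub1 sub2 fin fin2 in \<open>auto simp: path_image_join valid_path_join\<close>)
    have i1: "h contour_integrable_on ?l"
      by (intro contour_integrable_continuous_linepath continuous_on_subset[OF holomorphic_on_imp_continuous_on[OF hol]])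
        (use sub1 in auto)
    have i2: "h contour_integrable_on ?a"
      by (intro contour_integrable_continuous_part_circlepath continuous_on_subset[OF holomorphic_on_imp_continuous_on[OF hol] sub2])
    have "contour_integral ?l h + contour_integral ?a h = 0"
      using contour_integral_unique[OF int0] contour_integral_join[OF i1 i2] by simp
    moreover have "contour_integral ?l h = integral {-R..R} (\<lambda>x. h (of_real x))"
      using \<open>R > 0\<close> by (subst contour_integral_linepath_Reals_eq) auto
    moreover have "contour_integral ?a h = A R"
      by (subst contour_integral_part_circlepath_eq) (auto simp: A_def)
    ultimately show ?thesis by (simp add: eq_neg_iff_add_eq_0)
  qed
  have Alim: "(A \<longlongrightarrow> \<i> * pi * c) at_top"
  proof (rule tendstoI)
    fix e :: real assume "e > 0"
    \<comment> \<open>The quarter pays for the length of the parameter interval, as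
      \<open>pi < 4\<close>.\<close>
    then have "\<forall>\<^sub>F z in at_infinity. dist (z * h z) c < e / 4"
      using tendstoD[OF lim, of "e/4"] by auto
    then obtain B where B: "\<And>z. norm z \<ge> B \<Longrightarrow> dist (z * h z) c < e / 4"
      unfolding eventually_at_infinity by auto
    have "dist (A R) (\<i> * pi * c) < e" if R: "R \<ge> max B 1" for R
    proof -
      have cont: "continuous_on {0..pi} (\<lambda>t. h (R * cis t) * R * \<i> * cis t)"
      proof -
        have "poly D (R * cis t) \<noteq> 0" if "t \<in> {0..pi}" for t
          using D0[of "R * cis t"] that R mult_nonneg_nonneg[OF _ sin_ge_zero[of t], of R] by auto
        then show ?thesis unfolding h_def by (intro continuous_intros) auto
      qed
      have 1: "((\<lambda>t. h (R * cis t) * R * \<i> * cis t) has_integral A R) {0..pi}"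
        unfolding A_def using cont by (intro integrable_integral integrable_continuous_real)
      have 2: "((\<lambda>t::real. \<i> * c) has_integral pi *\<^sub>R (\<i> * c)) {0..pi}"
        using has_integral_const_real[of "\<i> * c" 0 pi] by simp
      have 3: "((\<lambda>t. h (R * cis t) * R * \<i> * cis t - \<i> * c) has_integral (A R - pi *\<^sub>R (\<i> * c))) {0..pi}"
        by (rule has_integral_diff[OF 1 2])
      have bd: "norm (h (R * cis t) * R * \<i> * cis t - \<i> * c) \<le> e / 4" for t
      proof -
        have "h (R * cis t) * R * \<i> * cis t - \<i> * c = \<i> * ((R * cis t) * h (R * cis t) - c)"
          by (simp add: algebra_simps)
        moreover have "norm ((R * cis t) * h (R * cis t) - c) \<le> e / 4"
          using B[of "R * cis t"] R by (auto simp: dist_norm norm_mult)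
        ultimately show ?thesis by (simp add: norm_mult)
      qed
      have "norm (A R - pi *\<^sub>R (\<i> * c)) \<le> e / 4 * measure lborel {0..pi}"
        using has_integral_bound_real[OF _ finite.emptyI 3, of "e / 4"] bd \<open>e > 0\<close> by auto
      also have "\<dots> = e * (pi / 4)" by simp
      also have "\<dots> < e" using \<open>e > 0\<close> pi_less_4 by (auto simp: field_simps)
      finally show ?thesis by (simp add: dist_norm scaleR_conv_of_real mult_ac)
    qed
    then show "\<forall>\<^sub>F R in at_top. dist (A R) (\<i> * pi * c) < e"
      using eventually_at_top_linorder by blast
  qed
  have ev: "\<forall>\<^sub>F R in at_top. - A R = integral {-R..R} (\<lambda>x. h (of_real x))"
    using eventually_gt_at_top[of 0] by eventually_elim (simp add: eq)
  show ?thesis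
    using tendsto_cong[OF ev] tendsto_minus[OF Alim] unfolding h_def c_def by simp
qed

section \<open>Bernstein-Szego weights\<close>

lemma orth_poly_Suc:
  assumes "n \<ge> 1"
  shows "orth_poly a b (Suc n) = smult (1 / a n) ([:- b n, 1:] * orth_poly a b n - smult (a (n - 1)) (orth_poly a b (n - 1)))"
  using assms by (cases n) auto

locale jacobi =
  fixes a b :: "nat \<Rightarrow> real"
  assumes a_pos: "a n > 0"
begin

abbreviation P :: "nat \<Rightarrow> real poly" where "P \<equiv> orth_poly a b"

lemma a_nz [simp]: "a n \<noteq> 0" and a_nn [simp]: "a n \<ge> 0" and a_gr [simp]: "a n > 0"
  using a_pos[of n] by auto

lemma degree_P [simp]: "degree (P n) = n"
  and coeff_P_Suc: "coeff (P (Suc n)) (Suc n) = coeff (P n) n / a n"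
proof -
  have *: "degree (P n) = n \<and> degree (P (Suc n)) = Suc n \<and> coeff (P (Suc n)) (Suc n) = coeff (P n) n / a n" for n
  proof (induction n)
    case (Suc n)
    then have nz: "P (Suc n) \<noteq> 0" by force
    have d: "degree ([:- b (Suc n), 1:] * P (Suc n)) = Suc (Suc n)"
      using Suc nz by (subst degree_mult_eq) auto
    have "degree (smult (a n) (P n)) < Suc (Suc n)"
      using Suc by (intro le_less_trans[OF degree_smult_le]) simp
    then have "degree ([:- b (Suc n), 1:] * P (Suc n) - smult (a n) (P n)) = Suc (Suc n)"
      using d by (metis degree_add_eq_left degree_minus diff_conv_add_uminus)
    then have 1: "degree (P (Suc (Suc n))) = Suc (Suc n)" by simp
    have 2: "coeff (P (Suc (Suc n))) (Suc (Suc n)) = coeff (P (Suc n)) (Suc n) / a (Suc n)"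
      using Suc by (simp add: coeff_eq_0)
    show ?case using Suc 1 2 by simp
  qed simp
  show "degree (P n) = n" "coeff (P (Suc n)) (Suc n) = coeff (P n) n / a n" using * by auto
qed

lemma lead_coeff_P_pos: "coeff (P n) n > 0"
  by (induction n) (simp_all del: orth_poly.simps(2,3) add: coeff_P_Suc)

lemma P_adjacent_nonzero: "poly (P n) x \<noteq> 0 \<or> poly (P (Suc n)) x \<noteq> 0"
proof (induction n)
  case (Suc n)
  have "a n * poly (P n) x = 0" if "poly (P (Suc n)) x = 0" "poly (P (Suc (Suc n))) x = 0"
    using that by simp
  then show ?case using Suc a_nz by (metis mult_eq_0_iff)
qed simp

definition cP :: "nat \<Rightarrow> complex \<Rightarrow> complex" where
  "cP n z = poly (map_poly of_real (P n)) z"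

lemma cP_0 [simp]: "cP 0 z = 1" and cP_1: "cP (Suc 0) z = (z - b 0) / a 0"
  and cP_Suc_Suc: "cP (Suc (Suc n)) z = ((z - b (Suc n)) * cP (Suc n) z - a n * cP n z) / a (Suc n)"
  for z :: complex
proof -
  show "cP 0 z = 1" by (simp add: cP_def)
  show "cP (Suc 0) z = (z - b 0) / a 0"
    by (simp add: cP_def map_poly_pCons field_simps)
  have "map_poly complex_of_real (P (Suc (Suc n))) =
     smult (1 / a (Suc n)) ([:- b (Suc n), 1:] * map_poly of_real (P (Suc n)) - smult (a n) (map_poly of_real (P n)))"
    by (rule poly_eqI) (auto simp: coeff_map_poly coeff_pCons split: nat.split)
  then show "cP (Suc (Suc n)) z = ((z - b (Suc n)) * cP (Suc n) z - a n * cP n z) / a (Suc n)"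
    unfolding cP_def by (simp add: field_simps)
qed

lemma cP_of_real: "cP n (of_real x) = of_real (poly (P n) x)"
  by (induction n rule: induct_nat_012)
     (auto simp: cP_Suc_Suc cP_1 algebra_simps add_divide_distrib diff_divide_distrib)

text \<open>Induction on the quotient \<open>q\<close> of consecutive polynomials:
  \<open>q \<mapsto> - a n / q\<close> preserves the upper half plane, and adding
  \<open>z - b (Suc n)\<close> only raises the imaginary part.\<close>

lemma cP_herglotz:
  assumes "Im z > 0"
  shows "cP n z \<noteq> 0 \<and> Im (cP (Suc n) z / cP n z) > 0"
proof (induction n)
  case 0
  then show ?case using assms by (simp add: cP_1)
next
  case (Suc n)
  then have nz: "cP (Suc n) z \<noteq> 0" by auto
  define q where "q = cP (Suc n) z / cP n z"
  have "Im q > 0" "q \<noteq> 0" using Suc nz by (auto simp: q_def)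
  then have iq: "Im (inverse q) < 0"
    by (simp add: divide_neg_pos complex_neq_0)
  have "cP (Suc (Suc n)) z / cP (Suc n) z = ((z - b (Suc n)) - a n * inverse q) / a (Suc n)"
    using nz Suc by (simp add: cP_Suc_Suc q_def field_simps)
  then have "Im (cP (Suc (Suc n)) z / cP (Suc n) z) = (Im z - a n * Im (inverse q)) / a (Suc n)"
    by (simp del: inverse_complex.simps)
  also have "\<dots> > 0"
    using assms iq mult_pos_neg[of "a n" "Im (inverse q)"] by (intro divide_pos_pos) auto
  finally show ?case using nz by simp
qed

text \<open>A zero above the axis would make the quotient of \<open>cP_herglotz\<close> equal to
  \<open>- 1 / cnj \<rho>\<close>, a point of the lower half plane; a zero on the axis would
  annihilate two consecutive polynomials. This is why the contour argument works with
  \<open>cnj \<rho>\<close>.\<close>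

lemma cP_combination_nonzero:
  assumes "Im z \<ge> 0" "Im \<rho> > 0"
  shows "cP n z + cnj \<rho> * cP (Suc n) z \<noteq> 0"
proof
  assume eq: "cP n z + cnj \<rho> * cP (Suc n) z = 0"
  show False
  proof (cases "Im z = 0")
    case True
    then obtain x where z: "z = of_real x" by (metis complex_is_Real_iff Reals_cases)
    have "Im (cP n z + cnj \<rho> * cP (Suc n) z) = - Im \<rho> * poly (P (Suc n)) x"
      "Re (cP n z + cnj \<rho> * cP (Suc n) z) = poly (P n) x + Re \<rho> * poly (P (Suc n)) x"
      unfolding z cP_of_real by auto
    then have "poly (P (Suc n)) x = 0" "poly (P n) x = 0" using eq assms by auto
    then show False using P_adjacent_nonzero[of n x] by auto
  next
    case False
    then have h: "cP n z \<noteq> 0" "Im (cP (Suc n) z / cP n z) > 0" using assms cP_herglotz[of z n] by auto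
    have "\<rho> \<noteq> 0" using assms by auto
    then have "cP (Suc n) z / cP n z = - inverse (cnj \<rho>)"
      using eq h by (simp add: field_simps eq_neg_iff_add_eq_0)
    then have "Im (cP (Suc n) z / cP n z) = - Im \<rho> / ((Re \<rho>)\<^sup>2 + (Im \<rho>)\<^sup>2)" by simp
    also have "\<dots> \<le> 0" using assms by (intro divide_nonpos_nonneg) auto
    finally show False using h by simp
  qed
qed

text \<open>The absolute value of \<open>Im \<rho>\<close> admits both half planes, since the \<rho>
  that is later read off an eigenvector has an imaginary part of the sign of
  \<open>y21\<close>.\<close>

definition bs_weight :: "complex \<Rightarrow> nat \<Rightarrow> real \<Rightarrow> real" where
  "bs_weight \<rho> n x = \<bar>Im \<rho>\<bar> / (pi * a (n - 1) *
     (cmod (of_real (poly (P (n - 1)) x) + \<rho> * of_real (poly (P n) x)))\<^sup>2)"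

lemma bs_weight_cnj: "bs_weight (cnj \<rho>) n x = bs_weight \<rho> n x"
proof -
  have "cnj (of_real (poly (P (n - 1)) x) + \<rho> * of_real (poly (P n) x)) = of_real (poly (P (n - 1)) x) + cnj \<rho> * of_real (poly (P n) x)"
    by simp
  then have "cmod (of_real (poly (P (n - 1)) x) + cnj \<rho> * of_real (poly (P n) x)) =
      cmod (of_real (poly (P (n - 1)) x) + \<rho> * of_real (poly (P n) x))"
    by (metis complex_mod_cnj)
  then show ?thesis unfolding bs_weight_def by simp
qed

lemma bs_denominator_pos:
  assumes "Im \<rho> \<noteq> 0" "n \<ge> 1"
  shows "(cmod (of_real (poly (P (n - 1)) x) + \<rho> * of_real (poly (P n) x)))\<^sup>2 > 0"
proof -
  obtain m where m: "n = Suc m" using assms by (cases n) auto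
  have "of_real (poly (P m) x) + \<rho> * of_real (poly (P n) x) \<noteq> 0"
    using P_adjacent_nonzero[of m x] assms unfolding complex_eq_iff m by auto
  then show ?thesis unfolding m by simp
qed

lemma bs_weight_pos: "Im \<rho> \<noteq> 0 \<Longrightarrow> n \<ge> 1 \<Longrightarrow> bs_weight \<rho> n x > 0"
  unfolding bs_weight_def using bs_denominator_pos[of \<rho> n x] by (intro divide_pos_pos mult_pos_pos) auto

lemma continuous_bs_weight:
  assumes "Im \<rho> \<noteq> 0" "n \<ge> 1"
  shows "continuous_on S (bs_weight \<rho> n)"
proof -
  have "pi * a (n - 1) * (cmod (of_real (poly (P (n - 1)) x) + \<rho> * of_real (poly (P n) x)))\<^sup>2 \<noteq> 0" for x
    using bs_denominator_pos[OF assms, of x] by auto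
  then show ?thesis
    unfolding bs_weight_def by (intro continuous_intros) auto
qed

text \<open>\<open>Im \<rho> * P n\<close> is the imaginary part of the number in the denominator,
  so for large \<open>x\<close> the weight is at most a constant over \<open>(P n)\<^sup>2\<close>.
  Multiplied by \<open>1 + x\<^sup>2\<close>, the polynomial \<open>f\<close> still has degree at
  most \<open>2 * n\<close>; hence the integrand is dominated by a multiple of
  \<open>1 / (1 + x\<^sup>2)\<close>.\<close>

lemma bs_weight_integrable:
  assumes \<rho>: "Im \<rho> > 0" and n: "n \<ge> 1" and f: "degree f + 2 \<le> 2 * n"
  shows "integrable lborel (\<lambda>x. poly f x * bs_weight \<rho> n x)"
proof -
  define g where "g = f * [:1, 0, 1:]"
  define h where "h x = poly g x * bs_weight \<rho> n x" for x
  have Pn: "P n \<noteq> 0" using lead_coeff_P_pos[of n] by auto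
  have degP: "degree ((P n)\<^sup>2) = 2 * n" using Pn by (simp add: degree_power_eq)
  have "degree g \<le> degree f + 2" unfolding g_def using degree_mult_le[of f "[:1,0,1:]"] by simp
  then have "((\<lambda>x. poly g x / poly ((P n)\<^sup>2) x) \<longlongrightarrow> coeff g (2 * n) / lead_coeff ((P n)\<^sup>2)) at_infinity"
    using poly_divide_tendsto_coeff[of g "(P n)\<^sup>2"] f Pn degP by simp
  from tendsto_norm[OF this]
  have "\<forall>\<^sub>F x in at_infinity. norm (poly g x / poly ((P n)\<^sup>2) x) < norm (coeff g (2 * n) / lead_coeff ((P n)\<^sup>2)) + 1"
    by (rule order_tendstoD) simp
  then obtain C where C: "C > 0" "\<forall>\<^sub>F x in at_infinity. norm (poly g x / poly ((P n)\<^sup>2) x) < C"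
    by (metis norm_ge_zero add_nonneg_pos zero_less_one)
  have "\<forall>\<^sub>F x in at_infinity. poly (P n) x \<noteq> 0" using Pn by (rule poly_eventually_not_zero)
  with C(2) have "\<forall>\<^sub>F x in at_infinity. norm (h x) \<le> C / (Im \<rho> * (pi * a (n - 1)))"
  proof eventually_elim
    case (elim x)
    have 1: "\<bar>poly g x\<bar> \<le> C * (poly (P n) x)\<^sup>2"
      using elim by (simp add: divide_simps abs_divide split: if_splits)
    define d where "d = (cmod (of_real (poly (P (n - 1)) x) + \<rho> * of_real (poly (P n) x)))\<^sup>2"
    have dp: "d > 0" unfolding d_def using bs_denominator_pos[of \<rho> n x] \<rho> n by simp
    have "(Im \<rho>)\<^sup>2 * (poly (P n) x)\<^sup>2 \<le> d"
      unfolding d_def cmod_power2 by (simp add: power_mult_distrib)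
    then have "C * ((Im \<rho>)\<^sup>2 * (poly (P n) x)\<^sup>2) \<le> C * d"
      using C(1) by (intro mult_left_mono) auto
    then have "(Im \<rho>)\<^sup>2 * \<bar>poly g x\<bar> \<le> C * d"
      using mult_left_mono[OF 1, of "(Im \<rho>)\<^sup>2"] by (simp add: mult_ac)
    then have "\<bar>poly g x\<bar> * Im \<rho> / d \<le> C / Im \<rho>"
      using \<rho> dp by (simp add: field_simps power2_eq_square)
    then have "\<bar>poly g x\<bar> * Im \<rho> / d / (pi * a (n - 1)) \<le> C / Im \<rho> / (pi * a (n - 1))"
      by (intro divide_right_mono) auto
    moreover have "norm (h x) = \<bar>poly g x\<bar> * Im \<rho> / d / (pi * a (n - 1))"
      unfolding h_def bs_weight_def d_def[symmetric] using \<rho> dp by (simp add: abs_mult field_simps)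
    ultimately show ?case by simp
  qed
  then obtain B where B: "\<And>x. norm x \<ge> B \<Longrightarrow> norm (h x) \<le> C / (Im \<rho> * (pi * a (n - 1)))"
    unfolding eventually_at_infinity by auto
  have conth: "continuous_on S h" for S
    unfolding h_def using \<rho> n by (intro continuous_intros continuous_bs_weight) auto
  have "bounded (h ` {-B..B})"
    using conth by (intro compact_imp_bounded compact_continuous_image) auto
  then obtain C' where C': "\<And>x. x \<in> {-B..B} \<Longrightarrow> norm (h x) \<le> C'"
    unfolding bounded_iff by blast
  define D where "D = max (C / (Im \<rho> * (pi * a (n - 1)))) C'"
  have D: "norm (h x) \<le> D" for x
    using B[of x] C'[of x] unfolding D_def by (cases "norm x \<ge> B") (force simp: abs_le_iff)+
  have int: "integrable lborel (\<lambda>x::real. D * inverse (1 + x\<^sup>2))"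
    using integrable_inverse_1_plus_square by (simp add: set_integrable_def)
  show ?thesis
  proof (rule Bochner_Integration.integrable_bound[OF int])
    have "continuous_on UNIV (\<lambda>x. poly f x * bs_weight \<rho> n x)"
      using \<rho> n by (intro continuous_intros continuous_bs_weight) auto
    then show "(\<lambda>x. poly f x * bs_weight \<rho> n x) \<in> borel_measurable lborel"
      by (simp add: borel_measurable_continuous_onI)
    show "AE x in lborel. norm (poly f x * bs_weight \<rho> n x) \<le> norm (D * inverse (1 + x\<^sup>2))"
    proof (rule AE_I2)
      fix x :: real
      have p: "1 + x\<^sup>2 > 0" by (simp add: add_pos_nonneg)
      have hx: "h x = (poly f x * bs_weight \<rho> n x) * (1 + x\<^sup>2)"
        by (simp add: h_def g_def power2_eq_square algebra_simps)
      have "norm (poly f x * bs_weight \<rho> n x) = norm (h x) * inverse (1 + x\<^sup>2)"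
        unfolding hx norm_mult[of _ "1 + x\<^sup>2"] using p by simp
      also have "\<dots> \<le> D * inverse (1 + x\<^sup>2)"
        using D[of x] p by (intro mult_right_mono) auto
      finally show "norm (poly f x * bs_weight \<rho> n x) \<le> norm (D * inverse (1 + x\<^sup>2))" by simp
    qed
  qed
qed

lemma tendsto_integral_symmetric:
  fixes f :: "real \<Rightarrow> real"
  assumes "integrable lborel f"
  shows "((\<lambda>R. integral {-R..R} f) \<longlongrightarrow> integral\<^sup>L lborel f) at_top"
proof -
  have "((\<lambda>R. \<integral>x. indicator {-R..R} x *\<^sub>R f x \<partial>lborel) \<longlongrightarrow> (\<integral>x. f x \<partial>lborel)) at_top"
  proof (rule integral_dominated_convergence_at_top[where w = "\<lambda>x. norm (f x)"])
    show "AE x in lborel. ((\<lambda>R. indicator {-R..R} x *\<^sub>R f x) \<longlongrightarrow> f x) at_top"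
    proof (rule AE_I2, rule tendsto_eventually)
      fix x :: real
      show "\<forall>\<^sub>F R in at_top. indicator {-R..R} x *\<^sub>R f x = f x"
        using eventually_ge_at_top[of "\<bar>x\<bar>"] by eventually_elim (auto simp: indicator_def)
    qed
    show "\<forall>\<^sub>F R in at_top. AE x in lborel. norm (indicator {-R..R} x *\<^sub>R f x) \<le> norm (f x)"
      by (auto simp: indicator_def)
  qed (use assms in \<open>auto\<close>)
  moreover have "(\<integral>x. indicator {-R..R} x *\<^sub>R f x \<partial>lborel) = integral {-R..R} f" for R
    using set_borel_integral_eq_integral(2)[of "{-R..R}" f] assms
      integrable_mult_indicator[of "{-R..R}" lborel f]
    by (simp add: set_lebesgue_integral_def set_integrable_def)
  ultimately show ?thesis by simp
qed

lemma bs_half_plane: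
  fixes g :: "real poly"
  assumes \<rho>: "Im \<rho> > 0" and n: "n \<ge> 1" and g: "degree g < n"
  shows "((\<lambda>R. integral {-R..R} (\<lambda>x. of_real (poly g x) / (of_real (poly (P (n - 1)) x) + cnj \<rho> * of_real (poly (P n) x))))
     \<longlongrightarrow> - (\<i> * pi * (coeff g (n - 1) / (cnj \<rho> * coeff (P n) n)))) at_top"
proof -
  define D where "D = map_poly complex_of_real (P (n - 1)) + smult (cnj \<rho>) (map_poly of_real (P n))"
  obtain m where m: "n = Suc m" using n by (cases n) auto
  have \<rho>0: "\<rho> \<noteq> 0" using \<rho> by auto
  have pD: "poly D z = cP (n - 1) z + cnj \<rho> * cP n z" for z by (simp add: D_def cP_def)
  have dm: "degree (map_poly complex_of_real q) = degree q" for q by (simp add: degree_map_poly)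
  have dD: "degree D = n" unfolding D_def using \<rho>0 by (subst degree_add_eq_right) (auto simp: dm m)
  have cD: "coeff D n = cnj \<rho> * coeff (P n) n"
    by (simp add: D_def coeff_map_poly m coeff_eq_0)
  have "((\<lambda>R. integral {-R..R} (\<lambda>x. poly (map_poly of_real g) (of_real x) / poly D (of_real x)))
     \<longlongrightarrow> - (\<i> * pi * (coeff (map_poly of_real g) (degree D - 1) / lead_coeff D))) at_top"
  proof (rule half_plane_quotient_integral)
    show "degree (map_poly complex_of_real g) < degree D" using g by (simp add: dm dD)
    show "poly D z \<noteq> 0" if "Im z \<ge> 0" for z
      using cP_combination_nonzero[OF that \<rho>, of m] unfolding pD by (simp add: m)
  qed
  moreover have "poly (map_poly of_real g) (of_real x) = complex_of_real (poly g x)" for x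
    by (induction g) (auto simp: map_poly_pCons)
  ultimately show ?thesis by (simp add: pD cP_of_real dD cD coeff_map_poly)
qed

lemma bs_weight_eq_Im:
  assumes "Im \<rho> > 0" "n \<ge> 1"
  shows "poly (P (n - 1)) x * bs_weight \<rho> n x =
      - Im (cnj \<rho> / (of_real (poly (P (n - 1)) x) + cnj \<rho> * of_real (poly (P n) x))) / (pi * a (n - 1))"
    and "poly (P n) x * bs_weight \<rho> n x =
      Im (1 / (of_real (poly (P (n - 1)) x) + cnj \<rho> * of_real (poly (P n) x))) / (pi * a (n - 1))"
proof -
  define u v where "u = poly (P (n - 1)) x" "v = poly (P n) x"
  define d where "d = (cmod (of_real u + \<rho> * of_real v))\<^sup>2"
  have d: "d > 0" using bs_denominator_pos[of \<rho> n x] assms by (simp add: d_def u_v_def)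
  have d2: "d = (u + Re \<rho> * v)\<^sup>2 + (Im \<rho> * v)\<^sup>2" unfolding d_def cmod_power2 by simp
  have *: "bs_weight \<rho> n x = Im \<rho> / (pi * a (n - 1) * d)"
    using assms by (simp add: bs_weight_def d_def u_v_def)
  show "poly (P (n - 1)) x * bs_weight \<rho> n x =
      - Im (cnj \<rho> / (of_real (poly (P (n - 1)) x) + cnj \<rho> * of_real (poly (P n) x))) / (pi * a (n - 1))"
    unfolding * u_v_def[symmetric] Im_divide using d by (simp add: d2 field_simps power2_eq_square)
  show "poly (P n) x * bs_weight \<rho> n x =
      Im (1 / (of_real (poly (P (n - 1)) x) + cnj \<rho> * of_real (poly (P n) x))) / (pi * a (n - 1))"
    unfolding * u_v_def[symmetric] Im_divide using d by (simp add: d2 field_simps power2_eq_square)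
qed

text \<open>On the real line \<open>p\<^sub>n\<^sub>-\<^sub>1\<close> and \<open>p\<^sub>n\<close> times the weight are imaginary parts of rational functions
  without poles in the upper half plane.\<close>

lemma bs_moment_base:
  assumes \<rho>: "Im \<rho> > 0" and n: "n \<ge> 1"
  shows "degree g < n \<Longrightarrow> (\<integral>x. poly g x * poly (P (n - 1)) x * bs_weight \<rho> n x \<partial>lborel) = coeff g (n - 1) / coeff (P (n - 1)) (n - 1)"
    and "degree g + 1 < n \<Longrightarrow> (\<integral>x. poly g x * poly (P n) x * bs_weight \<rho> n x \<partial>lborel) = 0"
proof -
  obtain m where m: "n = Suc m" using n by (cases n) auto
  define D where "D x = of_real (poly (P (n - 1)) x) + cnj \<rho> * of_real (poly (P n) x)" for x
  have D0: "D x \<noteq> 0" for x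
    using cP_combination_nonzero[of "of_real x" \<rho> m] \<rho> by (simp add: D_def m cP_of_real)
  have \<rho>0: "\<rho> \<noteq> 0" using \<rho> by auto
  have kk: "coeff (P n) n * a (n - 1) = coeff (P (n - 1)) (n - 1)" using coeff_P_Suc[of m] by (simp add: m del: orth_poly.simps)
  have Im_rmult: "Im (of_real r * c) = r * Im c" for r c by simp
  have int: "(\<lambda>x. of_real (poly h x) / D x) integrable_on {-R..R}" for h R
    unfolding D_def using D0 by (intro integrable_continuous_real continuous_intros) (auto simp: D_def)
  have key: "((\<lambda>R. integral {-R..R} (\<lambda>x. Im (c * (of_real (poly g x) / D x)) / (pi * a (n - 1)))) \<longlongrightarrow>
      Im (c * - (\<i> * pi * (coeff g (n - 1) / (cnj \<rho> * coeff (P n) n)))) / (pi * a (n - 1))) at_top"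
    if "degree g < n" for c
  proof -
    have "((\<lambda>R. Im (c * integral {-R..R} (\<lambda>x. of_real (poly g x) / D x)) / (pi * a (n - 1))) \<longlongrightarrow>
      Im (c * - (\<i> * pi * (coeff g (n - 1) / (cnj \<rho> * coeff (P n) n)))) / (pi * a (n - 1))) at_top"
      using bs_half_plane[OF \<rho> n that] unfolding D_def by (intro tendsto_intros) auto
    moreover have "Im (c * integral {-R..R} (\<lambda>x. of_real (poly g x) / D x)) / (pi * a (n - 1)) =
       integral {-R..R} (\<lambda>x. Im (c * (of_real (poly g x) / D x)) / (pi * a (n - 1)))" for R
    proof -
      have "((\<lambda>x. Im (c * (of_real (poly g x) / D x)) / (pi * a (n - 1))) has_integral
         Im (c * integral {-R..R} (\<lambda>x. of_real (poly g x) / D x)) / (pi * a (n - 1))) {-R..R}"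
        by (intro has_integral_divide has_integral_Im has_integral_mult_right integrable_integral int)
      then show ?thesis by (rule integral_unique[symmetric])
    qed
    ultimately show ?thesis by simp
  qed
  {
    assume g: "degree g < n"
    have "integrable lborel (\<lambda>x. poly (g * P (n - 1)) x * bs_weight \<rho> n x)"
      using g n degree_mult_le[of g "P (n - 1)"] by (intro bs_weight_integrable[OF \<rho> n]) simp
    from tendsto_integral_symmetric[OF this]
    have "((\<lambda>R. integral {-R..R} (\<lambda>x. Im ((- cnj \<rho>) * (of_real (poly g x) / D x)) / (pi * a (n - 1)))) \<longlongrightarrow>
       (\<integral>x. poly g x * poly (P (n - 1)) x * bs_weight \<rho> n x \<partial>lborel)) at_top"
    proof -
      have "poly (g * P (n - 1)) x * bs_weight \<rho> n x = Im ((- cnj \<rho>) * (of_real (poly g x) / D x)) / (pi * a (n - 1))" for x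
      proof -
        have "Im ((- cnj \<rho>) * (of_real (poly g x) / D x)) = Im (of_real (poly g x) * (- (cnj \<rho> / D x)))"
          by (simp add: mult_ac)
        also have "\<dots> = poly g x * (- Im (cnj \<rho> / D x))" by (simp only: Im_rmult uminus_complex.sel)
        finally show ?thesis using bs_weight_eq_Im(1)[OF \<rho> n, of x] unfolding D_def[symmetric]
          by (simp add: mult.assoc)
      qed
      then show ?thesis using \<open>((\<lambda>R. integral {-R..R} _) \<longlongrightarrow> _) at_top\<close> by (simp add: mult.assoc)
    qed
    from tendsto_unique[OF _ this key[OF g]]
    have "(\<integral>x. poly g x * poly (P (n - 1)) x * bs_weight \<rho> n x \<partial>lborel) =
       Im ((- cnj \<rho>) * - (\<i> * pi * (coeff g (n - 1) / (cnj \<rho> * coeff (P n) n)))) / (pi * a (n - 1))" by simp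
    \<comment> \<open>The factor \<open>cnj \<rho>\<close> in the integrand belonging to
      \<open>P (n - 1)\<close> cancels the one in the leading coefficient, which leaves a purely
      imaginary value free of \<rho>.\<close>
    also have "(- cnj \<rho>) * - (\<i> * pi * (coeff g (n - 1) / (cnj \<rho> * coeff (P n) n))) = \<i> * of_real (pi * (coeff g (n - 1) / coeff (P n) n))"
      using \<rho>0 by simp
    also have "Im \<dots> / (pi * a (n - 1)) = coeff g (n - 1) / (coeff (P n) n * a (n - 1))" by simp
    finally show "(\<integral>x. poly g x * poly (P (n - 1)) x * bs_weight \<rho> n x \<partial>lborel) = coeff g (n - 1) / coeff (P (n - 1)) (n - 1)"
      unfolding kk .
  }
  {
    assume g: "degree g + 1 < n"
    then have c0: "coeff g (n - 1) = 0" by (intro coeff_eq_0) auto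
    have "integrable lborel (\<lambda>x. poly (g * P n) x * bs_weight \<rho> n x)"
      using g n degree_mult_le[of g "P n"] by (intro bs_weight_integrable[OF \<rho> n]) simp
    from tendsto_integral_symmetric[OF this]
    have "((\<lambda>R. integral {-R..R} (\<lambda>x. Im (1 * (of_real (poly g x) / D x)) / (pi * a (n - 1)))) \<longlongrightarrow>
       (\<integral>x. poly g x * poly (P n) x * bs_weight \<rho> n x \<partial>lborel)) at_top"
    proof -
      have "poly (g * P n) x * bs_weight \<rho> n x = Im (1 * (of_real (poly g x) / D x)) / (pi * a (n - 1))" for x
      proof -
        have "Im (1 * (of_real (poly g x) / D x)) = Im (of_real (poly g x) * (1 / D x))" by simp
        also have "\<dots> = poly g x * Im (1 / D x)" by (simp only: Im_rmult)
        finally show ?thesis using bs_weight_eq_Im(2)[OF \<rho> n, of x] unfolding D_def[symmetric]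
          by (simp add: mult.assoc)
      qed
      then show ?thesis using \<open>((\<lambda>R. integral {-R..R} _) \<longlongrightarrow> _) at_top\<close> by (simp add: mult.assoc)
    qed
    from tendsto_unique[OF _ this key[of 1]] g
    show "(\<integral>x. poly g x * poly (P n) x * bs_weight \<rho> n x \<partial>lborel) = 0" by (simp add: c0[simplified])
  }
qed

text \<open>Downward induction on \<open>j\<close> by the three-term recurrence, starting from \<open>j = n\<close> and \<open>j = n - 1\<close>.\<close>

lemma bs_moment:
  assumes \<rho>: "Im \<rho> > 0" and n: "n \<ge> 1" and j: "j < n" and g: "degree g \<le> j"
  shows "(\<integral>x. poly g x * poly (P j) x * bs_weight \<rho> n x \<partial>lborel) = coeff g j / coeff (P j) j"
proof -
  \<comment> \<open>Two consecutive indices are carried along. The second claim stops one degree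
    short of full orthogonality: for \<open>P n\<close> itself, degree \<open>n - 1\<close> already
    leaves the range of \<open>bs_weight_integrable\<close>.\<close>
  have "(\<forall>g. degree g \<le> n - Suc l \<longrightarrow> (\<integral>x. poly g x * poly (P (n - Suc l)) x * bs_weight \<rho> n x \<partial>lborel) = coeff g (n - Suc l) / coeff (P (n - Suc l)) (n - Suc l))
    \<and> (\<forall>g. degree g + 1 < n - l \<longrightarrow> (\<integral>x. poly g x * poly (P (n - l)) x * bs_weight \<rho> n x \<partial>lborel) = 0)" if "l < n" for l
    using that
  proof (induction l)
    case 0
    then show ?case using bs_moment_base[OF \<rho> n] by auto
  next
    case (Suc l)
    define j where "j = n - Suc (Suc l)"
    have j: "n - Suc l = Suc j" "n - l = Suc (Suc j)" "n - Suc (Suc l) = j" "Suc (Suc j) \<le> n" using Suc.prems by (auto simp: j_def)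
    note IH = Suc.IH[unfolded j]
    have 1: "(\<integral>x. poly g x * poly (P j) x * bs_weight \<rho> n x \<partial>lborel) = coeff g j / coeff (P j) j" if g: "degree g \<le> j" for g
    proof -
      let ?h = "g * [:- b (Suc j), 1:]"
      have dh: "degree ?h \<le> Suc j" using degree_mult_le[of g "[:- b (Suc j), 1:]"] g by simp
      have ch: "coeff ?h (Suc j) = coeff g j"
        using g by (simp add: coeff_eq_0 mult.commute[of g])
      have i1: "integrable lborel (\<lambda>x. poly (?h * P (Suc j)) x * bs_weight \<rho> n x)"
        using dh degree_mult_le[of ?h "P (Suc j)"] j(4) by (intro bs_weight_integrable[OF \<rho> n]) (simp del: mult_pCons_right orth_poly.simps)
      have i2: "integrable lborel (\<lambda>x. poly (g * P (Suc (Suc j))) x * bs_weight \<rho> n x)"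
        using g degree_mult_le[of g "P (Suc (Suc j))"] j(4) by (intro bs_weight_integrable[OF \<rho> n]) (simp del: orth_poly.simps)
      have rec: "a j * poly (P j) x = (x - b (Suc j)) * poly (P (Suc j)) x - a (Suc j) * poly (P (Suc (Suc j))) x" for x
        by (simp add: algebra_simps)
      have "a j * (\<integral>x. poly g x * poly (P j) x * bs_weight \<rho> n x \<partial>lborel) =
         (\<integral>x. poly g x * (a j * poly (P j) x) * bs_weight \<rho> n x \<partial>lborel)"
        by (subst integral_mult_right_zero[symmetric]) (simp add: mult_ac)
      also have "\<dots> = (\<integral>x. poly (?h * P (Suc j)) x * bs_weight \<rho> n x - a (Suc j) * (poly (g * P (Suc (Suc j))) x * bs_weight \<rho> n x) \<partial>lborel)"
        unfolding rec by (intro Bochner_Integration.integral_cong refl) (simp add: algebra_simps del: orth_poly.simps)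
      also have "\<dots> = (\<integral>x. poly (?h * P (Suc j)) x * bs_weight \<rho> n x \<partial>lborel) - a (Suc j) * (\<integral>x. poly (g * P (Suc (Suc j))) x * bs_weight \<rho> n x \<partial>lborel)"
        using i1 i2 by (simp del: mult_pCons_right orth_poly.simps poly_mult)
      also have "(\<integral>x. poly (?h * P (Suc j)) x * bs_weight \<rho> n x \<partial>lborel) = coeff ?h (Suc j) / coeff (P (Suc j)) (Suc j)"
        using IH Suc.prems dh unfolding poly_mult[of ?h "P (Suc j)"] by (metis Suc_lessD)
      also have "(\<integral>x. poly (g * P (Suc (Suc j))) x * bs_weight \<rho> n x \<partial>lborel) = 0"
        using IH Suc.prems g unfolding poly_mult by auto
      finally have "a j * (\<integral>x. poly g x * poly (P j) x * bs_weight \<rho> n x \<partial>lborel) = coeff g j / (coeff (P j) j / a j)"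
        unfolding ch by (simp only: coeff_P_Suc mult_zero_right diff_zero)
      also have "\<dots> = a j * (coeff g j / coeff (P j) j)" by simp
      finally show ?thesis using mult_left_cancel[OF a_nz[of j]] by blast
    qed
    have 2: "(\<integral>x. poly g x * poly (P (Suc j)) x * bs_weight \<rho> n x \<partial>lborel) = 0" if g: "degree g + 1 < Suc j" for g
      using IH Suc.prems g coeff_eq_0[of g "Suc j"] by auto
    show ?case unfolding j using 1 2 by auto
  qed
  from this[of "n - Suc j"] j g show ?thesis by simp
qed

lemma bs_orthonormal:
  assumes \<rho>: "Im \<rho> > 0" and "i < n" "j < n"
  shows "(\<integral>x. poly (P i) x * poly (P j) x * bs_weight \<rho> n x \<partial>lborel) = (if i = j then 1 else 0)"
proof -
  have n: "n \<ge> 1" using assms by auto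
  have *: "(\<integral>x. poly (P i) x * poly (P j) x * bs_weight \<rho> n x \<partial>lborel) = (if i = j then 1 else 0)" if "i \<le> j" "j < n" for i j
    using bs_moment[OF \<rho> n \<open>j < n\<close>, of "P i"] that lead_coeff_P_pos[of j] by (auto simp: coeff_eq_0)
  show ?thesis using *[of i j] *[of j i] assms by (cases "i \<le> j") (auto simp: mult.commute)
qed

end

section \<open>Weak limits\<close>

lemma abs_diff_clip_le:
  fixes y R :: real
  assumes "R > 0"
  shows "\<bar>y - max (-R) (min R y)\<bar> \<le> y\<^sup>2 / R"
proof (cases "\<bar>y\<bar> \<le> R")
  case True
  then show ?thesis using assms by (auto simp: abs_le_iff max_def min_def)
next
  case False
  then have "\<bar>y - max (-R) (min R y)\<bar> \<le> \<bar>y\<bar>" using assms by (auto simp: max_def min_def abs_if)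
  also have "\<dots> \<le> y\<^sup>2 / R"
  proof -
    have "\<bar>y\<bar> * R \<le> \<bar>y\<bar> * \<bar>y\<bar>" using False by (intro mult_left_mono) auto
    then show ?thesis using assms by (simp add: field_simps power2_eq_square)
  qed
  finally show ?thesis .
qed

text \<open>Weak convergence tests bounded functions only. A common bound on second moments makes
  \<open>f\<close> uniformly integrable: clipping it at height \<open>R\<close> changes each
  integral by at most \<open>C / R\<close>, and the limit measure inherits the bound by monotone
  convergence of the truncated squares.\<close>

lemma weak_conv_integral_square_bounded:
  fixes f :: "real \<Rightarrow> real"
  assumes \<mu>: "\<And>n. real_distribution (\<mu> n)" and M: "real_distribution M" and conv: "weak_conv_m \<mu> M"
    and cont: "continuous_on UNIV f"
    and int: "\<forall>\<^sub>F n in sequentially. integrable (\<mu> n) (\<lambda>x. (f x)\<^sup>2) \<and> (\<integral>x. (f x)\<^sup>2 \<partial>\<mu> n) \<le> C"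
  shows "integrable M (\<lambda>x. (f x)\<^sup>2)" "(\<lambda>n. \<integral>x. f x \<partial>\<mu> n) \<longlonglongrightarrow> (\<integral>x. f x \<partial>M)"
proof -
  interpret M: real_distribution M by fact
  interpret \<mu>: real_distribution "\<mu> n" for n by fact
  have fm [measurable]: "f \<in> borel_measurable borel" using cont by (rule borel_measurable_continuous_onI)
  have f\<mu> [measurable]: "f \<in> borel_measurable (\<mu> n)" for n using fm by (simp cong: measurable_cong_sets)
  have fM [measurable]: "f \<in> borel_measurable M" using fm by (simp cong: measurable_cong_sets)
  have isc: "isCont f x" for x using cont by (simp add: continuous_on_eq_continuous_at)
  obtain n0 where n0: "\<And>n. n \<ge> n0 \<Longrightarrow> integrable (\<mu> n) (\<lambda>x. (f x)\<^sup>2)" "\<And>n. n \<ge> n0 \<Longrightarrow> (\<integral>x. (f x)\<^sup>2 \<partial>\<mu> n) \<le> C"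
    using int unfolding eventually_sequentially by auto
  have C0: "C \<ge> 0" by (rule order_trans[OF Bochner_Integration.integral_nonneg n0(2)[OF order_refl]]) simp
  have bound: "(\<integral>x. min R ((f x)\<^sup>2) \<partial>M) \<le> C" if "R \<ge> 0" for R
  proof -
    have lim: "(\<lambda>n. \<integral>x. min R ((f x)\<^sup>2) \<partial>\<mu> n) \<longlonglongrightarrow> (\<integral>x. min R ((f x)\<^sup>2) \<partial>M)"
      by (rule weak_conv_imp_integral_bdd_continuous_conv[OF \<mu> M conv, where B = R])
        (use isc that in \<open>auto intro!: continuous_intros\<close>)
    have le: "(\<integral>x. min R ((f x)\<^sup>2) \<partial>\<mu> n) \<le> C" if "n \<ge> n0" for n
    proof -
      have "(\<integral>x. min R ((f x)\<^sup>2) \<partial>\<mu> n) \<le> (\<integral>x. (f x)\<^sup>2 \<partial>\<mu> n)"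
        using n0(1)[OF that] \<open>R \<ge> 0\<close>
        by (intro integral_mono Bochner_Integration.integrable_bound[OF n0(1)[OF that]]) auto
      then show ?thesis using n0(2)[OF that] by linarith
    qed
    show ?thesis by (rule LIMSEQ_le_const2[OF lim]) (use le in auto)
  qed
  have mint: "integrable M (\<lambda>x. min R ((f x)\<^sup>2))" if "R \<ge> 0" for R
    by (rule M.integrable_const_bound[where B = R]) (use that in auto)
  have "(\<integral>\<^sup>+x. ennreal ((f x)\<^sup>2) \<partial>M) \<le> ennreal C"
  proof -
    have eq: "ennreal ((f x)\<^sup>2) = (SUP k. ennreal (min (real k) ((f x)\<^sup>2)))" for x
    proof (rule antisym)
      obtain k :: nat where "(f x)\<^sup>2 \<le> real k" using real_arch_simple by blast
      then show "ennreal ((f x)\<^sup>2) \<le> (SUP k. ennreal (min (real k) ((f x)\<^sup>2)))"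
        by (intro SUP_upper2[of k]) (auto simp: min_def)
      show "(SUP k. ennreal (min (real k) ((f x)\<^sup>2))) \<le> ennreal ((f x)\<^sup>2)"
        by (intro SUP_least ennreal_leI) auto
    qed
    have "(\<integral>\<^sup>+x. ennreal ((f x)\<^sup>2) \<partial>M) = (SUP k. \<integral>\<^sup>+x. ennreal (min (real k) ((f x)\<^sup>2)) \<partial>M)"
      unfolding eq by (rule nn_integral_monotone_convergence_SUP)
        (auto simp: incseq_def le_fun_def intro!: ennreal_leI)
    also have "\<dots> \<le> ennreal C"
    proof (rule SUP_least)
      fix k :: nat
      have "(\<integral>\<^sup>+x. ennreal (min (real k) ((f x)\<^sup>2)) \<partial>M) = ennreal (\<integral>x. min (real k) ((f x)\<^sup>2) \<partial>M)"
        by (rule nn_integral_eq_integral[OF mint]) auto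
      then show "(\<integral>\<^sup>+x. ennreal (min (real k) ((f x)\<^sup>2)) \<partial>M) \<le> ennreal C"
        using bound[of "real k"] by (simp add: ennreal_leI)
    qed
    finally show ?thesis .
  qed
  note nnC = this
  show int2: "integrable M (\<lambda>x. (f x)\<^sup>2)"
    by (rule integrableI_bounded) (use nnC in \<open>auto simp: top_unique intro: le_less_trans\<close>)
  have sqC: "(\<integral>x. (f x)\<^sup>2 \<partial>M) \<le> C"
    using nnC nn_integral_eq_integral[OF int2] C0 by (simp add: ennreal_le_iff)
  have clip: "\<bar>(\<integral>x. f x \<partial>N) - (\<integral>x. max (-R) (min R (f x)) \<partial>N)\<bar> \<le> C / R"
    if N: "real_distribution N" and i: "integrable N (\<lambda>x. (f x)\<^sup>2)" "(\<integral>x. (f x)\<^sup>2 \<partial>N) \<le> C" and "R > 0" for N R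
  proof -
    interpret N: real_distribution N by fact
    have fN [measurable]: "f \<in> borel_measurable N" using fm by (simp cong: measurable_cong_sets)
    have i1: "integrable N f" by (rule N.square_integrable_imp_integrable[OF fN i(1)])
    have i2: "integrable N (\<lambda>x. max (-R) (min R (f x)))"
      by (rule N.integrable_const_bound[where B = R]) (use \<open>R > 0\<close> in auto)
    have "\<bar>\<integral>x. f x - max (-R) (min R (f x)) \<partial>N\<bar> \<le> (\<integral>x. (f x)\<^sup>2 / R \<partial>N)"
      by (rule order_trans[OF integral_abs_bound], rule integral_mono)
        (use i i1 i2 abs_diff_clip_le[OF \<open>R > 0\<close>] in auto)
    also have "\<dots> \<le> C / R" using i(2) \<open>R > 0\<close> by (simp add: divide_right_mono)
    finally show ?thesis using i1 i2 by simp
  qed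
  show "(\<lambda>n. \<integral>x. f x \<partial>\<mu> n) \<longlonglongrightarrow> (\<integral>x. f x \<partial>M)"
  proof (rule LIMSEQ_I)
    fix e :: real assume "e > 0"
    define R where "R = 3 * (C + 1) / e"
    have R: "R > 0" using \<open>e > 0\<close> C0 by (simp add: R_def)
    have CR: "C / R < e / 3" using \<open>e > 0\<close> C0 by (simp add: R_def field_simps)
    have "(\<lambda>n. \<integral>x. max (-R) (min R (f x)) \<partial>\<mu> n) \<longlonglongrightarrow> (\<integral>x. max (-R) (min R (f x)) \<partial>M)"
      by (rule weak_conv_imp_integral_bdd_continuous_conv[OF \<mu> M conv, where B = R])
        (use isc R in \<open>auto intro!: continuous_intros\<close>)
    from LIMSEQ_D[OF this, of "e/3"] \<open>e > 0\<close> obtain n1 where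
      n1: "\<And>n. n \<ge> n1 \<Longrightarrow> \<bar>(\<integral>x. max (-R) (min R (f x)) \<partial>\<mu> n) - (\<integral>x. max (-R) (min R (f x)) \<partial>M)\<bar> < e / 3" by auto
    have "norm ((\<integral>x. f x \<partial>\<mu> n) - (\<integral>x. f x \<partial>M)) < e" if "n \<ge> max n0 n1" for n
      using clip[OF \<mu> n0(1) n0(2) R, of n] clip[OF M int2 sqC R] n1[of n] that CR
      unfolding real_norm_def by linarith
    then show "\<exists>no. \<forall>n\<ge>no. norm ((\<integral>x. f x \<partial>\<mu> n) - (\<integral>x. f x \<partial>M)) < e" by blast
  qed
qed

lemma tight_second_moment:
  assumes \<mu>: "\<And>n. real_distribution (\<mu> n)"
    and int: "\<And>n. integrable (\<mu> n) (\<lambda>x. x\<^sup>2)" "\<And>n. (\<integral>x. x\<^sup>2 \<partial>\<mu> n) \<le> C"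
  shows "tight \<mu>"
  unfolding tight_def
proof (intro conjI allI impI)
  show "real_distribution (\<mu> n)" for n by fact
  fix e :: real assume e: "e > 0"
  interpret \<mu>: real_distribution "\<mu> n" for n by fact
  have C0: "C \<ge> 0" by (rule order_trans[OF Bochner_Integration.integral_nonneg int(2)[of 0]]) simp
  \<comment> \<open>Chebyshev's inequality bounds the mass outside by \<open>C / R\<^sup>2\<close>;
    the \<open>+ 1\<close> keeps \<open>R\<close> positive and the final estimate strict.\<close>
  define R where "R = sqrt ((C + 1) / e)"
  have R: "R > 0" "R\<^sup>2 = (C + 1) / e" using e C0 by (auto simp: R_def)
  have "1 - e < measure (\<mu> n) {-R<..R}" for n
  proof -
    have "measure (\<mu> n) (- {-R<..R}) = (\<integral>x. indicator (- {-R<..R}) x \<partial>\<mu> n)" by simp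
    also have "\<dots> \<le> (\<integral>x. x\<^sup>2 / R\<^sup>2 \<partial>\<mu> n)"
    proof (rule integral_mono)
      fix x :: real
      have "R\<^sup>2 \<le> x\<^sup>2" if "x \<notin> {-R<..R}" using that R(1) abs_le_square_iff[of R x] by auto
      then show "indicator (- {-R<..R}) x \<le> x\<^sup>2 / R\<^sup>2"
        using R(1) by (auto simp: indicator_def)
    qed (use int(1) in \<open>auto intro!: integrable_real_indicator simp: less_top[symmetric]\<close>)
    also have "\<dots> \<le> C / R\<^sup>2" using int(2)[of n] R(1) by (simp add: divide_right_mono)
    also have "\<dots> < e" using e C0 by (simp add: R(2) field_simps)
    finally have "measure (\<mu> n) (- {-R<..R}) < e" .
    moreover have "measure (\<mu> n) (- {-R<..R}) = 1 - measure (\<mu> n) {-R<..R}"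
      using \<mu>.prob_compl[of "{-R<..R}" n] by (simp add: Compl_eq_Diff_UNIV)
    ultimately show ?thesis by linarith
  qed
  then show "\<exists>a b. a < b \<and> (\<forall>n. 1 - e < measure (\<mu> n) {a<..b})"
    using R(1) by (intro exI[of _ "-R"] exI[of _ R]) auto
qed

text \<open>Every polynomial is controlled through the moment of its square, which is eventually
  constant; the square of the identity supplies tightness.\<close>

lemma weak_limit_with_moments:
  assumes \<mu>: "\<And>n. real_distribution (\<mu> n)"
    and mom: "\<And>f::real poly. \<exists>C. \<forall>\<^sub>F n in sequentially. integrable (\<mu> n) (poly f) \<and> (\<integral>x. poly f x \<partial>\<mu> n) = C"
  obtains r M where "strict_mono (r :: nat \<Rightarrow> nat)" "real_distribution M" "weak_conv_m (\<mu> \<circ> r) M"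
    "\<And>f. integrable M (poly f)" "\<And>f. (\<lambda>n. \<integral>x. poly f x \<partial>\<mu> (r n)) \<longlonglongrightarrow> (\<integral>x. poly f x \<partial>M)"
proof -
  obtain C n0 where n0: "\<And>n. n \<ge> n0 \<Longrightarrow> integrable (\<mu> n) (poly ([:0, 1:]\<^sup>2)) \<and> (\<integral>x. poly ([:0, 1:]\<^sup>2) x \<partial>\<mu> n) = C"
    using mom[of "[:0, 1:]\<^sup>2"] unfolding eventually_sequentially by blast
  have sq: "poly ([:0, 1::real:]\<^sup>2) = (\<lambda>x. x\<^sup>2)" by (auto simp: fun_eq_iff)
  \<comment> \<open>Tightness is derived from a bound at every index, while the moments are constant
    only from \<open>n0\<close> on, hence the shift.\<close>
  have "tight (\<lambda>n. \<mu> (n + n0))"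
    by (rule tight_second_moment[where C = C]) (use \<mu> n0[unfolded sq] in auto)
  from tight_imp_convergent_subsubsequence[OF this strict_mono_id]
  obtain r M where r: "strict_mono r" and M: "real_distribution M"
    and conv: "weak_conv_m ((\<lambda>n. \<mu> (n + n0)) \<circ> id \<circ> r) M" by blast
  define s where "s n = r n + n0" for n
  have s: "strict_mono s" using r by (simp add: s_def strict_mono_def)
  have conv: "weak_conv_m (\<mu> \<circ> s) M" using conv by (simp add: s_def comp_def)
  interpret M: real_distribution M by fact
  have "integrable M (\<lambda>x. (poly f x)\<^sup>2) \<and> (\<lambda>n. \<integral>x. poly f x \<partial>\<mu> (s n)) \<longlonglongrightarrow> (\<integral>x. poly f x \<partial>M)" for f
  proof -
    obtain D where "\<forall>\<^sub>F n in sequentially. integrable (\<mu> n) (poly (f\<^sup>2)) \<and> (\<integral>x. poly (f\<^sup>2) x \<partial>\<mu> n) = D"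
      using mom by blast
    then have "\<forall>\<^sub>F n in sequentially. integrable (\<mu> n) (\<lambda>x. (poly f x)\<^sup>2) \<and> (\<integral>x. (poly f x)\<^sup>2 \<partial>\<mu> n) \<le> D"
      by eventually_elim (simp add: poly_power[abs_def])
    from eventually_compose_filterlim[OF this filterlim_subseq[OF s]]
    have *: "\<forall>\<^sub>F n in sequentially. integrable ((\<mu> \<circ> s) n) (\<lambda>x. (poly f x)\<^sup>2) \<and> (\<integral>x. (poly f x)\<^sup>2 \<partial>(\<mu> \<circ> s) n) \<le> D"
      by (simp add: comp_def)
    have "\<And>n. real_distribution ((\<mu> \<circ> s) n)" using \<mu> by simp
    moreover have "continuous_on UNIV (poly f)" using continuous_on_poly[of UNIV "\<lambda>x. x" f] by simp
    ultimately show ?thesis using weak_conv_integral_square_bounded[OF _ M conv _ *]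
      by (auto simp: comp_def)
  qed
  note * = this
  have "integrable M (poly f)" for f
    by (rule M.square_integrable_imp_integrable)
      (use * continuous_on_poly[of UNIV "\<lambda>x. x" f] in \<open>auto intro!: M.measurable_finite_borel borel_measurable_continuous_onI\<close>)
  with that[OF s M conv] * show thesis by blast
qed

text \<open>Interval masses pass to a weak limit when the endpoints carry no mass. Such endpoints
  are dense, and enclosing a point between them shows that \<open>M\<close> has no atom in the open
  interval; after that all subintervals are accessible. The margins around \<open>{l'..u'}\<close>
  are there because the behaviour at \<open>l\<close> and \<open>u\<close> is unknown.\<close>

lemma weak_limit_density:
  fixes w :: "real \<Rightarrow> real"
  assumes \<mu>: "\<And>n. real_distribution (\<mu> n)" and M: "real_distribution M" and conv: "weak_conv_m \<mu> M"
    and cont: "continuous_on {l..u} w" and w0: "\<And>x. x \<in> {l..u} \<Longrightarrow> w x \<ge> 0"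
    and lim: "\<And>c d. l < c \<Longrightarrow> c < d \<Longrightarrow> d < u \<Longrightarrow>
       (\<lambda>n. measure (\<mu> n) {c..d}) \<longlonglongrightarrow> (\<integral>x. indicator {c..d} x * w x \<partial>lborel)"
    and lu: "l < l'" "l' < u'" "u' < u"
  shows "restrict_space M {l'..u'} = density (restrict_space lborel {l'..u'}) (\<lambda>x. ennreal (w x))"
proof -
  interpret M: real_distribution M by fact
  have "bounded (w ` {l..u})" by (rule compact_imp_bounded[OF compact_continuous_image[OF cont]]) simp
  then obtain C where C: "\<And>x. x \<in> {l..u} \<Longrightarrow> \<bar>w x\<bar> \<le> C" unfolding bounded_iff by (metis imageI real_norm_def)
  define v where "v x = indicator {l..u} x * w x" for x
  have vm [measurable]: "v \<in> borel_measurable borel"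
  proof -
    have "(\<lambda>x. if x \<in> {l..u} then w x else 0) \<in> borel_measurable borel"
      by (rule borel_measurable_continuous_on_if) (use cont in auto)
    moreover have "v = (\<lambda>x. if x \<in> {l..u} then w x else 0)" by (auto simp: v_def)
    ultimately show ?thesis by simp
  qed
  have v0: "v x \<ge> 0" for x using w0 by (auto simp: v_def indicator_def)
  have C0: "C \<ge> 0" using C[of l] lu by force
  have vC: "v x \<le> C" for x using C[of x] C0 by (auto simp: v_def indicator_def)
  have nnI: "(\<integral>\<^sup>+x. ennreal (v x) * indicator {c..d} x \<partial>lborel) = ennreal (\<integral>x. indicator {c..d} x * w x \<partial>lborel)"
    if "l < c" "d < u" for c d
  proof -
    have eq: "indicator {c..d} x * w x = indicator {c..d} x * v x" for x
      using that by (auto simp: v_def indicator_def)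
    have int: "integrable lborel (\<lambda>x. indicator {c..d} x * v x)"
    proof (rule Bochner_Integration.integrable_bound)
      show "integrable lborel (\<lambda>x. C * indicator {c..d} x)"
        by (rule integrable_mult_right[OF integrable_real_indicator]) (auto simp: emeasure_lborel_Icc_eq)
      show "AE x in lborel. norm (indicator {c..d} x * v x) \<le> norm (C * indicator {c..d} x)"
        using v0 vC C0 by (intro AE_I2) (simp add: indicator_def)
    qed auto
    have "(\<integral>\<^sup>+x. ennreal (v x) * indicator {c..d} x \<partial>lborel) = (\<integral>\<^sup>+x. ennreal (indicator {c..d} x * v x) \<partial>lborel)"
      by (intro nn_integral_cong) (auto simp: indicator_def)
    also have "\<dots> = ennreal (\<integral>x. indicator {c..d} x * v x \<partial>lborel)"
      by (rule nn_integral_eq_integral[OF int]) (use v0 in auto)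
    finally show ?thesis unfolding eq .
  qed
  have Icd: "emeasure M {c..d} = (\<integral>\<^sup>+x. ennreal (v x) * indicator {c..d} x \<partial>lborel)"
    if "l < c" "c < d" "d < u" "measure M {c} = 0" "measure M {d} = 0" for c d
  proof -
    have "frontier {c..d} = {c, d}" using that by (auto simp: frontier_def)
    moreover have "emeasure M {c, d} = 0"
      using that by (subst emeasure_insert) (auto simp: M.emeasure_eq_measure)
    ultimately have "(\<lambda>n. measure (\<mu> n) {c..d}) \<longlonglongrightarrow> measure M {c..d}"
      by (intro weak_conv_imp_continuity_set_conv[OF \<mu> M conv]) auto
    from LIMSEQ_unique[OF this lim[OF that(1-3)]] nnI[OF that(1,3)] show ?thesis
      by (simp add: M.emeasure_eq_measure)
  qed
  have dense: "\<exists>y\<in>{p<..<q}. measure M {y} = 0" if "p < q" for p q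
  proof -
    from open_minus_countable[OF M.countable_atoms, of "{p<..<q}"] that
    obtain y where "y \<in> {p<..<q}" "y \<notin> {x. measure M {x} > 0}" by auto
    then show ?thesis using measure_nonneg[of M "{y}"] by (intro bexI[of _ y]) (auto simp: not_less)
  qed
  have noatom: "measure M {x} = 0" if x: "l < x" "x < u" for x
  proof (rule ccontr)
    assume "measure M {x} \<noteq> 0"
    then have pos: "measure M {x} > 0" using measure_nonneg[of M "{x}"] by linarith
    \<comment> \<open>Chosen so that the density integrates to at most \<open>C * (2 * e)\<close>
      over an interval of length \<open>2 * e\<close>, which is less than the mass of the alleged
      atom.\<close>
    define e where "e = measure M {x} / (2 * (C + 1))"
    have e: "e > 0" using pos C0 by (simp add: e_def)
    obtain c where c: "c \<in> {max l (x - e)<..<x}" "measure M {c} = 0" using dense[of "max l (x - e)" x] x e by auto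
    obtain d where d: "d \<in> {x<..<min u (x + e)}" "measure M {d} = 0" using dense[of x "min u (x + e)"] x e by auto
    have "emeasure M {x} \<le> emeasure M {c..d}" using c d by (intro emeasure_mono) auto
    also have "\<dots> = (\<integral>\<^sup>+x. ennreal (v x) * indicator {c..d} x \<partial>lborel)"
      using c d by (intro Icd) auto
    also have "\<dots> \<le> (\<integral>\<^sup>+x. ennreal C * indicator {c..d} x \<partial>lborel)"
      using vC by (intro nn_integral_mono mult_right_mono ennreal_leI) auto
    also have "\<dots> = ennreal (C * (d - c))"
      using c d C0 by (simp add: nn_integral_cmult_indicator ennreal_mult)
    finally have "measure M {x} \<le> C * (d - c)"
      using c d C0 by (simp add: M.emeasure_eq_measure)
    also have "\<dots> \<le> C * (2 * e)" using c d C0 by (intro mult_left_mono) auto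
    also have "\<dots> < (C + 1) * (2 * e)" using e by simp
    also have "\<dots> = measure M {x}" using C0 by (simp add: e_def field_simps)
    finally show False by simp
  qed
  define d where "d = (u' + u) / 2"
  define c where "c = (l + l') / 2"
  have cd: "l < c" "c < l'" "u' < d" "d < u" using lu by (auto simp: c_def d_def)
  \<comment> \<open>Both measures are cut off to a half-open interval with margins, so that they are
    finite on rays and comparing the rays \<open>{x<..}\<close> becomes comparing intervals.\<close>
  have eq: "density M (indicator {c<..d}) = density lborel (\<lambda>x. ennreal (v x) * indicator {c<..d} x)"
  proof (rule measure_eqI_lessThan)
    show "emeasure (density M (indicator {c<..d})) {x<..} < \<infinity>" for x
    proof -
      have "emeasure (density M (indicator {c<..d})) {x<..} = (\<integral>\<^sup>+z. indicator {c<..d} z * indicator {x<..} z \<partial>M)"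
        by (subst emeasure_density) auto
      also have "\<dots> \<le> (\<integral>\<^sup>+z. 1 \<partial>M)"
        by (intro nn_integral_mono) (simp add: indicator_def)
      finally show ?thesis by (simp add: M.emeasure_eq_measure order_le_less_trans[OF _ ennreal_less_top])
    qed
    fix x :: real
    define y where "y = max x c"
    have 1: "emeasure (density M (indicator {c<..d})) {x<..} = emeasure M {y<..d}"
    proof -
      have "emeasure (density M (indicator {c<..d})) {x<..} = (\<integral>\<^sup>+z. indicator {c<..d} z * indicator {x<..} z \<partial>M)"
        by (subst emeasure_density) auto
      also have "\<dots> = (\<integral>\<^sup>+z. indicator {y<..d} z \<partial>M)"
        by (intro nn_integral_cong) (auto simp: y_def indicator_def)
      finally show ?thesis by simp
    qed
    have 2: "emeasure (density lborel (\<lambda>x. ennreal (v x) * indicator {c<..d} x)) {x<..} = (\<integral>\<^sup>+z. ennreal (v z) * indicator {y<..d} z \<partial>lborel)"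
    proof -
      have "emeasure (density lborel (\<lambda>x. ennreal (v x) * indicator {c<..d} x)) {x<..} = (\<integral>\<^sup>+z. ennreal (v z) * indicator {c<..d} z * indicator {x<..} z \<partial>lborel)"
        by (subst emeasure_density) auto
      also have "\<dots> = (\<integral>\<^sup>+z. ennreal (v z) * indicator {y<..d} z \<partial>lborel)"
        by (intro nn_integral_cong) (auto simp: y_def indicator_def)
      finally show ?thesis .
    qed
    show "emeasure (density M (indicator {c<..d})) {x<..} = emeasure (density lborel (\<lambda>x. ennreal (v x) * indicator {c<..d} x)) {x<..}"
    proof (cases "y < d")
      case True
      have y: "l < y" "y < u" using cd True by (auto simp: y_def)
      have "{y..d} = insert y {y<..d}" using True by auto
      then have "emeasure M {y..d} = emeasure M {y} + emeasure M {y<..d}"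
        by (subst \<open>{y..d} = _\<close>, subst emeasure_insert) auto
      then have "emeasure M {y<..d} = emeasure M {y..d}"
        using noatom[OF y] by (simp add: M.emeasure_eq_measure)
      also have "\<dots> = (\<integral>\<^sup>+z. ennreal (v z) * indicator {y..d} z \<partial>lborel)"
        using y True cd noatom[of y] noatom[of d] by (intro Icd) auto
      also have "\<dots> = (\<integral>\<^sup>+z. ennreal (v z) * indicator {y<..d} z \<partial>lborel)"
      proof (rule nn_integral_cong_AE)
        show "AE z in lborel. ennreal (v z) * indicator {y..d} z = ennreal (v z) * indicator {y<..d} z"
          using AE_lborel_singleton[of y] by eventually_elim (auto simp: indicator_def)
      qed
      finally show ?thesis unfolding 1 2 .
    next
      case False
      then have "{y<..d} = {}" by auto
      then show ?thesis unfolding 1 2 by simp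
    qed
  qed simp_all
  show ?thesis
  proof (rule measure_eqI)
    show s: "sets (restrict_space M {l'..u'}) = sets (density (restrict_space lborel {l'..u'}) (\<lambda>x. ennreal (w x)))"
      by (simp add: sets_restrict_space)
    fix A assume "A \<in> sets (restrict_space M {l'..u'})"
    then have A: "A \<in> sets borel" "A \<subseteq> {l'..u'}"
      by (auto simp: sets_restrict_space_iff)
    have wm: "(\<lambda>x. ennreal (w x)) \<in> borel_measurable (restrict_space lborel {l'..u'})"
    proof -
      have "(\<lambda>x. ennreal (v x)) \<in> borel_measurable (restrict_space lborel {l'..u'})"
        by (rule measurable_restrict_space1) auto
      then show ?thesis
        by (rule measurable_cong[THEN iffD1, rotated]) (use lu in \<open>auto simp: v_def space_restrict_space\<close>)
    qed
    have "emeasure (restrict_space M {l'..u'}) A = emeasure M A"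
      using A by (subst emeasure_restrict_space) auto
    also have "\<dots> = emeasure (density M (indicator {c<..d})) A"
    proof -
      have "emeasure (density M (indicator {c<..d})) A = (\<integral>\<^sup>+x. indicator {c<..d} x * indicator A x \<partial>M)"
        using A by (subst emeasure_density) auto
      also have "\<dots> = (\<integral>\<^sup>+x. indicator A x \<partial>M)"
        using A cd by (intro nn_integral_cong) (auto simp: indicator_def)
      finally show ?thesis using A by simp
    qed
    also have "\<dots> = (\<integral>\<^sup>+x. ennreal (v x) * indicator A x \<partial>lborel)"
    proof -
      have "emeasure (density M (indicator {c<..d})) A = (\<integral>\<^sup>+x. ennreal (v x) * indicator {c<..d} x * indicator A x \<partial>lborel)"
        unfolding eq using A by (subst emeasure_density) auto
      also have "\<dots> = (\<integral>\<^sup>+x. ennreal (v x) * indicator A x \<partial>lborel)"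
        using A cd by (intro nn_integral_cong) (auto simp: indicator_def)
      finally show ?thesis .
    qed
    also have "\<dots> = (\<integral>\<^sup>+x. ennreal (w x) * indicator A x \<partial>restrict_space lborel {l'..u'})"
    proof -
      have "(\<integral>\<^sup>+x. ennreal (w x) * indicator A x \<partial>restrict_space lborel {l'..u'}) = (\<integral>\<^sup>+x. ennreal (w x) * indicator A x * indicator {l'..u'} x \<partial>lborel)"
        by (subst nn_integral_restrict_space) auto
      also have "\<dots> = (\<integral>\<^sup>+x. ennreal (v x) * indicator A x \<partial>lborel)"
        using A lu by (intro nn_integral_cong) (auto simp: v_def indicator_def)
      finally show ?thesis by simp
    qed
    also have "\<dots> = emeasure (density (restrict_space lborel {l'..u'}) (\<lambda>x. ennreal (w x))) A"
      using A wm by (subst emeasure_density) (auto simp: sets_restrict_space_iff)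
    finally show "emeasure (restrict_space M {l'..u'}) A = emeasure (density (restrict_space lborel {l'..u'}) (\<lambda>x. ennreal (w x))) A" .
  qed
qed

section \<open>Averages of rotating sequences\<close>

text \<open>The window \<open>{n..<2*n}\<close> replaces the usual initial segment so that every
  averaged index is at least \<open>n\<close>: identities and bounds that hold only for large
  indices then hold for the averages without error.\<close>

definition block_average :: "(nat \<Rightarrow> 'a::real_normed_vector) \<Rightarrow> nat \<Rightarrow> 'a" where
  "block_average f n = (\<Sum>k=n..<2*n. f k) /\<^sub>R real n"

lemma block_average_diff: "block_average (\<lambda>k. f k - g k) n = block_average f n - block_average g n"
  by (simp add: block_average_def sum_subtractf scaleR_diff_right)

lemma block_average_linear:
  assumes "linear h"
  shows "block_average (\<lambda>k. h (f k)) n = h (block_average f n)"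
  by (simp add: block_average_def linear_sum[OF assms] linear_scale[OF assms])

lemma block_average_sum:
  "block_average (\<lambda>k. \<Sum>m\<in>A. f m k) n = (\<Sum>m\<in>A. block_average (f m) n)"
  unfolding block_average_def by (subst sum.swap) (simp add: scaleR_sum_right)

lemma block_average_const: "n \<ge> 1 \<Longrightarrow> block_average (\<lambda>_. c) n = c"
  by (simp add: block_average_def sum_constant_scaleR)

lemma block_average_norm_le:
  assumes "n \<ge> 1" "\<And>k. k \<ge> n \<Longrightarrow> norm (f k) \<le> B"
  shows "norm (block_average f n) \<le> B"
proof -
  have "norm (\<Sum>k=n..<2*n. f k) \<le> (\<Sum>k=n..<2*n. B)"
    by (rule sum_norm_le) (use assms in auto)
  then show ?thesis using assms(1) by (simp add: block_average_def field_simps)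
qed

lemma block_average_tendsto:
  assumes "f \<longlonglongrightarrow> l"
  shows "block_average f \<longlonglongrightarrow> l"
proof (rule LIMSEQ_I)
  fix e :: real assume "e > 0"
  then obtain N where N: "\<And>k. k \<ge> N \<Longrightarrow> norm (f k - l) < e / 2"
    using LIMSEQ_D[OF assms, of "e/2"] by auto
  have "norm (block_average f n - l) < e" if "n \<ge> max N 1" for n
  proof -
    have "norm (block_average (\<lambda>k. f k - l) n) \<le> e / 2"
      by (rule block_average_norm_le) (use that N in \<open>auto intro: less_imp_le\<close>)
    then show ?thesis using that \<open>e > 0\<close> by (simp add: block_average_diff block_average_const)
  qed
  then show "\<exists>no. \<forall>n\<ge>no. norm (block_average f n - l) < e" by blast
qed

text \<open>Shifting the window changes the average by at most \<open>2 * B / n\<close>, while by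
  the recursion shifting multiplies it by \<open>l\<close> asymptotically; as
  \<open>l \<noteq> 1\<close>, the average must vanish in the limit.\<close>

lemma block_average_geometric:
  fixes c :: "nat \<Rightarrow> complex"
  assumes bd: "\<And>k. norm (c k) \<le> B" and rec: "(\<lambda>k. c (Suc k) - l * c k) \<longlonglongrightarrow> 0" and l: "l \<noteq> 1"
  shows "block_average c \<longlonglongrightarrow> 0"
proof -
  have 1: "(\<lambda>n. block_average (\<lambda>k. c (Suc k) - l * c k) n) \<longlonglongrightarrow> 0"
    using block_average_tendsto[OF rec] by simp
  have shift: "block_average (\<lambda>k. c (Suc k)) n - block_average c n = (c (2 * n) - c n) /\<^sub>R real n" for n
  proof -
    have "(\<Sum>k=n..<2*n. c (Suc k) - c k) = c (2 * n) - c n"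
      by (rule sum_Suc_diff') simp
    then show ?thesis
      unfolding block_average_diff[symmetric] by (simp add: block_average_def)
  qed
  have 2: "(\<lambda>n. block_average (\<lambda>k. c (Suc k)) n - block_average c n) \<longlonglongrightarrow> 0"
  proof (rule Lim_null_comparison)
    show "\<forall>\<^sub>F n in sequentially. norm (block_average (\<lambda>k. c (Suc k)) n - block_average c n) \<le> 2 * B / real n"
    proof (rule always_eventually, rule allI)
      fix n
      have "norm (c (2 * n) - c n) \<le> 2 * B"
        using norm_triangle_ineq4[of "c (2 * n)" "c n"] bd[of "2 * n"] bd[of n] by linarith
      then show "norm (block_average (\<lambda>k. c (Suc k)) n - block_average c n) \<le> 2 * B / real n"
        unfolding shift by (simp add: divide_simps)
    qed
    show "(\<lambda>n. 2 * B / real n) \<longlonglongrightarrow> 0" by (rule lim_const_over_n)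
  qed
  have "(\<lambda>n. block_average (\<lambda>k. c (Suc k) - l * c k) n - (block_average (\<lambda>k. c (Suc k)) n - block_average c n)) \<longlonglongrightarrow> 0 - 0"
    by (rule tendsto_diff[OF 1 2])
  moreover have "block_average (\<lambda>k. c (Suc k) - l * c k) n - (block_average (\<lambda>k. c (Suc k)) n - block_average c n) = (1 - l) * block_average c n" for n
    using block_average_linear[OF bounded_linear.linear[OF bounded_linear_mult_right[of l]], of c n]
    by (simp add: block_average_diff algebra_simps)
  ultimately have "(\<lambda>n. (1 - l) * block_average c n) \<longlonglongrightarrow> 0" by simp
  from tendsto_mult_left[OF this, of "1 / (1 - l)"] l show ?thesis by simp
qed

text \<open>The powers \<open>q k ^ m\<close> rotate asymptotically by \<open>w ^ m\<close>. This is
  shown by exchanging one factor at a time, each exchange costing an error that tends to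
  \<open>0\<close> because all factors are bounded.\<close>

lemma block_average_power:
  fixes q :: "nat \<Rightarrow> complex"
  assumes bd: "\<And>k. norm (q k) \<le> 1" and rec: "(\<lambda>k. q (Suc k) - w * q k) \<longlonglongrightarrow> 0" and w: "w ^ m \<noteq> 1"
  shows "block_average (\<lambda>k. q k ^ m) \<longlonglongrightarrow> 0"
proof (rule block_average_geometric[OF _ _ w])
  show "norm (q k ^ m) \<le> 1" for k using bd[of k] by (simp add: norm_power power_le_one)
  show "(\<lambda>k. q (Suc k) ^ m - w ^ m * q k ^ m) \<longlonglongrightarrow> 0"
  proof (induction m)
    case (Suc m)
    have "(\<lambda>k. q (Suc k) * (q (Suc k) ^ m - w ^ m * q k ^ m)) \<longlonglongrightarrow> 0"
      by (rule Lim_null_comparison[OF always_eventually tendsto_norm_zero[OF Suc]])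
        (use bd in \<open>auto simp: norm_mult intro!: mult_left_le_one_le\<close>)
    moreover have "(\<lambda>k. (w ^ m * q k ^ m) * (q (Suc k) - w * q k)) \<longlonglongrightarrow> 0"
    proof (rule Lim_null_comparison[OF always_eventually])
      have "(\<lambda>k. norm (w ^ m) * norm (q (Suc k) - w * q k)) \<longlonglongrightarrow> norm (w ^ m) * 0"
        by (intro tendsto_intros tendsto_norm_zero[OF rec])
      then show "(\<lambda>k. norm (w ^ m) * norm (q (Suc k) - w * q k)) \<longlonglongrightarrow> 0" by simp
      show "\<forall>k. norm ((w ^ m * q k ^ m) * (q (Suc k) - w * q k)) \<le> norm (w ^ m) * norm (q (Suc k) - w * q k)"
      proof
        fix k
        have "norm (q k ^ m) \<le> 1" using bd[of k] by (simp add: norm_power power_le_one)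
        then have "norm (w ^ m) * norm (q k ^ m) \<le> norm (w ^ m)"
          by (intro mult_left_le) auto
        then show "norm ((w ^ m * q k ^ m) * (q (Suc k) - w * q k)) \<le> norm (w ^ m) * norm (q (Suc k) - w * q k)"
          unfolding norm_mult[of "w ^ m * q k ^ m"] norm_mult[of "w ^ m"] by (intro mult_right_mono) auto
      qed
    qed
    ultimately have "(\<lambda>k. q (Suc k) * (q (Suc k) ^ m - w ^ m * q k ^ m) + (w ^ m * q k ^ m) * (q (Suc k) - w * q k)) \<longlonglongrightarrow> 0 + 0"
      by (rule tendsto_add)
    then show ?case by (simp add: algebra_simps)
  qed simp
qed

text \<open>Geometric series in \<open>- t * q k\<close>, truncated with an error uniform in
  \<open>k\<close>: the averages of all positive powers vanish and only the constant term remains.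
  The alternative \<open>t = 0\<close> covers a constant sequence.\<close>

lemma block_average_inverse_one_plus:
  fixes q :: "nat \<Rightarrow> complex"
  assumes bd: "\<And>k. norm (q k) \<le> 1" and rec: "(\<lambda>k. q (Suc k) - w * q k) \<longlonglongrightarrow> 0"
    and t: "norm t < 1" and w: "t = 0 \<or> (\<forall>m\<ge>1. w ^ m \<noteq> 1)"
  shows "block_average (\<lambda>k. 1 / (1 + t * q k)) \<longlonglongrightarrow> 1"
proof (cases "t = 0")
  case True
  have "(\<lambda>k::nat. 1 / (1 + t * q k)) \<longlonglongrightarrow> 1" unfolding True by simp
  then show ?thesis by (rule block_average_tendsto)
next
  case False
  show ?thesis
  proof (rule LIMSEQ_I)
    fix e :: real assume "e > 0"
    define r where "r = norm t"
    have r: "0 \<le> r" "r < 1" using t by (auto simp: r_def)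
    have "(\<lambda>M. r ^ M / (1 - r)) \<longlonglongrightarrow> 0 / (1 - r)"
      using r by (intro tendsto_intros LIMSEQ_realpow_zero) auto
    from order_tendstoD(2)[OF this, of "e/2"] \<open>e > 0\<close>
    obtain M where M: "r ^ M / (1 - r) < e / 2" "M \<ge> 1"
      by (metis (no_types, lifting) div_0 eventually_conj eventually_ge_at_top eventually_happens' half_gt_zero sequentially_bot)
    define G where "G k = (\<Sum>m<M. (- t * q k) ^ m)" for k
    have tq: "norm (t * q k) \<le> r" for k
      unfolding norm_mult r_def using bd[of k] by (simp add: mult_left_le)
    have nz: "1 + t * q k \<noteq> 0" for k
      using tq[of k] r by (metis add.inverse_inverse add_eq_0_iff norm_minus_cancel norm_one not_le)
    have err: "norm (1 / (1 + t * q k) - G k) \<le> r ^ M / (1 - r)" for k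
    proof -
      have "(1 + t * q k) * G k = 1 - (- t * q k) ^ M"
        unfolding G_def using one_diff_power_eq[of "- t * q k" M] by simp
      then have "G k = (1 - (- t * q k) ^ M) / (1 + t * q k)"
        using nz[of k] by (simp add: field_simps)
      then have "1 / (1 + t * q k) - G k = (- t * q k) ^ M / (1 + t * q k)"
        by (simp add: diff_divide_distrib[symmetric])
      moreover have "norm ((- t * q k) ^ M) \<le> r ^ M"
        using tq[of k] by (simp add: norm_power power_mono)
      moreover have "1 - r \<le> norm (1 + t * q k)"
        using norm_triangle_ineq2[of 1 "- (t * q k)"] tq[of k] by simp
      ultimately show ?thesis using r by (simp add: norm_divide frac_le)
    qed
    have "block_average G \<longlonglongrightarrow> (\<Sum>m<M. if m = 0 then 1 else 0)"
    proof -
      have "block_average (\<lambda>k. (- t * q k) ^ m) \<longlonglongrightarrow> (if m = 0 then 1 else 0)" for m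
      proof (cases "m = 0")
        case True
        then show ?thesis by (auto intro!: block_average_tendsto)
      next
        case m: False
        have "block_average (\<lambda>k. (- t * q k) ^ m) = (\<lambda>n. (- t) ^ m * block_average (\<lambda>k. q k ^ m) n)"
        proof
          fix n
          have "block_average (\<lambda>k. (- t) ^ m * q k ^ m) n = (- t) ^ m * block_average (\<lambda>k. q k ^ m) n"
            by (rule block_average_linear[OF bounded_linear.linear[OF bounded_linear_mult_right]])
          then show "block_average (\<lambda>k. (- t * q k) ^ m) n = (- t) ^ m * block_average (\<lambda>k. q k ^ m) n"
            by (simp only: power_mult_distrib)
        qed
        moreover have "block_average (\<lambda>k. q k ^ m) \<longlonglongrightarrow> 0"
          by (rule block_average_power[OF bd rec]) (use w False m in auto)
        ultimately show ?thesis using m tendsto_mult_right_zero by auto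
      qed
      then have "(\<lambda>n. \<Sum>m<M. block_average (\<lambda>k. (- t * q k) ^ m) n) \<longlonglongrightarrow> (\<Sum>m<M. if m = 0 then 1 else 0)"
        by (intro tendsto_sum)
      then show ?thesis unfolding G_def[abs_def] by (simp add: block_average_sum[abs_def])
    qed
    moreover have "(\<Sum>m<M. if m = 0 then 1 else 0) = (1::complex)" using M(2) by (simp add: sum.delta)
    ultimately have "block_average G \<longlonglongrightarrow> 1" by simp
    from LIMSEQ_D[OF this, of "e/2"] \<open>e > 0\<close>
    obtain N where N: "\<And>n. n \<ge> N \<Longrightarrow> norm (block_average G n - 1) < e / 2" by auto
    have "norm (block_average (\<lambda>k. 1 / (1 + t * q k)) n - 1) < e" if "n \<ge> max N 1" for n
    proof -
      have "norm (block_average (\<lambda>k. 1 / (1 + t * q k) - G k) n) \<le> r ^ M / (1 - r)"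
        by (rule block_average_norm_le) (use that err in auto)
      then have "norm (block_average (\<lambda>k. 1 / (1 + t * q k)) n - block_average G n) < e / 2"
        using M(1) unfolding block_average_diff by linarith
      moreover have "norm (block_average G n - 1) < e / 2" using N that by auto
      ultimately show ?thesis by (rule norm_diff_triangle_less[THEN order_less_le_trans]) simp
    qed
    then show "\<exists>no. \<forall>n\<ge>no. norm (block_average (\<lambda>k. 1 / (1 + t * q k)) n - 1) < e" by blast
  qed
qed

text \<open>The Poisson kernel identity \<open>(1 - \<bar>u\<bar>\<^sup>2) / \<bar>1 + u\<bar>\<^sup>2 = 2 Re (1 / (1 + u)) - 1\<close> reduces
  the average of \<open>1 / \<bar>1 + t q\<bar>\<^sup>2\<close> over the unit circle to a geometric series.\<close>

lemma block_average_poisson: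
  fixes q :: "nat \<Rightarrow> complex"
  assumes q1: "\<And>k. norm (q k) = 1" and rec: "(\<lambda>k. q (Suc k) - w * q k) \<longlonglongrightarrow> 0"
    and t: "norm t < 1" and w: "t = 0 \<or> (\<forall>m\<ge>1. w ^ m \<noteq> 1)"
  shows "block_average (\<lambda>k. 1 / (norm (1 + t * q k))\<^sup>2) \<longlonglongrightarrow> 1 / (1 - (norm t)\<^sup>2)"
proof -
  have t2: "1 - (norm t)\<^sup>2 > 0" using t by (simp add: power_less_one_iff abs_square_less_1)
  have id: "1 / (norm (1 + t * q k))\<^sup>2 = (2 * Re (1 / (1 + t * q k)) - 1) / (1 - (norm t)\<^sup>2)" for k
  proof -
    define u where "u = t * q k"
    have nu: "norm u = norm t" using q1 by (simp add: u_def norm_mult)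
    have "1 + u \<noteq> 0" using nu t by (metis add_eq_0_iff norm_minus_cancel norm_one less_irrefl)
    then have p: "(norm (1 + u))\<^sup>2 > 0" by simp
    have "Re (1 / (1 + u)) = (1 + Re u) / (norm (1 + u))\<^sup>2"
      unfolding Re_divide cmod_power2 by simp
    then have "(2 * Re (1 / (1 + u)) - 1) * (norm (1 + u))\<^sup>2 = 2 * (1 + Re u) - (norm (1 + u))\<^sup>2"
      using p by (simp add: field_simps)
    also have "\<dots> = 1 - (norm u)\<^sup>2" unfolding cmod_power2 by (simp add: power2_eq_square algebra_simps)
    finally show ?thesis using p t2 unfolding nu u_def[symmetric] by (simp add: field_simps)
  qed
  have "(\<lambda>n. (2 * Re (block_average (\<lambda>k. 1 / (1 + t * q k)) n) - 1) / (1 - (norm t)\<^sup>2)) \<longlonglongrightarrow> (2 * Re 1 - 1) / (1 - (norm t)\<^sup>2)"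
    using block_average_inverse_one_plus[OF _ rec t w] q1 t2 by (intro tendsto_intros) auto
  moreover have "\<forall>\<^sub>F n in sequentially. (2 * Re (block_average (\<lambda>k. 1 / (1 + t * q k)) n) - 1) / (1 - (norm t)\<^sup>2)
     = block_average (\<lambda>k. 1 / (norm (1 + t * q k))\<^sup>2) n"
    using eventually_ge_at_top[of 1]
  proof eventually_elim
    case (elim n)
    have l: "linear (\<lambda>x::real. (2 * x) / (1 - (norm t)\<^sup>2))"
      by (intro linearI) (auto simp: add_divide_distrib distrib_left)
    have "block_average (\<lambda>k. (2 * Re (1 / (1 + t * q k)) - 1) / (1 - (norm t)\<^sup>2)) n =
      block_average (\<lambda>k. (2 * Re (1 / (1 + t * q k))) / (1 - (norm t)\<^sup>2) - 1 / (1 - (norm t)\<^sup>2)) n"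
      by (simp add: diff_divide_distrib)
    also have "\<dots> = (2 * Re (block_average (\<lambda>k. 1 / (1 + t * q k)) n)) / (1 - (norm t)\<^sup>2) - 1 / (1 - (norm t)\<^sup>2)"
      unfolding block_average_diff block_average_const[OF elim] block_average_linear[OF l]
        block_average_linear[OF bounded_linear.linear[OF bounded_linear_Re]] ..
    finally show ?case unfolding id by (simp add: diff_divide_distrib)
  qed
  ultimately show ?thesis using tendsto_cong by fastforce
qed

text \<open>With \<open>\<zeta> * E k\<close> in place of \<open>z k\<close>, the quantity is
  \<open>s * \<zeta> * E k\<close> times \<open>1 + t / s * q k\<close>, where the unimodular
  \<open>q\<close> rotates by \<open>cnj (e k) ^ 2\<close>; this square is the source of the even
  powers in the last hypothesis. As \<open>norm t < norm s\<close>, the unperturbed modulus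
  \<open>b\<close> stays away from \<open>0\<close>, so the replacement does not affect the limit of
  the averaged reciprocals.\<close>

lemma block_average_elliptic_aux:
  fixes z E e :: "nat \<Rightarrow> complex"
  assumes z: "(\<lambda>k. z k - \<zeta> * E k) \<longlonglongrightarrow> 0" and \<zeta>: "\<zeta> \<noteq> 0"
    and E: "\<And>k. norm (E k) = 1" "\<And>k. E (Suc k) = e k * E k" and e: "e \<longlonglongrightarrow> e0" "\<And>k. norm (e k) = 1"
    and st: "norm t < norm s" and e0: "t = 0 \<or> (\<forall>m\<ge>1. e0 ^ (2 * m) \<noteq> 1)"
  shows "block_average (\<lambda>k. 1 / (norm (s * z k + t * cnj (z k)))\<^sup>2) \<longlonglongrightarrow>
    1 / (((norm s)\<^sup>2 - (norm t)\<^sup>2) * (norm \<zeta>)\<^sup>2)"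
proof -
  define q where "q k = cnj (\<zeta> * E k) / (\<zeta> * E k)" for k
  define w where "w = cnj e0 ^ 2"
  have s0: "s \<noteq> 0" using st by auto
  have E0: "E k \<noteq> 0" "e k \<noteq> 0" for k using E(1)[of k] e(2)[of k] by auto
  have inv: "cnj x = 1 / x" if "norm x = 1" for x :: complex
    using that complex_norm_square[of x] by (metis mult.commute nonzero_eq_divide_eq norm_zero of_real_1 power_one zero_neq_one)
  have ne0: "norm e0 = 1" using tendsto_norm[OF e(1)] e(2) by (simp add: LIMSEQ_const_iff)
  have q1: "norm (q k) = 1" for k using \<zeta> E0 by (simp add: q_def norm_divide norm_mult)
  have qS: "q (Suc k) = cnj (e k) ^ 2 * q k" for k
    using \<zeta> E0 inv[OF e(2)[of k]] by (simp add: q_def E(2) power2_eq_square field_simps)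
  have rec: "(\<lambda>k. q (Suc k) - w * q k) \<longlonglongrightarrow> 0"
  proof -
    have "(\<lambda>k. cnj (e k) ^ 2 - w) \<longlonglongrightarrow> cnj e0 ^ 2 - w" by (intro tendsto_intros e)
    then have "(\<lambda>k. norm (cnj (e k) ^ 2 - w)) \<longlonglongrightarrow> 0" by (simp add: w_def tendsto_norm_zero)
    moreover have eq: "norm (q (Suc k) - w * q k) = norm (cnj (e k) ^ 2 - w)" for k
      unfolding qS left_diff_distrib[symmetric] norm_mult q1 by simp
    ultimately have "(\<lambda>k. norm (q (Suc k) - w * q k)) \<longlonglongrightarrow> 0" unfolding eq by blast
    then show ?thesis by (rule tendsto_norm_zero_cancel)
  qed
  have w: "t / s = 0 \<or> (\<forall>m\<ge>1. w ^ m \<noteq> 1)"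
    using e0 by (auto simp: w_def power_mult[symmetric] complex_cnj_power[symmetric] simp del: complex_cnj_power)
  have A: "block_average (\<lambda>k. 1 / (norm (1 + t / s * q k))\<^sup>2) \<longlonglongrightarrow> 1 / (1 - (norm (t / s))\<^sup>2)"
    by (rule block_average_poisson[OF q1 rec _ w]) (use st s0 in \<open>simp add: norm_divide\<close>)
  define a where "a k = norm (s * z k + t * cnj (z k))" for k
  define b where "b k = norm (s * (\<zeta> * E k) + t * cnj (\<zeta> * E k))" for k
  define c where "c = (norm s * norm \<zeta>)\<^sup>2"
  have c0: "c > 0" using s0 \<zeta> by (simp add: c_def)
  have b_eq: "1 / (b k)\<^sup>2 = (1 / c) * (1 / (norm (1 + t / s * q k))\<^sup>2)" for k
  proof -
    have "s * (\<zeta> * E k) + t * cnj (\<zeta> * E k) = (s * \<zeta> * E k) * (1 + t / s * q k)"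
      using s0 \<zeta> E0 by (simp add: q_def field_simps)
    then have "b k = norm s * norm \<zeta> * norm (1 + t / s * q k)"
      by (simp add: b_def norm_mult E)
    then show ?thesis by (simp add: c_def power_mult_distrib)
  qed
  have B: "block_average (\<lambda>k. 1 / (b k)\<^sup>2) \<longlonglongrightarrow> 1 / (((norm s)\<^sup>2 - (norm t)\<^sup>2) * (norm \<zeta>)\<^sup>2)"
  proof -
    have "block_average (\<lambda>k. 1 / (b k)\<^sup>2) = (\<lambda>n. (1 / c) * block_average (\<lambda>k. 1 / (norm (1 + t / s * q k))\<^sup>2) n)"
      unfolding b_eq by (rule ext, rule block_average_linear[OF bounded_linear.linear[OF bounded_linear_mult_right]])
    moreover have "(1 / c) * (1 / (1 - (norm (t / s))\<^sup>2)) = 1 / (((norm s)\<^sup>2 - (norm t)\<^sup>2) * (norm \<zeta>)\<^sup>2)"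
    proof -
      have "c * (1 - (norm (t / s))\<^sup>2) = ((norm s)\<^sup>2 - (norm t)\<^sup>2) * (norm \<zeta>)\<^sup>2"
        using s0 by (simp add: c_def norm_divide power_mult_distrib power_divide field_simps)
      then show ?thesis by (metis mult_1 times_divide_times_eq)
    qed
    ultimately show ?thesis using tendsto_mult_left[OF A, of "1 / c"] by metis
  qed
  have ab: "(\<lambda>k. a k - b k) \<longlonglongrightarrow> 0"
  proof (rule Lim_null_comparison[OF always_eventually])
    have "(\<lambda>k. (norm s + norm t) * norm (z k - \<zeta> * E k)) \<longlonglongrightarrow> (norm s + norm t) * 0"
      by (intro tendsto_intros tendsto_norm_zero[OF z])
    then show "(\<lambda>k. (norm s + norm t) * norm (z k - \<zeta> * E k)) \<longlonglongrightarrow> 0" by simp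
    show "\<forall>k. norm (a k - b k) \<le> (norm s + norm t) * norm (z k - \<zeta> * E k)"
    proof
      fix k
      have "norm (a k - b k) \<le> norm (s * (z k - \<zeta> * E k) + t * cnj (z k - \<zeta> * E k))"
        unfolding a_def b_def real_norm_def
        by (rule order_trans[OF norm_triangle_ineq3]) (simp add: algebra_simps)
      also have "\<dots> \<le> (norm s + norm t) * norm (z k - \<zeta> * E k)"
        by (rule order_trans[OF norm_triangle_ineq]) (simp add: norm_mult distrib_right complex_mod_cnj del: complex_cnj_diff)
      finally show "norm (a k - b k) \<le> (norm s + norm t) * norm (z k - \<zeta> * E k)" .
    qed
  qed
  define d where "d = (norm s - norm t) * norm \<zeta>"
  have d0: "d > 0" using st \<zeta> by (simp add: d_def)
  have bd: "d \<le> b k" for k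
    using norm_triangle_ineq2[of "s * (\<zeta> * E k)" "- (t * cnj (\<zeta> * E k))"]
    by (simp add: b_def d_def norm_mult E left_diff_distrib)
  have bu: "b k \<le> (norm s + norm t) * norm \<zeta>" for k
    unfolding b_def by (rule order_trans[OF norm_triangle_ineq]) (simp add: norm_mult E distrib_right)
  have "\<forall>\<^sub>F k in sequentially. \<bar>a k - b k\<bar> < d / 2"
    using tendstoD[OF ab, of "d/2"] d0 by (simp add: dist_real_def)
  then have ev: "\<forall>\<^sub>F k in sequentially. a k \<ge> d / 2"
    by eventually_elim (use bd in \<open>auto simp: abs_less_iff field_simps intro: order_trans less_imp_le; smt (verit)\<close>)
  have diff: "(\<lambda>k. 1 / (a k)\<^sup>2 - 1 / (b k)\<^sup>2) \<longlonglongrightarrow> 0"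
  proof (rule Lim_null_comparison)
    let ?U = "(norm s + norm t) * norm \<zeta>"
    show "\<forall>\<^sub>F k in sequentially. norm (1 / (a k)\<^sup>2 - 1 / (b k)\<^sup>2) \<le> (norm (a k - b k) * (norm (a k - b k) + 2 * ?U)) / ((d / 2)\<^sup>2 * d\<^sup>2)"
      using ev
    proof eventually_elim
      case (elim k)
      have pos: "a k > 0" "b k > 0" using elim d0 bd[of k] by auto
      have "1 / (a k)\<^sup>2 - 1 / (b k)\<^sup>2 = ((b k - a k) * (a k + b k)) / ((a k)\<^sup>2 * (b k)\<^sup>2)"
        using pos by (simp add: divide_simps) (simp add: power2_eq_square algebra_simps)
      then have "norm (1 / (a k)\<^sup>2 - 1 / (b k)\<^sup>2) = (norm (a k - b k) * (a k + b k)) / ((a k)\<^sup>2 * (b k)\<^sup>2)"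
        using pos by (simp add: abs_mult abs_divide abs_minus_commute)
      also have "\<dots> \<le> (norm (a k - b k) * (norm (a k - b k) + 2 * ?U)) / ((d / 2)\<^sup>2 * d\<^sup>2)"
      proof (rule frac_le)
        show "norm (a k - b k) * (a k + b k) \<le> norm (a k - b k) * (norm (a k - b k) + 2 * ?U)"
          using bu[of k] by (intro mult_left_mono) auto
        show "(d / 2)\<^sup>2 * d\<^sup>2 \<le> (a k)\<^sup>2 * (b k)\<^sup>2"
          using elim bd[of k] d0 by (intro mult_mono power_mono) auto
      qed (use d0 in auto)
      finally show ?case .
    qed
    have "(\<lambda>k. (norm (a k - b k) * (norm (a k - b k) + 2 * ?U)) / ((d / 2)\<^sup>2 * d\<^sup>2)) \<longlonglongrightarrow> (0 * (0 + 2 * ?U)) / ((d / 2)\<^sup>2 * d\<^sup>2)"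
      using d0 by (intro tendsto_intros tendsto_norm_zero[OF ab]) auto
    then show "(\<lambda>k. (norm (a k - b k) * (norm (a k - b k) + 2 * ?U)) / ((d / 2)\<^sup>2 * d\<^sup>2)) \<longlonglongrightarrow> 0" by simp
  qed
  have "(\<lambda>n. block_average (\<lambda>k. 1 / (a k)\<^sup>2 - 1 / (b k)\<^sup>2) n + block_average (\<lambda>k. 1 / (b k)\<^sup>2) n) \<longlonglongrightarrow> 0 + 1 / (((norm s)\<^sup>2 - (norm t)\<^sup>2) * (norm \<zeta>)\<^sup>2)"
    by (rule tendsto_add[OF block_average_tendsto[OF diff] B])
  then show ?thesis by (simp add: block_average_diff a_def[symmetric])
qed

lemma block_average_elliptic:
  fixes z E e :: "nat \<Rightarrow> complex"
  assumes z: "(\<lambda>k. z k - \<zeta> * E k) \<longlonglongrightarrow> 0" and \<zeta>: "\<zeta> \<noteq> 0"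
    and E: "\<And>k. norm (E k) = 1" "\<And>k. E (Suc k) = e k * E k" and e: "e \<longlonglongrightarrow> e0" "\<And>k. norm (e k) = 1"
    and st: "norm t \<noteq> norm s" and e0: "t = 0 \<or> s = 0 \<or> (\<forall>m\<ge>1. e0 ^ (2 * m) \<noteq> 1)"
  shows "block_average (\<lambda>k. 1 / (norm (s * z k + t * cnj (z k)))\<^sup>2) \<longlonglongrightarrow>
    1 / (\<bar>(norm s)\<^sup>2 - (norm t)\<^sup>2\<bar> * (norm \<zeta>)\<^sup>2)"
proof (cases "norm t < norm s")
  case True
  then have "t = 0 \<or> (\<forall>m\<ge>1. e0 ^ (2 * m) \<noteq> 1)" using e0 by auto
  from block_average_elliptic_aux[OF z \<zeta> E e True this] True show ?thesis
    by (simp add: power_mono)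
next
  case False
  \<comment> \<open>Conjugating \<open>s * z k + t * cnj (z k)\<close> exchanges the roles of the
    two coefficients.\<close>
  then have lt: "norm (cnj s) < norm (cnj t)" using st by simp
  then have "cnj s = 0 \<or> (\<forall>m\<ge>1. e0 ^ (2 * m) \<noteq> 1)" using e0 by auto
  from block_average_elliptic_aux[OF z \<zeta> E e lt this]
  have "block_average (\<lambda>k. 1 / (norm (cnj t * z k + cnj s * cnj (z k)))\<^sup>2) \<longlonglongrightarrow>
    1 / (((norm t)\<^sup>2 - (norm s)\<^sup>2) * (norm \<zeta>)\<^sup>2)" by simp
  moreover have "norm (cnj t * z k + cnj s * cnj (z k)) = norm (s * z k + t * cnj (z k))" for k
  proof -
    have "cnj t * z k + cnj s * cnj (z k) = cnj (s * z k + t * cnj (z k))" by simp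
    then show ?thesis by (metis complex_mod_cnj)
  qed
  moreover have "(norm t)\<^sup>2 - (norm s)\<^sup>2 = \<bar>(norm s)\<^sup>2 - (norm t)\<^sup>2\<bar>"
    using power_strict_mono[of "norm s" "norm t" 2] lt by simp
  ultimately show ?thesis by simp
qed

section \<open>Perturbed rotations\<close>

lemma telescoping_limit:
  fixes f :: "nat \<Rightarrow> 'a::banach"
  assumes d: "summable d" "\<And>k. k \<ge> M \<Longrightarrow> norm (f (Suc k) - f k) \<le> d k"
  obtains L where "f \<longlonglongrightarrow> L" "\<And>k. k \<ge> M \<Longrightarrow> norm (f k - L) \<le> (\<Sum>j. d (j + k))"
proof -
  have sd: "summable (\<lambda>j. d (j + k))" for k using d(1) by (simp add: summable_iff_shift)
  define L where "L = f M + (\<Sum>j. f (Suc (j + M)) - f (j + M))"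
  have sums: "summable (\<lambda>j. f (Suc (j + k)) - f (j + k))" "norm (\<Sum>j. f (Suc (j + k)) - f (j + k)) \<le> (\<Sum>j. d (j + k))"
    if "k \<ge> M" for k
  proof -
    show "summable (\<lambda>j. f (Suc (j + k)) - f (j + k))"
      by (rule summable_comparison_test'[OF sd[of k], of 0]) (use that d(2) in auto)
    show "norm (\<Sum>j. f (Suc (j + k)) - f (j + k)) \<le> (\<Sum>j. d (j + k))"
      by (rule norm_suminf_le[OF _ sd[of k]]) (use that d(2) in auto)
  qed
  have tel: "(\<lambda>j. f (Suc (j + k)) - f (j + k)) sums (L - f k)" if "f \<longlonglongrightarrow> L" for k L
    using telescope_sums[of "\<lambda>j. f (j + k)" L] that by (simp add: LIMSEQ_ignore_initial_segment)
  have "(\<lambda>n. (\<Sum>j<n. f (Suc (j + M)) - f (j + M))) \<longlonglongrightarrow> (\<Sum>j. f (Suc (j + M)) - f (j + M))"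
    using sums(1)[OF order_refl] by (rule summable_LIMSEQ)
  moreover have "(\<Sum>j<n. f (Suc (j + M)) - f (j + M)) = f (n + M) - f M" for n
    by (induction n) auto
  ultimately have "(\<lambda>n. f (n + M) - f M) \<longlonglongrightarrow> (\<Sum>j. f (Suc (j + M)) - f (j + M))" by simp
  from tendsto_add[OF this tendsto_const[of "f M"]]
  have "(\<lambda>n. f (n + M)) \<longlonglongrightarrow> L" by (simp add: L_def add.commute)
  then have L: "f \<longlonglongrightarrow> L" by (rule LIMSEQ_offset)
  show thesis
  proof (rule that[OF L])
    fix k assume "k \<ge> M"
    then show "norm (f k - L) \<le> (\<Sum>j. d (j + k))"
      using sums(2)[of k] sums_unique[OF tel[OF L, of k]] by (simp add: norm_minus_commute)
  qed
qed

section \<open>Calculus of sequences of uniformly bounded variation\<close>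

locale variation =
  fixes S :: "real set" and \<delta> :: "nat \<Rightarrow> real"
  assumes \<delta>_nonneg: "\<delta> k \<ge> 0" and \<delta>_summable: "summable \<delta>"
begin

text \<open>Increments are compared with one fixed summable \<open>\<delta>\<close>, so all derived
  quantities approach their limits at the common rate \<open>tail\<close>. The condition concerns
  large \<open>k\<close> only, which lets square roots and reciprocals be taken once a positive
  lower bound has set in.\<close>

definition bv :: "(nat \<Rightarrow> real \<Rightarrow> 'a::real_normed_vector) \<Rightarrow> bool" where
  "bv f \<longleftrightarrow> (\<exists>M C. \<forall>k\<ge>M. \<forall>x\<in>S. norm (f k x) \<le> C \<and> norm (f (Suc k) x - f k x) \<le> C * \<delta> k)"

definition tail :: "nat \<Rightarrow> real" where "tail k = (\<Sum>j. \<delta> (j + k))"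

lemma sum_le_tail:
  assumes "M \<le> k"
  shows "(\<Sum>j=M..<k. \<delta> j) \<le> tail M"
proof -
  have "(\<Sum>j=M..<k. \<delta> j) = (\<Sum>j<k-M. \<delta> (j + M))"
    using sum.shift_bounds_nat_ivl[of \<delta> 0 M "k - M"] assms by (simp add: lessThan_atLeast0)
  also have "\<dots> \<le> tail M"
    unfolding tail_def using \<delta>_summable \<delta>_nonneg by (intro sum_le_suminf) (auto simp: summable_iff_shift)
  finally show ?thesis .
qed

lemma mult_\<delta>_mono: "C \<le> D \<Longrightarrow> C * \<delta> k \<le> D * \<delta> k"
  by (rule mult_right_mono[OF _ \<delta>_nonneg])

lemma tail_nonneg: "tail k \<ge> 0"
  unfolding tail_def using \<delta>_nonneg \<delta>_summable by (intro suminf_nonneg) (auto simp: summable_iff_shift)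

lemma tail_tendsto_0: "tail \<longlonglongrightarrow> 0"
  unfolding tail_def by (rule suminf_exist_split2[OF \<delta>_summable])

lemma tail_mono: "k \<le> l \<Longrightarrow> tail l \<le> tail k"
proof (induction rule: dec_induct)
  case (step n)
  have "tail n = tail (Suc n) + \<delta> n"
    unfolding tail_def using suminf_split_head[of "\<lambda>j. \<delta> (j + n)"] \<delta>_summable by (simp add: summable_iff_shift)
  then show ?case using step \<delta>_nonneg[of n] by linarith
qed simp

lemma bvE:
  assumes "bv f"
  obtains M C where "C \<ge> 0" "\<And>k x. k \<ge> M \<Longrightarrow> x \<in> S \<Longrightarrow> norm (f k x) \<le> C"
    "\<And>k x. k \<ge> M \<Longrightarrow> x \<in> S \<Longrightarrow> norm (f (Suc k) x - f k x) \<le> C * \<delta> k"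
proof -
  obtain M C where *: "\<forall>k\<ge>M. \<forall>x\<in>S. norm (f k x) \<le> C \<and> norm (f (Suc k) x - f k x) \<le> C * \<delta> k"
    using assms unfolding bv_def by blast
  show thesis
  proof (rule that[of "max C 0" M])
    fix k x assume "k \<ge> M" "x \<in> S"
    then show "norm (f k x) \<le> max C 0" "norm (f (Suc k) x - f k x) \<le> max C 0 * \<delta> k"
      using * mult_\<delta>_mono[of C "max C 0" k] by (auto intro: order_trans max.coboundedI1)
  qed simp
qed

lemma bvI:
  assumes "\<And>k x. k \<ge> M \<Longrightarrow> x \<in> S \<Longrightarrow> norm (f k x) \<le> C"
    "\<And>k x. k \<ge> M \<Longrightarrow> x \<in> S \<Longrightarrow> norm (f (Suc k) x - f k x) \<le> D * \<delta> k"
  shows "bv f"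
  unfolding bv_def
proof (intro exI[of _ M] exI[of _ "max C D"] allI ballI impI conjI)
  fix k x assume "k \<ge> M" "x \<in> S"
  then show "norm (f k x) \<le> max C D" "norm (f (Suc k) x - f k x) \<le> max C D * \<delta> k"
    using assms[of k x] mult_\<delta>_mono[of D "max C D" k] by (auto intro: order_trans max.coboundedI1)
qed

lemma bv_const: "bv (\<lambda>k x. c)"
  by (rule bvI[of 0 _ "norm c" 0]) auto

lemma bv_add:
  assumes "bv f" "bv g" shows "bv (\<lambda>k x. f k x + g k x)"
proof -
  obtain M C where f: "\<And>k x. k \<ge> M \<Longrightarrow> x \<in> S \<Longrightarrow> norm (f k x) \<le> C"
    "\<And>k x. k \<ge> M \<Longrightarrow> x \<in> S \<Longrightarrow> norm (f (Suc k) x - f k x) \<le> C * \<delta> k" using bvE[OF assms(1)] by metis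
  obtain M' C' where g: "\<And>k x. k \<ge> M' \<Longrightarrow> x \<in> S \<Longrightarrow> norm (g k x) \<le> C'"
    "\<And>k x. k \<ge> M' \<Longrightarrow> x \<in> S \<Longrightarrow> norm (g (Suc k) x - g k x) \<le> C' * \<delta> k" using bvE[OF assms(2)] by metis
  show ?thesis
  proof (rule bvI[of "max M M'" _ "C + C'" "C + C'"])
    fix k x assume k: "k \<ge> max M M'" "x \<in> S"
    show "norm (f k x + g k x) \<le> C + C'" using k f(1)[of k x] g(1)[of k x] by (intro norm_triangle_mono) auto
    have "f (Suc k) x + g (Suc k) x - (f k x + g k x) = (f (Suc k) x - f k x) + (g (Suc k) x - g k x)" by simp
    then show "norm (f (Suc k) x + g (Suc k) x - (f k x + g k x)) \<le> (C + C') * \<delta> k"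
      using k f(2)[of k x] g(2)[of k x] unfolding distrib_right by (simp only:) (intro norm_triangle_mono, auto)
  qed
qed

lemma bv_mult:
  fixes f g :: "nat \<Rightarrow> real \<Rightarrow> 'a::real_normed_algebra"
  assumes "bv f" "bv g" shows "bv (\<lambda>k x. f k x * g k x)"
proof -
  obtain M C where f: "C \<ge> 0" "\<And>k x. k \<ge> M \<Longrightarrow> x \<in> S \<Longrightarrow> norm (f k x) \<le> C"
    "\<And>k x. k \<ge> M \<Longrightarrow> x \<in> S \<Longrightarrow> norm (f (Suc k) x - f k x) \<le> C * \<delta> k" using bvE[OF assms(1)] by metis
  obtain M' C' where g: "C' \<ge> 0" "\<And>k x. k \<ge> M' \<Longrightarrow> x \<in> S \<Longrightarrow> norm (g k x) \<le> C'"
    "\<And>k x. k \<ge> M' \<Longrightarrow> x \<in> S \<Longrightarrow> norm (g (Suc k) x - g k x) \<le> C' * \<delta> k" using bvE[OF assms(2)] by metis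
  show ?thesis
  proof (rule bvI[of "max M M'" _ "C * C'" "2 * C * C'"])
    fix k x assume k: "k \<ge> max M M'" "x \<in> S"
    show "norm (f k x * g k x) \<le> C * C'"
      by (rule order_trans[OF norm_mult_ineq mult_mono]) (use k f(1) f(2)[of k x] g(1) g(2)[of k x] in auto)
    have eq: "f (Suc k) x * g (Suc k) x - f k x * g k x = (f (Suc k) x - f k x) * g (Suc k) x + f k x * (g (Suc k) x - g k x)"
      by (simp add: algebra_simps)
    have "norm ((f (Suc k) x - f k x) * g (Suc k) x) \<le> (C * \<delta> k) * C'"
      by (rule order_trans[OF norm_mult_ineq mult_mono]) (use k f(1) f(3)[of k x] g(2)[of "Suc k" x] \<delta>_nonneg in auto)
    moreover have "norm (f k x * (g (Suc k) x - g k x)) \<le> C * (C' * \<delta> k)"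
      by (rule order_trans[OF norm_mult_ineq mult_mono]) (use k f(1) f(2)[of k x] g(3)[of k x] in auto)
    ultimately have "norm (f (Suc k) x * g (Suc k) x - f k x * g k x) \<le> (C * \<delta> k) * C' + C * (C' * \<delta> k)"
      unfolding eq by (rule norm_triangle_mono)
    then show "norm (f (Suc k) x * g (Suc k) x - f k x * g k x) \<le> 2 * C * C' * \<delta> k" by (simp add: algebra_simps)
  qed
qed

lemma bv_diff:
  fixes f g :: "nat \<Rightarrow> real \<Rightarrow> 'a::real_normed_algebra_1"
  assumes "bv f" "bv g" shows "bv (\<lambda>k x. f k x - g k x)"
  using bv_add[OF assms(1) bv_mult[OF bv_const[of "-1"] assms(2)]] by simp

lemma bv_of_real:
  assumes "bv f" shows "bv (\<lambda>k x. of_real (f k x) :: complex)"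
proof -
  have "norm (of_real (f (Suc k) x) - of_real (f k x) :: complex) = norm (f (Suc k) x - f k x)" for k x
    by (metis norm_of_real of_real_diff real_norm_def)
  then show ?thesis using assms unfolding bv_def by simp
qed

lemma bv_sqrt:
  assumes "bv f" and c: "c > 0" "\<forall>\<^sub>F k in sequentially. \<forall>x\<in>S. f k x \<ge> c"
  shows "bv (\<lambda>k x. sqrt (f k x))"
proof -
  obtain M C where f: "C \<ge> 0" "\<And>k x. k \<ge> M \<Longrightarrow> x \<in> S \<Longrightarrow> norm (f k x) \<le> C"
    "\<And>k x. k \<ge> M \<Longrightarrow> x \<in> S \<Longrightarrow> norm (f (Suc k) x - f k x) \<le> C * \<delta> k" using bvE[OF assms(1)] by metis
  obtain M' where M': "\<And>k x. k \<ge> M' \<Longrightarrow> x \<in> S \<Longrightarrow> f k x \<ge> c"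
    using c(2) unfolding eventually_sequentially by blast
  show ?thesis
  proof (rule bvI[of "max M M'" _ "sqrt C" "C / (2 * sqrt c)"])
    fix k x assume k: "k \<ge> max M M'" "x \<in> S"
    have ge: "f k x \<ge> c" "f (Suc k) x \<ge> c" using k M' by auto
    then show "norm (sqrt (f k x)) \<le> sqrt C" using k f(2)[of k x] c(1) by simp
    define u v where "u = sqrt (f (Suc k) x)" "v = sqrt (f k x)"
    have uv: "u \<ge> sqrt c" "v \<ge> sqrt c" "u\<^sup>2 = f (Suc k) x" "v\<^sup>2 = f k x"
      using ge c(1) by (auto simp: u_v_def)
    have sc: "sqrt c > 0" using c by simp
    have "\<bar>u - v\<bar> * (2 * sqrt c) \<le> \<bar>u - v\<bar> * (u + v)" using uv by (intro mult_left_mono) auto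
    also have "\<dots> = \<bar>(u - v) * (u + v)\<bar>"
    proof -
      have "u + v > 0" using uv(1,2) sc by linarith
      then show ?thesis by (simp add: abs_mult)
    qed
    also have "(u - v) * (u + v) = u\<^sup>2 - v\<^sup>2" by (simp add: power2_eq_square algebra_simps)
    also have "\<bar>u\<^sup>2 - v\<^sup>2\<bar> \<le> C * \<delta> k" unfolding uv using f(3)[of k x] k by simp
    finally have "\<bar>u - v\<bar> * (2 * sqrt c) \<le> C * \<delta> k" .
    then have "\<bar>u - v\<bar> \<le> C * \<delta> k / (2 * sqrt c)" using sc by (simp add: pos_le_divide_eq)
    then show "norm (sqrt (f (Suc k) x) - sqrt (f k x)) \<le> C / (2 * sqrt c) * \<delta> k"
      by (simp add: u_v_def)
  qed
qed

lemma bv_inverse: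
  fixes f :: "nat \<Rightarrow> real \<Rightarrow> real"
  assumes "bv f" and c: "c > 0" "\<forall>\<^sub>F k in sequentially. \<forall>x\<in>S. \<bar>f k x\<bar> \<ge> c"
  shows "bv (\<lambda>k x. inverse (f k x))"
proof -
  obtain M C where f: "C \<ge> 0" "\<And>k x. k \<ge> M \<Longrightarrow> x \<in> S \<Longrightarrow> norm (f k x) \<le> C"
    "\<And>k x. k \<ge> M \<Longrightarrow> x \<in> S \<Longrightarrow> norm (f (Suc k) x - f k x) \<le> C * \<delta> k" using bvE[OF assms(1)] by metis
  obtain M' where M': "\<And>k x. k \<ge> M' \<Longrightarrow> x \<in> S \<Longrightarrow> \<bar>f k x\<bar> \<ge> c"
    using c(2) unfolding eventually_sequentially by blast
  show ?thesis
  proof (rule bvI[of "max M M'" _ "1 / c" "C / (c * c)"])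
    fix k x assume k: "k \<ge> max M M'" "x \<in> S"
    have ge: "\<bar>f k x\<bar> \<ge> c" "\<bar>f (Suc k) x\<bar> \<ge> c" using k M' by auto
    then have nz: "f k x \<noteq> 0" "f (Suc k) x \<noteq> 0" using c by auto
    show "norm (inverse (f k x)) \<le> 1 / c" using ge c by (simp add: divide_simps)
    have "norm (inverse (f (Suc k) x) - inverse (f k x)) = norm (f (Suc k) x - f k x) / (\<bar>f (Suc k) x\<bar> * \<bar>f k x\<bar>)"
    proof -
      have "inverse (f (Suc k) x) - inverse (f k x) = (f k x - f (Suc k) x) / (f (Suc k) x * f k x)"
        using nz by (simp add: field_simps)
      then show ?thesis by (simp add: abs_mult abs_divide abs_minus_commute)
    qed
    also have "\<dots> \<le> (C * \<delta> k) / (c * c)"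
      by (intro frac_le mult_mono) (use ge c f(3)[of k x] k in \<open>auto\<close>)
    finally show "norm (inverse (f (Suc k) x) - inverse (f k x)) \<le> C / (c * c) * \<delta> k" by simp
  qed
qed

lemma bv_limit:
  fixes f :: "nat \<Rightarrow> real \<Rightarrow> 'a::banach"
  assumes "bv f" and lim: "\<And>x. x \<in> S \<Longrightarrow> (\<lambda>k. f k x) \<longlonglongrightarrow> F x"
  obtains M C where "C \<ge> 0" "\<And>k x. k \<ge> M \<Longrightarrow> x \<in> S \<Longrightarrow> norm (f k x - F x) \<le> C * tail k"
proof -
  obtain M C where f: "C \<ge> 0" "\<And>k x. k \<ge> M \<Longrightarrow> x \<in> S \<Longrightarrow> norm (f k x) \<le> C"
    "\<And>k x. k \<ge> M \<Longrightarrow> x \<in> S \<Longrightarrow> norm (f (Suc k) x - f k x) \<le> C * \<delta> k" using bvE[OF assms(1)] by metis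
  have "norm (f k x - F x) \<le> C * tail k" if "k \<ge> M" "x \<in> S" for k x
  proof -
    obtain L where L: "(\<lambda>k. f k x) \<longlonglongrightarrow> L" "\<And>k. k \<ge> M \<Longrightarrow> norm (f k x - L) \<le> (\<Sum>j. C * \<delta> (j + k))"
      using telescoping_limit[of "\<lambda>k. C * \<delta> k" M "\<lambda>k. f k x"] f(3) \<open>x \<in> S\<close> summable_mult[OF \<delta>_summable] by metis
    have "(\<Sum>j. C * \<delta> (j + k)) = C * tail k"
      unfolding tail_def using \<delta>_summable by (intro suminf_mult) (simp add: summable_iff_shift)
    moreover have "L = F x" using LIMSEQ_unique[OF L(1) lim[OF \<open>x \<in> S\<close>]] .
    ultimately show ?thesis using L(2)[OF that(1)] by simp
  qed
  with that f(1) show thesis by blast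
qed

lemma eventually_tail_less: "e > 0 \<Longrightarrow> \<forall>\<^sub>F k in sequentially. C * tail k < e"
  using order_tendstoD(2)[OF tendsto_mult_right_zero[OF tail_tendsto_0, of C]] by simp

text \<open>The rate \<open>C * tail k\<close> does not depend on \<open>x\<close>, so a lower bound
  of the limit holds, with a small loss, for all \<open>x\<close> at once from some index
  on.\<close>

lemma bv_eventually_ge:
  fixes f :: "nat \<Rightarrow> real \<Rightarrow> real"
  assumes "bv f" "\<And>x. x \<in> S \<Longrightarrow> (\<lambda>k. f k x) \<longlonglongrightarrow> F x" "c' < c" "\<And>x. x \<in> S \<Longrightarrow> F x \<ge> c"
  shows "\<forall>\<^sub>F k in sequentially. \<forall>x\<in>S. f k x \<ge> c'"
proof -
  obtain M C where M: "C \<ge> 0" "\<And>k x. k \<ge> M \<Longrightarrow> x \<in> S \<Longrightarrow> norm (f k x - F x) \<le> C * tail k"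
    using bv_limit[OF assms(1,2)] by metis
  have "\<forall>\<^sub>F k in sequentially. C * tail k < c - c'" using assms(3) by (intro eventually_tail_less) simp
  then show ?thesis using eventually_ge_at_top[of M]
  proof eventually_elim
    case (elim k)
    show ?case
    proof
      fix x assume "x \<in> S"
      then have "\<bar>f k x - F x\<bar> \<le> C * tail k" "F x \<ge> c" using M(2)[of k x] assms(4) elim by auto
      then show "f k x \<ge> c'" using elim(1) by linarith
    qed
  qed
qed

lemma bv_eventually_abs_ge:
  fixes f :: "nat \<Rightarrow> real \<Rightarrow> real"
  assumes "bv f" "\<And>x. x \<in> S \<Longrightarrow> (\<lambda>k. f k x) \<longlonglongrightarrow> F x" "c' < c" "\<And>x. x \<in> S \<Longrightarrow> \<bar>F x\<bar> \<ge> c"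
  shows "\<forall>\<^sub>F k in sequentially. \<forall>x\<in>S. \<bar>f k x\<bar> \<ge> c'"
proof (rule bv_eventually_ge[OF _ _ assms(3)])
  show "bv (\<lambda>k x. \<bar>f k x\<bar>)"
  proof -
    obtain M C where f: "C \<ge> 0" "\<And>k x. k \<ge> M \<Longrightarrow> x \<in> S \<Longrightarrow> norm (f k x) \<le> C"
      "\<And>k x. k \<ge> M \<Longrightarrow> x \<in> S \<Longrightarrow> norm (f (Suc k) x - f k x) \<le> C * \<delta> k" using bvE[OF assms(1)] by metis
    show ?thesis
      by (rule bvI[of M _ C C]) (use f in \<open>auto intro: order_trans[OF abs_triangle_ineq3]\<close>)
  qed
  show "(\<lambda>k. \<bar>f k x\<bar>) \<longlonglongrightarrow> \<bar>F x\<bar>" if "x \<in> S" for x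
    using assms(2)[OF that] by (intro tendsto_intros)
qed (use assms(4) in auto)

text \<open>Dividing by the accumulated phase leaves a sequence \<open>y\<close> with increments of
  relative size \<open>C * \<delta> k\<close>, so \<open>y\<close> converges at the rate of the
  tail. The smallness of \<open>C * tail M\<close> keeps \<open>norm (y k x)\<close> between half
  and twice its initial value, which gives the limit a lower bound.\<close>

lemma perturbed_rotation:
  fixes z e :: "nat \<Rightarrow> real \<Rightarrow> complex"
  assumes e1: "\<And>k x. k \<ge> M \<Longrightarrow> x \<in> S \<Longrightarrow> norm (e k x) = 1"
    and z: "\<And>k x. k \<ge> M \<Longrightarrow> x \<in> S \<Longrightarrow> norm (z (Suc k) x - e (Suc k) x * z k x) \<le> C * \<delta> k * norm (z k x)"
    and C: "C \<ge> 0" "C * tail M \<le> 1 / 4"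
    and contz: "\<And>k. k \<ge> M \<Longrightarrow> continuous_on S (z k)" and conte: "\<And>k. k \<ge> M \<Longrightarrow> continuous_on S (e k)"
    and zb: "\<And>x. x \<in> S \<Longrightarrow> norm (z M x) \<le> B"
  obtains \<zeta> where "continuous_on S \<zeta>"
    "\<And>k x. k \<ge> M \<Longrightarrow> x \<in> S \<Longrightarrow> norm (z k x - \<zeta> x * (\<Prod>j=M+1..k. e j x)) \<le> 2 * C * norm (z M x) * tail k"
    "\<And>x. x \<in> S \<Longrightarrow> norm (\<zeta> x) \<ge> norm (z M x) / 2"
    "\<And>k x. k \<ge> M \<Longrightarrow> x \<in> S \<Longrightarrow> norm (z k x) \<ge> norm (z M x) / 2"
    "\<And>k x. k \<ge> M \<Longrightarrow> x \<in> S \<Longrightarrow> norm (z k x) \<le> 2 * norm (z M x)"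
proof -
  define E where "E k x = (\<Prod>j=M+1..k. e j x)" for k x
  define y where "y k x = z k x / E k x" for k x
  have E1: "norm (E k x) = 1" if "x \<in> S" for k x
    unfolding E_def prod_norm[symmetric] using that by (intro prod.neutral) (auto intro: e1)
  have EM: "E M x = 1" for x by (simp add: E_def)
  have ES: "E (Suc k) x = E k x * e (Suc k) x" if "k \<ge> M" for k x
    using that by (simp add: E_def)
  have E0: "E k x \<noteq> 0" if "x \<in> S" for k x using E1[OF that, of k] by auto
  have ny: "norm (y k x) = norm (z k x)" if "x \<in> S" for k x using E1[OF that] by (simp add: y_def norm_divide)
  have yM: "y M x = z M x" for x by (simp add: y_def EM)
  have incr: "norm (y (Suc k) x - y k x) \<le> C * \<delta> k * norm (y k x)" if "k \<ge> M" "x \<in> S" for k x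
  proof -
    have "e (Suc k) x \<noteq> 0" using e1[of "Suc k" x] that by auto
    then have "y (Suc k) x - y k x = (z (Suc k) x - e (Suc k) x * z k x) / E (Suc k) x"
      using E0[OF that(2)] by (simp add: y_def ES[OF that(1)] field_simps)
    then show ?thesis using z[OF that] E1[OF that(2)] by (simp add: norm_divide ny[OF that(2)])
  qed
  \<comment> \<open>A bootstrap: the bound \<open>2 * norm (y M x)\<close> on the earlier terms
    limits the total drift to half of the initial norm, and this reproduces the bound for the next
    term.\<close>
  have bound: "norm (y k x - y M x) \<le> 2 * norm (y M x) * (C * (\<Sum>j=M..<k. \<delta> j)) \<and> norm (y k x) \<le> 2 * norm (y M x)"
    if "k \<ge> M" "x \<in> S" for k x
    using that(1)
  proof (induction k rule: dec_induct)
    case base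
    then show ?case by simp
  next
    case (step n)
    have "norm (y (Suc n) x - y n x) \<le> C * \<delta> n * (2 * norm (y M x))"
      using incr[OF step(1) \<open>x \<in> S\<close>] step.IH C(1) \<delta>_nonneg[of n]
      by (meson mult_left_mono mult_nonneg_nonneg order_trans)
    moreover have "norm (y (Suc n) x - y M x) \<le> norm (y (Suc n) x - y n x) + norm (y n x - y M x)"
      using norm_triangle_ineq[of "y (Suc n) x - y n x" "y n x - y M x"] by simp
    ultimately have 1: "norm (y (Suc n) x - y M x) \<le> 2 * norm (y M x) * (C * (\<Sum>j=M..<Suc n. \<delta> j))"
      using step by (simp add: algebra_simps)
    also have "\<dots> \<le> 2 * norm (y M x) * (1 / 4)"
      using C sum_le_tail[of M "Suc n"] step(1) by (intro mult_left_mono order_trans[OF mult_left_mono C(2)]) auto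
    finally have "norm (y (Suc n) x - y M x) \<le> norm (y M x) / 2" by simp
    then have "norm (y (Suc n) x) \<le> 2 * norm (y M x)"
      using norm_triangle_ineq2[of "y (Suc n) x" "y M x"] by (smt (verit) norm_ge_zero field_sum_of_halves)
    with 1 show ?case by simp
  qed
  have "\<exists>L. (\<lambda>k. y k x) \<longlonglongrightarrow> L \<and> (\<forall>k\<ge>M. norm (y k x - L) \<le> 2 * C * norm (z M x) * tail k)" if x: "x \<in> S" for x
  proof -
    have "norm (y (Suc k) x - y k x) \<le> 2 * C * norm (z M x) * \<delta> k" if "k \<ge> M" for k
    proof -
      have "norm (y (Suc k) x - y k x) \<le> C * \<delta> k * (2 * norm (y M x))"
        using incr[OF that x] bound[OF that x] C(1) \<delta>_nonneg[of k]
        by (meson mult_left_mono mult_nonneg_nonneg order_trans)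
      then show ?thesis by (simp add: yM mult_ac)
    qed
    then obtain L where L: "(\<lambda>k. y k x) \<longlonglongrightarrow> L" "\<And>k. k \<ge> M \<Longrightarrow> norm (y k x - L) \<le> (\<Sum>j. 2 * C * norm (z M x) * \<delta> (j + k))"
      using telescoping_limit[of "\<lambda>k. 2 * C * norm (z M x) * \<delta> k" M "\<lambda>k. y k x"] summable_mult[OF \<delta>_summable] by metis
    have "(\<Sum>j. 2 * C * norm (z M x) * \<delta> (j + k)) = 2 * C * norm (z M x) * tail k" for k
      unfolding tail_def using \<delta>_summable by (intro suminf_mult) (simp add: summable_iff_shift)
    with L show ?thesis by auto
  qed
  then obtain \<zeta> where lim: "\<And>x. x \<in> S \<Longrightarrow> (\<lambda>k. y k x) \<longlonglongrightarrow> \<zeta> x"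
    and rate: "\<And>k x. k \<ge> M \<Longrightarrow> x \<in> S \<Longrightarrow> norm (y k x - \<zeta> x) \<le> 2 * C * norm (z M x) * tail k" by metis
  have rate': "norm (z k x - \<zeta> x * E k x) \<le> 2 * C * norm (z M x) * tail k" if "k \<ge> M" "x \<in> S" for k x
  proof -
    have "z k x - \<zeta> x * E k x = (y k x - \<zeta> x) * E k x" using E0[OF that(2)] by (simp add: y_def field_simps)
    then show ?thesis using rate[OF that] E1[OF that(2)] by (simp add: norm_mult)
  qed
  have near: "norm (y k x - y M x) \<le> norm (z M x) / 2" if "k \<ge> M" "x \<in> S" for k x
  proof -
    have "(\<Sum>j=M..<k. \<delta> j) \<le> tail M" by (rule sum_le_tail[OF that(1)])
    then have "C * (\<Sum>j=M..<k. \<delta> j) \<le> 1 / 4" using C by (meson mult_left_mono order_trans)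
    then have "2 * norm (y M x) * (C * (\<Sum>j=M..<k. \<delta> j)) \<le> 2 * norm (y M x) * (1 / 4)" by (intro mult_left_mono) auto
    with bound[OF that] show ?thesis by (simp add: yM)
  qed
  have lower: "norm (z k x) \<ge> norm (z M x) / 2" if "k \<ge> M" "x \<in> S" for k x
    using near[OF that] norm_triangle_ineq2[of "y M x" "y k x"] ny[OF that(2), of k]
    by (simp add: yM norm_minus_commute)
  have lowz: "norm (\<zeta> x) \<ge> norm (z M x) / 2" if "x \<in> S" for x
  proof -
    have "(\<lambda>k. norm (y k x)) \<longlonglongrightarrow> norm (\<zeta> x)" by (intro tendsto_norm lim that)
    then show ?thesis
      by (rule LIMSEQ_le_const) (use lower ny that in auto)
  qed
  have cont: "continuous_on S \<zeta>"
  proof (rule uniform_limit_theorem[of _ y sequentially])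
    show "\<forall>\<^sub>F n in sequentially. continuous_on S (y n)"
      using eventually_ge_at_top[of M]
    proof eventually_elim
      case (elim n)
      show ?case unfolding y_def E_def
        using E0 by (intro continuous_intros contz elim conte) (auto simp: E_def)
    qed
    show "uniform_limit S y \<zeta> sequentially"
    proof (rule uniform_limitI)
      fix ee :: real assume "ee > 0"
      then have "\<forall>\<^sub>F k in sequentially. 2 * C * max B 0 * tail k < ee" by (rule eventually_tail_less)
      then show "\<forall>\<^sub>F n in sequentially. \<forall>x\<in>S. dist (y n x) (\<zeta> x) < ee"
        using eventually_ge_at_top[of M]
      proof eventually_elim
        case (elim n)
        show ?case
        proof
          fix x assume x: "x \<in> S"
          have "dist (y n x) (\<zeta> x) \<le> 2 * C * norm (z M x) * tail n" using rate[OF elim(2) x] by (simp add: dist_norm)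
          also have "\<dots> \<le> 2 * C * max B 0 * tail n"
            using zb[OF x] C(1) tail_nonneg[of n] by (intro mult_right_mono mult_left_mono) auto
          finally show "dist (y n x) (\<zeta> x) < ee" using elim(1) by simp
        qed
      qed
    qed
  qed simp
  show thesis
    by (rule that[OF cont rate'[unfolded E_def] lowz lower]) (use bound ny yM in auto)
qed

text \<open>Only differences are controlled by \<open>\<delta>\<close>; boundedness of the sequence
  is recovered from the limit by adding the tail.\<close>

lemma bv_of_limit:
  fixes f :: "nat \<Rightarrow> real \<Rightarrow> 'a::banach"
  assumes var: "\<And>k x. k \<ge> 1 \<Longrightarrow> x \<in> S \<Longrightarrow> norm (f (Suc k) x - f k x) \<le> \<delta> k"
    and lim: "\<And>x. x \<in> S \<Longrightarrow> (\<lambda>k. f k x) \<longlonglongrightarrow> F x" and F: "\<And>x. x \<in> S \<Longrightarrow> norm (F x) \<le> B"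
  shows "bv f"
proof (rule bvI[of 1 _ "B + tail 1" 1])
  fix k :: nat and x assume k: "k \<ge> 1" "x \<in> S"
  obtain L where L: "(\<lambda>k. f k x) \<longlonglongrightarrow> L" "\<And>k. k \<ge> 1 \<Longrightarrow> norm (f k x - L) \<le> (\<Sum>j. \<delta> (j + k))"
    using telescoping_limit[of \<delta> 1 "\<lambda>k. f k x"] var \<open>x \<in> S\<close> \<delta>_summable by metis
  have "L = F x" using LIMSEQ_unique[OF L(1) lim[OF \<open>x \<in> S\<close>]] .
  then have "norm (f k x - F x) \<le> tail k" using L(2)[OF k(1)] by (simp add: tail_def)
  moreover have "tail k \<le> tail 1" by (rule tail_mono[OF k(1)])
  ultimately show "norm (f k x) \<le> B + tail 1"
    using F[OF k(2)] norm_triangle_ineq2[of "f k x" "F x"] by linarith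
qed (use var in auto)

end

section \<open>Elliptic recurrences and their phase asymptotics\<close>

lemma left_eigenvector:
  fixes e :: complex
  assumes "y11 * y22 - y12 * y21 = 1" "e\<^sup>2 = (y11 + y22) * e - 1"
  shows "y21 * (y11 * v1 + y12 * v2) + (e - y11) * (y21 * v1 + y22 * v2) = e * (y21 * v1 + (e - y11) * v2)"
proof -
  have "y21 * (y11 * v1 + y12 * v2) + (e - y11) * (y21 * v1 + y22 * v2) - e * (y21 * v1 + (e - y11) * v2)
    = v2 * (((y11 + y22) * e - 1 - e\<^sup>2) - (y11 * y22 - y12 * y21 - 1))"
    by (simp add: algebra_simps power2_eq_square)
  then show ?thesis using assms by simp
qed

lemma compact_continuous_pos_bound:
  fixes f :: "real \<Rightarrow> real"
  assumes "compact S" "continuous_on S f" "\<And>x. x \<in> S \<Longrightarrow> f x > 0"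
  obtains d where "d > 0" "\<And>x. x \<in> S \<Longrightarrow> f x \<ge> d"
proof (cases "S = {}")
  case True
  with that[of 1] show thesis by auto
next
  case False
  from continuous_attains_inf[OF assms(1) this assms(2)] assms(3) that show thesis by blast
qed

lemma compact_continuous_norm_bound:
  fixes f :: "real \<Rightarrow> 'a::real_normed_vector"
  assumes "compact S" "continuous_on S f"
  obtains B where "B > 0" "\<And>x. x \<in> S \<Longrightarrow> norm (f x) \<le> B"
proof -
  have "bounded (f ` S)" by (rule compact_imp_bounded[OF compact_continuous_image[OF assms(2,1)]])
  then show thesis using that unfolding bounded_pos by blast
qed

text \<open>\<open>x11, \<dots>, x22\<close> are the entries of the transfer matrices, \<open>y11, \<dots>, y22\<close> those of their limit,
  and \<open>(p, q)\<close> is the vector they act on.\<close>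

locale elliptic_recurrence = variation S \<delta> for S :: "real set" and \<delta> +
  fixes x11 x12 x21 x22 :: "nat \<Rightarrow> real \<Rightarrow> real" and y11 y12 y21 y22 :: "real \<Rightarrow> real"
    and \<alpha> :: "nat \<Rightarrow> real" and p q :: "nat \<Rightarrow> real \<Rightarrow> real"
  assumes compact_S: "compact S"
    and var11: "\<And>k x. k \<ge> 1 \<Longrightarrow> x \<in> S \<Longrightarrow> \<bar>x11 (Suc k) x - x11 k x\<bar> \<le> \<delta> k"
    and var12: "\<And>k x. k \<ge> 1 \<Longrightarrow> x \<in> S \<Longrightarrow> \<bar>x12 (Suc k) x - x12 k x\<bar> \<le> \<delta> k"
    and var21: "\<And>k x. k \<ge> 1 \<Longrightarrow> x \<in> S \<Longrightarrow> \<bar>x21 (Suc k) x - x21 k x\<bar> \<le> \<delta> k"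
    and var22: "\<And>k x. k \<ge> 1 \<Longrightarrow> x \<in> S \<Longrightarrow> \<bar>x22 (Suc k) x - x22 k x\<bar> \<le> \<delta> k"
    and lim: "\<And>x. x \<in> S \<Longrightarrow> (\<lambda>k. x11 k x) \<longlonglongrightarrow> y11 x" "\<And>x. x \<in> S \<Longrightarrow> (\<lambda>k. x12 k x) \<longlonglongrightarrow> y12 x"
      "\<And>x. x \<in> S \<Longrightarrow> (\<lambda>k. x21 k x) \<longlonglongrightarrow> y21 x" "\<And>x. x \<in> S \<Longrightarrow> (\<lambda>k. x22 k x) \<longlonglongrightarrow> y22 x"
    and conty: "continuous_on S y11" "continuous_on S y12" "continuous_on S y21" "continuous_on S y22"
    and contx: "\<And>k. k \<ge> 1 \<Longrightarrow> continuous_on S (x11 k)" "\<And>k. k \<ge> 1 \<Longrightarrow> continuous_on S (x12 k)"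
      "\<And>k. k \<ge> 1 \<Longrightarrow> continuous_on S (x21 k)" "\<And>k. k \<ge> 1 \<Longrightarrow> continuous_on S (x22 k)"
    and \<alpha>_pos: "\<And>k. \<alpha> k > 0" and \<alpha>_ratio: "(\<lambda>k. \<alpha> k / \<alpha> (Suc k)) \<longlonglongrightarrow> 1"
    and det: "\<And>k x. k \<ge> 1 \<Longrightarrow> x11 k x * x22 k x - x12 k x * x21 k x = \<alpha> k / \<alpha> (Suc k)"
    and elliptic: "\<And>x. x \<in> S \<Longrightarrow> (y11 x + y22 x)\<^sup>2 < 4"
    and rec: "\<And>k x. k \<ge> 1 \<Longrightarrow> p (Suc k) x = x11 k x * p k x + x12 k x * q k x"
      "\<And>k x. k \<ge> 1 \<Longrightarrow> q (Suc k) x = x21 k x * p k x + x22 k x * q k x"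
    and contpq: "\<And>k. continuous_on S (p k)" "\<And>k. continuous_on S (q k)"
    and nz: "\<And>k x. k \<ge> 1 \<Longrightarrow> p k x \<noteq> 0 \<or> q k x \<noteq> 0"
begin

text \<open>\<open>(\<beta>, \<gamma>)\<close> is the left eigenvector, with eigenvalue \<open>e\<close>, of the normalised \<open>k\<close>-th matrix, and \<open>z\<close> is
  its value on the normalised vector \<open>(v1, v2)\<close>; \<open>s\<close>, \<open>\<sigma>\<close> are the sines of the angles with cosines \<open>t\<close>, \<open>\<tau>\<close>.\<close>

definition D where "D k x = x11 k x * x22 k x - x12 k x * x21 k x"
definition isD where "isD k x = inverse (sqrt (D k x))"
definition t where "t k x = (x11 k x + x22 k x) / (2 * sqrt (D k x))"
definition s where "s k x = sqrt (1 - (t k x)\<^sup>2)"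
definition e where "e k x = complex_of_real (t k x) + \<i> * of_real (s k x)"
definition \<beta> where "\<beta> k x = x21 k x * isD k x"
definition \<gamma> where "\<gamma> k x = e k x - of_real (x11 k x * isD k x)"
definition v1 where "v1 k x = sqrt (\<alpha> k) * p k x"
definition v2 where "v2 k x = sqrt (\<alpha> k) * q k x"
definition z where "z k x = of_real (\<beta> k x * v1 k x) + \<gamma> k x * of_real (v2 k x)"
definition \<tau> where "\<tau> x = (y11 x + y22 x) / 2"
definition \<sigma> where "\<sigma> x = sqrt (1 - (\<tau> x)\<^sup>2)"
definition \<epsilon> where "\<epsilon> x = complex_of_real (\<tau> x) + \<i> * of_real (\<sigma> x)"

lemma D_eq: "k \<ge> 1 \<Longrightarrow> D k x = \<alpha> k / \<alpha> (Suc k)" using det by (simp add: D_def)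
lemma D_pos: "k \<ge> 1 \<Longrightarrow> D k x > 0" using D_eq \<alpha>_pos by simp

lemma D_lim: "(\<lambda>k. D k x) \<longlonglongrightarrow> 1"
  by (rule Lim_transform_eventually[OF \<alpha>_ratio])
    (use eventually_ge_at_top[of 1] in \<open>eventually_elim, simp add: D_eq\<close>)

lemma isD_lim: "(\<lambda>k. isD k x) \<longlonglongrightarrow> 1"
proof -
  have "(\<lambda>k. isD k x) \<longlonglongrightarrow> inverse (sqrt 1)" unfolding isD_def by (intro tendsto_intros D_lim) auto
  then show ?thesis by simp
qed

lemma y_det: "x \<in> S \<Longrightarrow> y11 x * y22 x - y12 x * y21 x = 1"
proof -
  assume x: "x \<in> S"
  have "(\<lambda>k. D k x) \<longlonglongrightarrow> y11 x * y22 x - y12 x * y21 x" unfolding D_def by (intro tendsto_intros lim x)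
  from LIMSEQ_unique[OF this D_lim] show ?thesis .
qed

lemma \<tau>_bound: "x \<in> S \<Longrightarrow> 1 - (\<tau> x)\<^sup>2 > 0"
  using elliptic[of x] by (simp add: \<tau>_def power_divide)

text \<open>A triangular real matrix has real eigenvalues, which ellipticity excludes.\<close>

lemma y21_nz:
  assumes "x \<in> S" shows "y21 x \<noteq> 0"
proof
  assume "y21 x = 0"
  then have "(y11 x + y22 x)\<^sup>2 - 4 = (y11 x - y22 x)\<^sup>2"
    using y_det[OF assms] by (simp add: power2_eq_square algebra_simps)
  then show False using elliptic[OF assms] by (smt (verit) zero_le_power2)
qed

lemma t_eq: "t k x = (x11 k x + x22 k x) * isD k x / 2"
  unfolding t_def isD_def by (simp only: divide_inverse inverse_mult_distrib mult_ac)

lemma t_lim: "x \<in> S \<Longrightarrow> (\<lambda>k. t k x) \<longlonglongrightarrow> \<tau> x"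
proof -
  assume x: "x \<in> S"
  have "(\<lambda>k. t k x) \<longlonglongrightarrow> (y11 x + y22 x) * 1 / 2" unfolding t_eq by (intro tendsto_intros lim isD_lim x) auto
  then show ?thesis by (simp add: \<tau>_def)
qed

lemma s_lim: "x \<in> S \<Longrightarrow> (\<lambda>k. s k x) \<longlonglongrightarrow> \<sigma> x"
  unfolding s_def \<sigma>_def by (intro tendsto_intros t_lim)

lemma e_lim: "x \<in> S \<Longrightarrow> (\<lambda>k. e k x) \<longlonglongrightarrow> \<epsilon> x"
  unfolding e_def \<epsilon>_def by (intro tendsto_intros t_lim s_lim)

lemma \<beta>_lim: "x \<in> S \<Longrightarrow> (\<lambda>k. \<beta> k x) \<longlonglongrightarrow> y21 x"
proof -
  assume x: "x \<in> S"
  have "(\<lambda>k. \<beta> k x) \<longlonglongrightarrow> y21 x * 1" unfolding \<beta>_def by (intro tendsto_intros lim isD_lim x)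
  then show ?thesis by simp
qed

lemma \<gamma>_lim: "x \<in> S \<Longrightarrow> (\<lambda>k. \<gamma> k x) \<longlonglongrightarrow> \<epsilon> x - of_real (y11 x)"
proof -
  assume x: "x \<in> S"
  have "(\<lambda>k. \<gamma> k x) \<longlonglongrightarrow> \<epsilon> x - of_real (y11 x * 1)" unfolding \<gamma>_def by (intro tendsto_intros lim isD_lim e_lim x)
  then show ?thesis by simp
qed

lemma bv_entries: "bv x11" "bv x12" "bv x21" "bv x22"
proof -
  obtain B1 where B1: "\<And>x. x \<in> S \<Longrightarrow> norm (y11 x) \<le> B1" using compact_continuous_norm_bound[OF compact_S conty(1)] by metis
  obtain B2 where B2: "\<And>x. x \<in> S \<Longrightarrow> norm (y12 x) \<le> B2" using compact_continuous_norm_bound[OF compact_S conty(2)] by metis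
  obtain B3 where B3: "\<And>x. x \<in> S \<Longrightarrow> norm (y21 x) \<le> B3" using compact_continuous_norm_bound[OF compact_S conty(3)] by metis
  obtain B4 where B4: "\<And>x. x \<in> S \<Longrightarrow> norm (y22 x) \<le> B4" using compact_continuous_norm_bound[OF compact_S conty(4)] by metis
  show "bv x11" by (rule bv_of_limit[OF _ lim(1) B1]) (use var11 in auto)
  show "bv x12" by (rule bv_of_limit[OF _ lim(2) B2]) (use var12 in auto)
  show "bv x21" by (rule bv_of_limit[OF _ lim(3) B3]) (use var21 in auto)
  show "bv x22" by (rule bv_of_limit[OF _ lim(4) B4]) (use var22 in auto)
qed

lemma bv_D: "bv D" unfolding D_def[abs_def] by (intro bv_diff bv_mult bv_entries)

lemma D_ge: "\<forall>\<^sub>F k in sequentially. \<forall>x\<in>S. D k x \<ge> 1 / 2"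
  by (rule bv_eventually_ge[OF bv_D D_lim, of "1/2" 1]) auto

lemma bv_isD: "bv isD"
proof -
  have "\<forall>\<^sub>F k in sequentially. \<forall>x\<in>S. \<bar>sqrt (D k x)\<bar> \<ge> sqrt (1 / 2)"
    using D_ge by eventually_elim (auto intro!: order_trans[OF _ abs_ge_self])
  then show ?thesis unfolding isD_def[abs_def]
    by (intro bv_inverse[OF bv_sqrt[OF bv_D _ D_ge]]) auto
qed

lemma bv_t: "bv t"
proof -
  have "bv (\<lambda>k x. (x11 k x + x22 k x) * isD k x * (1 / 2))"
    by (intro bv_mult bv_add bv_entries bv_isD bv_const)
  then show ?thesis unfolding t_eq[abs_def] by simp
qed

lemma \<tau>_uniform:
  obtains d where "d > 0" "\<forall>x\<in>S. 1 - (\<tau> x)\<^sup>2 \<ge> d" "\<forall>\<^sub>F k in sequentially. \<forall>x\<in>S. 1 - (t k x)\<^sup>2 \<ge> d / 2"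
proof -
  have "continuous_on S (\<lambda>x. 1 - (\<tau> x)\<^sup>2)" unfolding \<tau>_def by (intro continuous_intros conty) auto
  then obtain d where d: "d > 0" "\<And>x. x \<in> S \<Longrightarrow> 1 - (\<tau> x)\<^sup>2 \<ge> d"
    using compact_continuous_pos_bound[OF compact_S] \<tau>_bound by metis
  have "bv (\<lambda>k x. 1 - t k x * t k x)" by (intro bv_diff bv_mult bv_const bv_t)
  then have b: "bv (\<lambda>k x. 1 - (t k x)\<^sup>2)" by (simp add: power2_eq_square)
  have "\<forall>\<^sub>F k in sequentially. \<forall>x\<in>S. 1 - (t k x)\<^sup>2 \<ge> d / 2"
    by (rule bv_eventually_ge[OF b, of "\<lambda>x. 1 - (\<tau> x)\<^sup>2" "d/2" d]) (use d in \<open>auto intro!: tendsto_intros t_lim\<close>)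
  with d that show thesis by blast
qed

lemma bv_s: "bv s"
proof -
  obtain d where d: "d > 0" "\<forall>x\<in>S. 1 - (\<tau> x)\<^sup>2 \<ge> d" "\<forall>\<^sub>F k in sequentially. \<forall>x\<in>S. 1 - (t k x)\<^sup>2 \<ge> d / 2"
    by (rule \<tau>_uniform)
  have "bv (\<lambda>k x. 1 - t k x * t k x)" by (intro bv_diff bv_mult bv_const bv_t)
  then have b: "bv (\<lambda>k x. 1 - (t k x)\<^sup>2)" by (simp add: power2_eq_square)
  show ?thesis unfolding s_def[abs_def] by (rule bv_sqrt[OF b _ d(3)]) (use d(1) in auto)
qed

lemma bv_e: "bv e" unfolding e_def[abs_def] by (intro bv_add bv_mult bv_const bv_of_real bv_t bv_s)
lemma bv_\<beta>: "bv \<beta>" unfolding \<beta>_def[abs_def] by (intro bv_mult bv_entries bv_isD)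
lemma bv_\<gamma>: "bv \<gamma>" unfolding \<gamma>_def[abs_def] by (intro bv_diff bv_mult bv_of_real bv_entries bv_isD bv_e)

lemma \<beta>_uniform:
  obtains r where "r > 0" "\<forall>\<^sub>F k in sequentially. \<forall>x\<in>S. \<bar>\<beta> k x\<bar> \<ge> r"
proof -
  obtain r where r: "r > 0" "\<And>x. x \<in> S \<Longrightarrow> \<bar>y21 x\<bar> \<ge> r"
    using compact_continuous_pos_bound[OF compact_S, of "\<lambda>x. \<bar>y21 x\<bar>"] y21_nz conty
    by (metis continuous_on_rabs zero_less_abs_iff)
  have "\<forall>\<^sub>F k in sequentially. \<forall>x\<in>S. \<bar>\<beta> k x\<bar> \<ge> r / 2"
    by (rule bv_eventually_abs_ge[OF bv_\<beta> \<beta>_lim, of "r/2" r]) (use r in auto)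
  with r that[of "r/2"] show thesis by simp
qed

lemma v_rec:
  assumes "k \<ge> 1"
  shows "v1 (Suc k) x = isD k x * x11 k x * v1 k x + isD k x * x12 k x * v2 k x"
    "v2 (Suc k) x = isD k x * x21 k x * v1 k x + isD k x * x22 k x * v2 k x"
proof -
  have "sqrt (\<alpha> (Suc k)) = isD k x * sqrt (\<alpha> k)"
    using \<alpha>_pos[of k] \<alpha>_pos[of "Suc k"] by (simp add: isD_def D_eq[OF assms] real_sqrt_divide)
  then show "v1 (Suc k) x = isD k x * x11 k x * v1 k x + isD k x * x12 k x * v2 k x"
    "v2 (Suc k) x = isD k x * x21 k x * v1 k x + isD k x * x22 k x * v2 k x"
    by (simp_all add: v1_def v2_def rec[OF assms] algebra_simps)
qed

lemma eigen:
  assumes "k \<ge> 1" "1 - (t k x)\<^sup>2 \<ge> 0"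
  shows "of_real (\<beta> k x * v1 (Suc k) x) + \<gamma> k x * of_real (v2 (Suc k) x) = e k x * z k x"
proof -
  have s2: "(s k x)\<^sup>2 = 1 - (t k x)\<^sup>2" using assms by (simp add: s_def)
  have e2: "(e k x)\<^sup>2 = 2 * of_real (t k x) * e k x - 1"
    unfolding complex_eq_iff using s2 by (simp add: e_def power2_eq_square algebra_simps)
  have sd: "isD k x * isD k x * D k x = 1"
    using D_pos[OF assms(1), of x] by (simp add: isD_def real_sqrt_mult[symmetric] field_simps)
  let ?c = "\<lambda>r. complex_of_real (isD k x * r)"
  have d1: "?c (x11 k x) * ?c (x22 k x) - ?c (x12 k x) * ?c (x21 k x) = 1"
    using sd unfolding D_def of_real_mult[symmetric] of_real_diff[symmetric]
    by (simp only: of_real_eq_1_iff) (simp add: algebra_simps)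
  have "2 * complex_of_real (t k x) = ?c (x11 k x) + ?c (x22 k x)"
    by (simp add: t_eq algebra_simps)
  then have e2': "(e k x)\<^sup>2 = (?c (x11 k x) + ?c (x22 k x)) * e k x - 1" using e2 by simp
  from left_eigenvector[OF d1 e2', of "of_real (v1 k x)" "of_real (v2 k x)"] show ?thesis
    unfolding v_rec[OF assms(1)] z_def \<beta>_def \<gamma>_def by (simp add: mult_ac)
qed

text \<open>The complex number \<open>z\<close> determines both real coordinates: its imaginary part
  is \<open>s k x * v2 k x\<close>, and subtracting the \<gamma> term leaves
  \<open>\<beta> k x * v1 k x\<close>. Uniform lower bounds on \<open>s\<close> and
  \<open>\<beta>\<close> make this inversion uniform.\<close>

lemma v_le_z:
  obtains C where "C > 0" "\<forall>\<^sub>F k in sequentially. \<forall>x\<in>S. \<bar>v1 k x\<bar> + \<bar>v2 k x\<bar> \<le> C * norm (z k x)"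
proof -
  obtain d where d: "d > 0" "\<forall>x\<in>S. 1 - (\<tau> x)\<^sup>2 \<ge> d" "\<forall>\<^sub>F k in sequentially. \<forall>x\<in>S. 1 - (t k x)\<^sup>2 \<ge> d / 2"
    by (rule \<tau>_uniform)
  obtain r where r: "r > 0" "\<forall>\<^sub>F k in sequentially. \<forall>x\<in>S. \<bar>\<beta> k x\<bar> \<ge> r" by (rule \<beta>_uniform)
  obtain M G where G: "G \<ge> 0" "\<And>k x. k \<ge> M \<Longrightarrow> x \<in> S \<Longrightarrow> norm (\<gamma> k x) \<le> G" using bvE[OF bv_\<gamma>] by metis
  define c where "c = sqrt (d / 2)"
  have c: "c > 0" using d by (simp add: c_def)
  define C where "C = (1 + G / c) / r + 1 / c"
  have "\<forall>\<^sub>F k in sequentially. \<forall>x\<in>S. \<bar>v1 k x\<bar> + \<bar>v2 k x\<bar> \<le> C * norm (z k x)"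
    using d(3) r(2) eventually_ge_at_top[of M]
  proof eventually_elim
    case (elim k)
    show ?case
    proof
      fix x assume x: "x \<in> S"
      have sc: "s k x \<ge> c" unfolding s_def c_def using elim(1) x by simp
      have "\<bar>Im (z k x)\<bar> = s k x * \<bar>v2 k x\<bar>"
        using sc c by (simp add: z_def \<gamma>_def e_def abs_mult)
      then have "s k x * \<bar>v2 k x\<bar> \<le> norm (z k x)" using abs_Im_le_cmod[of "z k x"] by simp
      then have "c * \<bar>v2 k x\<bar> \<le> norm (z k x)" using sc mult_right_mono[OF sc, of "\<bar>v2 k x\<bar>"] by linarith
      then have v2: "\<bar>v2 k x\<bar> \<le> norm (z k x) / c" using c by (simp add: field_simps)
      have "norm (of_real (\<beta> k x * v1 k x) :: complex) \<le> norm (z k x) + norm (\<gamma> k x * of_real (v2 k x))"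
        using norm_triangle_ineq4[of "z k x" "\<gamma> k x * of_real (v2 k x)"] by (simp add: z_def)
      also have "norm (\<gamma> k x * of_real (v2 k x)) \<le> G * (norm (z k x) / c)"
        unfolding norm_mult using G elim(3) x v2 by (intro mult_mono) auto
      finally have "\<bar>\<beta> k x\<bar> * \<bar>v1 k x\<bar> \<le> norm (z k x) * (1 + G / c)"
        by (simp add: abs_mult norm_mult algebra_simps)
      moreover have "r * \<bar>v1 k x\<bar> \<le> \<bar>\<beta> k x\<bar> * \<bar>v1 k x\<bar>" using elim(2) x by (intro mult_right_mono) auto
      ultimately have "\<bar>v1 k x\<bar> \<le> norm (z k x) * (1 + G / c) / r" using r(1) by (simp add: field_simps)
      with v2 show "\<bar>v1 k x\<bar> + \<bar>v2 k x\<bar> \<le> C * norm (z k x)" by (simp add: C_def algebra_simps)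
    qed
  qed
  moreover have "C > 0" using G(1) c r(1) by (simp add: C_def add_nonneg_pos)
  ultimately show thesis using that by blast
qed

text \<open>By \<open>eigen\<close>, the eigenvector at \<open>k\<close> applied to the vector at
  \<open>Suc k\<close> gives exactly \<open>e k x * z k x\<close>. Passing to the eigenvector at
  \<open>Suc k\<close> costs increments of \<open>\<beta>\<close> and \<open>\<gamma>\<close>, and
  passing to \<open>e (Suc k) x\<close> an increment of \<open>e\<close>; the latter makes the
  accumulated phase run over \<open>M+1..k\<close>, as the sum in the theorem does.\<close>

lemma z_step:
  obtains C where "C > 0" "\<forall>\<^sub>F k in sequentially. \<forall>x\<in>S. norm (z (Suc k) x - e (Suc k) x * z k x) \<le> C * \<delta> k * norm (z k x)"
proof -
  obtain d where d: "d > 0" "\<forall>x\<in>S. 1 - (\<tau> x)\<^sup>2 \<ge> d" "\<forall>\<^sub>F k in sequentially. \<forall>x\<in>S. 1 - (t k x)\<^sup>2 \<ge> d / 2"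
    by (rule \<tau>_uniform)
  obtain V where V: "V > 0" "\<forall>\<^sub>F k in sequentially. \<forall>x\<in>S. \<bar>v1 k x\<bar> + \<bar>v2 k x\<bar> \<le> V * norm (z k x)" by (rule v_le_z)
  obtain M1 C1 where 1: "C1 \<ge> 0" "\<And>k x. k \<ge> M1 \<Longrightarrow> x \<in> S \<Longrightarrow> norm (\<beta> (Suc k) x - \<beta> k x) \<le> C1 * \<delta> k" using bvE[OF bv_\<beta>] by metis
  obtain M2 C2 where 2: "C2 \<ge> 0" "\<And>k x. k \<ge> M2 \<Longrightarrow> x \<in> S \<Longrightarrow> norm (\<gamma> (Suc k) x - \<gamma> k x) \<le> C2 * \<delta> k" using bvE[OF bv_\<gamma>] by metis
  obtain M3 C3 where 3: "C3 \<ge> 0" "\<And>k x. k \<ge> M3 \<Longrightarrow> x \<in> S \<Longrightarrow> norm (e (Suc k) x - e k x) \<le> C3 * \<delta> k" using bvE[OF bv_e] by metis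
  obtain N1 G1 where g1: "G1 \<ge> 0" "\<And>k x. k \<ge> N1 \<Longrightarrow> x \<in> S \<Longrightarrow> norm (isD k x * x11 k x) \<le> G1" using bvE[OF bv_mult[OF bv_isD bv_entries(1)]] by metis
  obtain N2 G2 where g2: "G2 \<ge> 0" "\<And>k x. k \<ge> N2 \<Longrightarrow> x \<in> S \<Longrightarrow> norm (isD k x * x12 k x) \<le> G2" using bvE[OF bv_mult[OF bv_isD bv_entries(2)]] by metis
  obtain N3 G3 where g3: "G3 \<ge> 0" "\<And>k x. k \<ge> N3 \<Longrightarrow> x \<in> S \<Longrightarrow> norm (isD k x * x21 k x) \<le> G3" using bvE[OF bv_mult[OF bv_isD bv_entries(3)]] by metis
  obtain N4 G4 where g4: "G4 \<ge> 0" "\<And>k x. k \<ge> N4 \<Longrightarrow> x \<in> S \<Longrightarrow> norm (isD k x * x22 k x) \<le> G4" using bvE[OF bv_mult[OF bv_isD bv_entries(4)]] by metis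
  define G where "G = G1 + G2 + G3 + G4"
  define C where "C = (C1 * (G * V) + C2 * (G * V) + C3) + 1"
  have Gn: "G \<ge> 0" using g1 g2 g3 g4 by (simp add: G_def)
  have "\<forall>\<^sub>F k in sequentially. \<forall>x\<in>S. norm (z (Suc k) x - e (Suc k) x * z k x) \<le> C * \<delta> k * norm (z k x)"
    using d(3) V(2) eventually_ge_at_top[of 1] eventually_ge_at_top[of M1] eventually_ge_at_top[of M2] eventually_ge_at_top[of M3]
      eventually_ge_at_top[of N1] eventually_ge_at_top[of N2] eventually_ge_at_top[of N3] eventually_ge_at_top[of N4]
  proof eventually_elim
    case (elim k)
    show ?case
    proof
      fix x assume x: "x \<in> S"
      have abs2: "\<bar>a * u + b * v\<bar> \<le> G * (V * norm (z k x))"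
        if "\<bar>a\<bar> \<le> G" "\<bar>b\<bar> \<le> G" "u = v1 k x" "v = v2 k x" for a b u v
      proof -
        have "\<bar>a * u + b * v\<bar> \<le> \<bar>a\<bar> * \<bar>u\<bar> + \<bar>b\<bar> * \<bar>v\<bar>" using abs_triangle_ineq[of "a * u" "b * v"] by (simp add: abs_mult)
        also have "\<dots> \<le> G * \<bar>u\<bar> + G * \<bar>v\<bar>" using that by (intro add_mono mult_right_mono) auto
        also have "\<dots> = G * (\<bar>v1 k x\<bar> + \<bar>v2 k x\<bar>)" using that by (simp add: distrib_left)
        also have "\<dots> \<le> G * (V * norm (z k x))" using elim(2) x Gn by (intro mult_left_mono) auto
        finally show ?thesis .
      qed
      have w1: "\<bar>v1 (Suc k) x\<bar> \<le> G * (V * norm (z k x))"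
        unfolding v_rec(1)[OF elim(3)]
        using g1(1) g1(2)[OF elim(7) x] g2(1) g2(2)[OF elim(8) x] g3(1) g4(1) by (intro abs2) (auto simp: G_def)
      have w2: "\<bar>v2 (Suc k) x\<bar> \<le> G * (V * norm (z k x))"
        unfolding v_rec(2)[OF elim(3)]
        using g1(1) g2(1) g3(1) g3(2)[OF elim(9) x] g4(1) g4(2)[OF elim(10) x] by (intro abs2) (auto simp: G_def)
      have "1 - (t k x)\<^sup>2 \<ge> 0" using elim(1) x d(1) by (meson half_gt_zero less_imp_le order_trans)
      from eigen[OF elim(3) this]
      have eq: "z (Suc k) x - e (Suc k) x * z k x = of_real (\<beta> (Suc k) x - \<beta> k x) * of_real (v1 (Suc k) x)
          + (\<gamma> (Suc k) x - \<gamma> k x) * of_real (v2 (Suc k) x) + (e k x - e (Suc k) x) * z k x"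
        unfolding z_def[of "Suc k"] by (simp add: algebra_simps)
      have "norm (z (Suc k) x - e (Suc k) x * z k x) \<le> (C1 * \<delta> k) * (G * (V * norm (z k x))) + (C2 * \<delta> k) * (G * (V * norm (z k x))) + (C3 * \<delta> k) * norm (z k x)"
        unfolding eq
      proof (intro norm_triangle_mono)
        show "norm (complex_of_real (\<beta> (Suc k) x - \<beta> k x) * of_real (v1 (Suc k) x)) \<le> (C1 * \<delta> k) * (G * (V * norm (z k x)))"
          unfolding norm_mult norm_of_real using 1(2)[OF elim(4) x] w1 1(1) \<delta>_nonneg[of k] by (intro mult_mono) auto
        show "norm ((\<gamma> (Suc k) x - \<gamma> k x) * of_real (v2 (Suc k) x)) \<le> (C2 * \<delta> k) * (G * (V * norm (z k x)))"
          unfolding norm_mult norm_of_real using 2(2)[OF elim(5) x] w2 2(1) \<delta>_nonneg[of k] by (intro mult_mono) auto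
        show "norm ((e k x - e (Suc k) x) * z k x) \<le> (C3 * \<delta> k) * norm (z k x)"
          unfolding norm_mult norm_minus_commute[of "e k x"] using 3(2)[OF elim(6) x] by (intro mult_right_mono) auto
      qed
      also have "\<dots> = (C - 1) * \<delta> k * norm (z k x)" by (simp add: C_def algebra_simps)
      also have "\<dots> \<le> C * \<delta> k * norm (z k x)" using \<delta>_nonneg[of k] by (intro mult_right_mono) auto
      finally show "norm (z (Suc k) x - e (Suc k) x * z k x) \<le> C * \<delta> k * norm (z k x)" .
    qed
  qed
  moreover have "C > 0" unfolding C_def using 1(1) 2(1) 3(1) Gn V(1) by (intro add_nonneg_pos add_nonneg_nonneg mult_nonneg_nonneg) auto
  ultimately show thesis using that by blast
qed

definition \<theta> where "\<theta> k x = arccos (t k x)"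
definition phase where "phase M k x = (\<Sum>j=M+1..k. \<theta> j x)"

lemma e_eq_cis:
  assumes "1 - (t k x)\<^sup>2 \<ge> 0"
  shows "e k x = cis (\<theta> k x)" "\<bar>t k x\<bar> \<le> 1"
proof -
  show t1: "\<bar>t k x\<bar> \<le> 1" using assms by (simp add: abs_square_le_1)
  then have "cos (\<theta> k x) = t k x" "sin (\<theta> k x) = s k x"
    by (auto simp: \<theta>_def s_def abs_le_iff sin_arccos)
  then show "e k x = cis (\<theta> k x)" by (simp add: complex_eq_iff e_def)
qed

lemma prod_cis_sum: "finite A \<Longrightarrow> (\<Prod>j\<in>A. cis (f j)) = cis (\<Sum>j\<in>A. f j)"
  by (induction A rule: finite_induct) (auto simp: cis_mult)

text \<open>The imaginary part of \<open>z\<close> is \<open>s k x * v2 k x\<close>. Dividing by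
  \<open>s\<close> and exchanging \<open>\<alpha> k\<close> for \<open>\<alpha> (Suc k)\<close>
  multiplies by a factor that converges to \<open>1 / \<sigma> x\<close> at the rate of the tail,
  which gives the oscillation of \<open>q\<close>. The last two conclusions serve the measure: one
  passes to the limit eigenvector, which does not depend on \<open>k\<close>, and the other will
  bound the weights from above.\<close>

theorem asymptotics:
  obtains M \<zeta> C c where "M \<ge> 1" "continuous_on S \<zeta>" "\<And>x. x \<in> S \<Longrightarrow> \<zeta> x \<noteq> 0" "C \<ge> 0" "c > 0"
    "\<And>k x. k \<ge> M \<Longrightarrow> x \<in> S \<Longrightarrow> \<bar>t k x\<bar> \<le> 1"
    "\<And>k x. k \<ge> M \<Longrightarrow> x \<in> S \<Longrightarrow> \<bar>sqrt (\<alpha> (Suc k)) * q k x - Im (\<zeta> x * cis (phase M k x)) / \<sigma> x\<bar> \<le> C * tail k"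
    "\<And>x. x \<in> S \<Longrightarrow> (\<lambda>k. of_real (y21 x * v1 k x) + (\<epsilon> x - of_real (y11 x)) * of_real (v2 k x) - \<zeta> x * cis (phase M k x)) \<longlonglongrightarrow> 0"
    "\<And>k x. k \<ge> M \<Longrightarrow> x \<in> S \<Longrightarrow> (v1 k x)\<^sup>2 + (v2 k x)\<^sup>2 \<ge> c"
proof -
  obtain d where d: "d > 0" "\<forall>x\<in>S. 1 - (\<tau> x)\<^sup>2 \<ge> d" "\<forall>\<^sub>F k in sequentially. \<forall>x\<in>S. 1 - (t k x)\<^sup>2 \<ge> d / 2"
    by (rule \<tau>_uniform)
  obtain V where V: "V > 0" "\<forall>\<^sub>F k in sequentially. \<forall>x\<in>S. \<bar>v1 k x\<bar> + \<bar>v2 k x\<bar> \<le> V * norm (z k x)" by (rule v_le_z)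
  obtain C where C: "C > 0" "\<forall>\<^sub>F k in sequentially. \<forall>x\<in>S. norm (z (Suc k) x - e (Suc k) x * z k x) \<le> C * \<delta> k * norm (z k x)"
    by (rule z_step)
  define g where "g k x = isD k x * inverse (s k x)" for k x
  have s_ge: "\<forall>\<^sub>F k in sequentially. \<forall>x\<in>S. \<bar>s k x\<bar> \<ge> sqrt (d / 2)"
    using d(3) by eventually_elim (auto simp: s_def intro!: order_trans[OF _ abs_ge_self])
  have bvg: "bv g" unfolding g_def[abs_def]
    by (intro bv_mult bv_isD bv_inverse[OF bv_s _ s_ge]) (use d(1) in auto)
  have \<sigma>_pos: "\<sigma> x > 0" if "x \<in> S" for x using \<tau>_bound[OF that] by (simp add: \<sigma>_def)
  have glim: "(\<lambda>k. g k x) \<longlonglongrightarrow> 1 / \<sigma> x" if "x \<in> S" for x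
  proof -
    have "(\<lambda>k. g k x) \<longlonglongrightarrow> 1 * inverse (\<sigma> x)" unfolding g_def
      using \<sigma>_pos[OF that] by (intro tendsto_intros isD_lim s_lim that) auto
    then show ?thesis by (simp add: inverse_eq_divide)
  qed
  obtain N1 Cg where g: "Cg \<ge> 0" "\<And>k x. k \<ge> N1 \<Longrightarrow> x \<in> S \<Longrightarrow> norm (g k x - 1 / \<sigma> x) \<le> Cg * tail k"
    using bv_limit[OF bvg glim] by metis
  obtain N2 G1 where G1: "G1 \<ge> 0" "\<And>k x. k \<ge> N2 \<Longrightarrow> x \<in> S \<Longrightarrow> norm (\<beta> k x) \<le> G1" using bvE[OF bv_\<beta>] by metis
  obtain N3 G2 where G2: "G2 \<ge> 0" "\<And>k x. k \<ge> N3 \<Longrightarrow> x \<in> S \<Longrightarrow> norm (\<gamma> k x) \<le> G2" using bvE[OF bv_\<gamma>] by metis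
  define G where "G = G1 + G2 + 1"
  have G0: "G > 0" using G1 G2 by (simp add: G_def)
  have "\<forall>\<^sub>F k in sequentially. C * tail k < 1 / 4" by (rule eventually_tail_less) simp
  from eventually_conj[OF d(3) eventually_conj[OF V(2) eventually_conj[OF C(2) eventually_conj[OF this eventually_conj[OF s_ge eventually_ge_at_top[of "Suc (N1 + N2 + N3)"]]]]]]
  obtain M where M: "\<And>k. k \<ge> M \<Longrightarrow> (\<forall>x\<in>S. 1 - (t k x)\<^sup>2 \<ge> d / 2) \<and> (\<forall>x\<in>S. \<bar>v1 k x\<bar> + \<bar>v2 k x\<bar> \<le> V * norm (z k x))
     \<and> (\<forall>x\<in>S. norm (z (Suc k) x - e (Suc k) x * z k x) \<le> C * \<delta> k * norm (z k x)) \<and> C * tail k < 1 / 4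
     \<and> (\<forall>x\<in>S. \<bar>s k x\<bar> \<ge> sqrt (d / 2)) \<and> k \<ge> Suc (N1 + N2 + N3)"
    unfolding eventually_sequentially by blast
  have M1: "M \<ge> 1" using M[of M] by simp
  have t0: "1 - (t k x)\<^sup>2 \<ge> 0" if "k \<ge> M" "x \<in> S" for k x
    using M[OF that(1)] that(2) d(1) by (meson half_gt_zero less_imp_le order_trans)
  have Dp: "D k x > 0" if "k \<ge> M" for k x using D_pos[of k x] that M1 by simp
  have contD: "continuous_on S (D k)" if "k \<ge> M" for k
    unfolding D_def using that M1 by (intro continuous_intros contx) auto
  have contiD: "continuous_on S (isD k)" if "k \<ge> M" for k
    unfolding isD_def using Dp[OF that] by (intro continuous_intros contD that) (auto simp: less_imp_neq[THEN not_sym])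
  have contt: "continuous_on S (t k)" if "k \<ge> M" for k
    unfolding t_eq using that M1 by (intro continuous_intros contx contiD) auto
  have conte: "continuous_on S (e k)" if "k \<ge> M" for k
    unfolding e_def s_def using that by (intro continuous_intros contt) auto
  have contz: "continuous_on S (z k)" if "k \<ge> M" for k
    unfolding z_def \<beta>_def \<gamma>_def v1_def v2_def using that M1 by (intro continuous_intros contx contpq conte contiD) auto
  obtain B where B: "B > 0" "\<And>x. x \<in> S \<Longrightarrow> norm (z M x) \<le> B"
    using compact_continuous_norm_bound[OF compact_S contz[OF order_refl]] by metis
  have zM0: "norm (z M x) > 0" if "x \<in> S" for x
  proof -
    have "\<bar>v1 M x\<bar> + \<bar>v2 M x\<bar> > 0"
      using nz[of M x] M1 \<alpha>_pos[of M] by (auto simp: v1_def v2_def abs_mult intro: add_pos_nonneg add_nonneg_pos)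
    then have "V * norm (z M x) > 0" using M[OF order_refl] that by (meson less_le_trans)
    then show ?thesis using V(1) by (simp add: zero_less_mult_iff)
  qed
  obtain b where b: "b > 0" "\<And>x. x \<in> S \<Longrightarrow> norm (z M x) \<ge> b"
    using compact_continuous_pos_bound[OF compact_S continuous_on_norm[OF contz[OF order_refl]] zM0] by metis
  obtain \<zeta> where \<zeta>: "continuous_on S \<zeta>"
    "\<And>k x. k \<ge> M \<Longrightarrow> x \<in> S \<Longrightarrow> norm (z k x - \<zeta> x * (\<Prod>j=M+1..k. e j x)) \<le> 2 * C * norm (z M x) * tail k"
    "\<And>x. x \<in> S \<Longrightarrow> norm (\<zeta> x) \<ge> norm (z M x) / 2"
    "\<And>k x. k \<ge> M \<Longrightarrow> x \<in> S \<Longrightarrow> norm (z k x) \<ge> norm (z M x) / 2"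
    "\<And>k x. k \<ge> M \<Longrightarrow> x \<in> S \<Longrightarrow> norm (z k x) \<le> 2 * norm (z M x)"
  proof (rule perturbed_rotation[of M e z C B])
    show "norm (e k x) = 1" if "k \<ge> M" "x \<in> S" for k x using e_eq_cis(1)[OF t0[OF that]] by simp
    show "norm (z (Suc k) x - e (Suc k) x * z k x) \<le> C * \<delta> k * norm (z k x)" if "k \<ge> M" "x \<in> S" for k x
      using M that by blast
    show "C \<ge> 0" using C(1) by simp
    show "C * tail M \<le> 1 / 4" using M[OF order_refl] by simp
  qed (use contz conte B in auto)
  have prod: "(\<Prod>j=M+1..k. e j x) = cis (phase M k x)" if "x \<in> S" for k x
  proof -
    have "(\<Prod>j=M+1..k. e j x) = (\<Prod>j=M+1..k. cis (\<theta> j x))"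
      by (intro prod.cong refl e_eq_cis(1) t0 that) auto
    then show ?thesis by (simp add: prod_cis_sum phase_def)
  qed
  have rate: "norm (z k x - \<zeta> x * cis (phase M k x)) \<le> 2 * C * B * tail k" if "k \<ge> M" "x \<in> S" for k x
  proof -
    have "norm (z k x - \<zeta> x * cis (phase M k x)) \<le> 2 * C * norm (z M x) * tail k" using \<zeta>(2)[OF that] prod[OF that(2)] by simp
    also have "\<dots> \<le> 2 * C * B * tail k" using B(2)[OF that(2)] C(1) tail_nonneg by (intro mult_right_mono mult_left_mono) auto
    finally show ?thesis .
  qed
  define C' where "C' = Cg * (2 * B) + 1 / sqrt d * (2 * C * B)"
  show thesis
  proof (rule that[OF M1 \<zeta>(1)])
    show "\<zeta> x \<noteq> 0" if "x \<in> S" for x using \<zeta>(3)[OF that] zM0[OF that] by auto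
    show "C' \<ge> 0" unfolding C'_def using g(1) B(1) d(1) C(1) by simp
    \<comment> \<open>This constant comes from \<open>b / 2 \<le> norm (z k x)\<close>, the bound
      \<open>G\<close> on the eigenvectors, and
      \<open>(r + s)\<^sup>2 \<le> 2 * (r\<^sup>2 + s\<^sup>2)\<close>.\<close>
    show "(b / (2 * G))\<^sup>2 / 2 > 0" using b(1) G0 by simp
    show "\<bar>t k x\<bar> \<le> 1" if "k \<ge> M" "x \<in> S" for k x using e_eq_cis(2)[OF t0[OF that]] .
    show "\<bar>sqrt (\<alpha> (Suc k)) * q k x - Im (\<zeta> x * cis (phase M k x)) / \<sigma> x\<bar> \<le> C' * tail k" if k: "k \<ge> M" and x: "x \<in> S" for k x
    proof -
      have k1: "k \<ge> 1" using k M1 by simp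
      have sp: "s k x \<noteq> 0"
      proof -
        have "1 - (t k x)\<^sup>2 > 0" using M[OF k] x d(1) by (meson half_gt_zero less_le_trans)
        then show ?thesis by (simp add: s_def)
      qed
      have "sqrt (\<alpha> (Suc k)) = sqrt (\<alpha> k) * isD k x"
        using \<alpha>_pos[of k] \<alpha>_pos[of "Suc k"] by (simp add: isD_def D_eq[OF k1] real_sqrt_divide)
      moreover have "Im (z k x) = s k x * v2 k x" by (simp add: z_def \<gamma>_def e_def)
      ultimately have eq: "sqrt (\<alpha> (Suc k)) * q k x = g k x * Im (z k x)"
        using sp by (simp add: g_def v2_def)
      have split: "sqrt (\<alpha> (Suc k)) * q k x - Im (\<zeta> x * cis (phase M k x)) / \<sigma> x =
          (g k x - 1 / \<sigma> x) * Im (z k x) + 1 / \<sigma> x * Im (z k x - \<zeta> x * cis (phase M k x))"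
        unfolding eq by (simp add: algebra_simps add_divide_distrib)
      have "\<bar>sqrt (\<alpha> (Suc k)) * q k x - Im (\<zeta> x * cis (phase M k x)) / \<sigma> x\<bar> \<le> (Cg * tail k) * (2 * B) + 1 / sqrt d * (2 * C * B * tail k)"
        unfolding split real_norm_def[symmetric]
      proof (intro norm_triangle_mono)
        have "norm (Im (z k x)) \<le> 2 * B"
          using abs_Im_le_cmod[of "z k x"] \<zeta>(5)[OF k x] B(2)[OF x] by simp
        then show "norm ((g k x - 1 / \<sigma> x) * Im (z k x)) \<le> (Cg * tail k) * (2 * B)"
          unfolding norm_mult using g M[OF k] x tail_nonneg[of k] by (intro mult_mono) auto
        have "sqrt d \<le> \<sigma> x" unfolding \<sigma>_def using d(2) x by simp
        then have "norm (1 / \<sigma> x) \<le> 1 / sqrt d" using d(1) \<sigma>_pos[OF x] by (simp add: frac_le)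
        moreover have "norm (Im (z k x - \<zeta> x * cis (phase M k x))) \<le> 2 * C * B * tail k"
          using order_trans[OF abs_Im_le_cmod rate[OF k x]] by simp
        ultimately show "norm (1 / \<sigma> x * Im (z k x - \<zeta> x * cis (phase M k x))) \<le> 1 / sqrt d * (2 * C * B * tail k)"
          unfolding norm_mult using d(1) by (intro mult_mono) auto
      qed
      also have "\<dots> = C' * tail k" by (simp add: C'_def algebra_simps)
      finally show ?thesis .
    qed
    show "(\<lambda>k. of_real (y21 x * v1 k x) + (\<epsilon> x - of_real (y11 x)) * of_real (v2 k x) - \<zeta> x * cis (phase M k x)) \<longlonglongrightarrow> 0"
      if x: "x \<in> S" for x
    proof (rule Lim_null_comparison)
      let ?h = "\<lambda>k. \<bar>y21 x - \<beta> k x\<bar> * (V * (2 * B)) + norm (\<epsilon> x - of_real (y11 x) - \<gamma> k x) * (V * (2 * B)) + 2 * C * B * tail k"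
      have "?h \<longlonglongrightarrow> \<bar>y21 x - y21 x\<bar> * (V * (2 * B)) + norm (\<epsilon> x - of_real (y11 x) - (\<epsilon> x - of_real (y11 x))) * (V * (2 * B)) + 2 * C * B * 0"
        by (intro tendsto_intros \<beta>_lim \<gamma>_lim tail_tendsto_0 x)
      then show "?h \<longlonglongrightarrow> 0" by simp
      show "\<forall>\<^sub>F k in sequentially. norm (of_real (y21 x * v1 k x) + (\<epsilon> x - of_real (y11 x)) * of_real (v2 k x) - \<zeta> x * cis (phase M k x)) \<le> ?h k"
        using eventually_ge_at_top[of M]
      proof eventually_elim
        case (elim k)
        have zb: "norm (z k x) \<le> 2 * B" using \<zeta>(5)[OF elim x] B(2)[OF x] by simp
        have "\<bar>v1 k x\<bar> + \<bar>v2 k x\<bar> \<le> V * norm (z k x)" using M[OF elim] x by blast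
        also have "\<dots> \<le> V * (2 * B)" using zb V(1) by simp
        finally have v: "\<bar>v1 k x\<bar> \<le> V * (2 * B)" "\<bar>v2 k x\<bar> \<le> V * (2 * B)" by linarith+
        have eq: "of_real (y21 x * v1 k x) + (\<epsilon> x - of_real (y11 x)) * of_real (v2 k x) - \<zeta> x * cis (phase M k x) =
          of_real (y21 x - \<beta> k x) * of_real (v1 k x) + (\<epsilon> x - of_real (y11 x) - \<gamma> k x) * of_real (v2 k x) + (z k x - \<zeta> x * cis (phase M k x))"
          by (simp add: z_def algebra_simps)
        show ?case
          unfolding eq
        proof (intro norm_triangle_mono)
          show "norm (complex_of_real (y21 x - \<beta> k x) * of_real (v1 k x)) \<le> \<bar>y21 x - \<beta> k x\<bar> * (V * (2 * B))"
            unfolding norm_mult norm_of_real using v by (intro mult_left_mono) auto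
          show "norm ((\<epsilon> x - of_real (y11 x) - \<gamma> k x) * of_real (v2 k x)) \<le> norm (\<epsilon> x - of_real (y11 x) - \<gamma> k x) * (V * (2 * B))"
            unfolding norm_mult norm_of_real using v by (intro mult_left_mono) auto
          show "norm (z k x - \<zeta> x * cis (phase M k x)) \<le> 2 * C * B * tail k" by (rule rate[OF elim x])
        qed
      qed
    qed
    show "(v1 k x)\<^sup>2 + (v2 k x)\<^sup>2 \<ge> (b / (2 * G))\<^sup>2 / 2" if k: "k \<ge> M" and x: "x \<in> S" for k x
    proof -
      have kN: "k \<ge> N2" "k \<ge> N3" using M[OF k] by auto
      have "norm (z k x) \<le> G * \<bar>v1 k x\<bar> + G * \<bar>v2 k x\<bar>"
        unfolding z_def
      proof (rule norm_triangle_mono)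
        show "norm (complex_of_real (\<beta> k x * v1 k x)) \<le> G * \<bar>v1 k x\<bar>"
          unfolding norm_of_real abs_mult using G1(2)[OF kN(1) x] G2(1) by (intro mult_right_mono) (auto simp: G_def)
        show "norm (\<gamma> k x * complex_of_real (v2 k x)) \<le> G * \<bar>v2 k x\<bar>"
          unfolding norm_mult norm_of_real using G2(2)[OF kN(2) x] G1(1) by (intro mult_right_mono) (auto simp: G_def)
      qed
      moreover have "norm (z k x) \<ge> b / 2" using \<zeta>(4)[OF k x] b(2)[OF x] by simp
      ultimately have "b / (2 * G) \<le> \<bar>v1 k x\<bar> + \<bar>v2 k x\<bar>" using G0 by (simp add: field_simps)
      then have "(b / (2 * G))\<^sup>2 \<le> (\<bar>v1 k x\<bar> + \<bar>v2 k x\<bar>)\<^sup>2" using b(1) G0 by (intro power_mono) auto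
      also have "\<dots> \<le> 2 * ((v1 k x)\<^sup>2 + (v2 k x)\<^sup>2)"
        using zero_le_power2[of "\<bar>v1 k x\<bar> - \<bar>v2 k x\<bar>"] by (simp add: power2_eq_square algebra_simps)
      finally show ?thesis by simp
    qed
  qed
qed

end

section \<open>Transfer matrices\<close>

lemma vec2_mult_component:
  fixes A B :: "real^2^2"
  shows "(A ** B) $ i $ j = A $ i $ 1 * B $ 1 $ j + A $ i $ 2 * B $ 2 $ j"
  by (simp add: matrix_matrix_mult_def sum_2)

lemma trace_2: "trace (A :: real^2^2) = A $ 1 $ 1 + A $ 2 $ 2"
  by (simp add: trace_def sum_2)

lemma transfer_matrix_component:
  "transfer_matrix a b j x $ 1 $ 1 = 0" "transfer_matrix a b j x $ 1 $ 2 = 1"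
  "transfer_matrix a b j x $ 2 $ 1 = - (a (j - 1) / a j)" "transfer_matrix a b j x $ 2 $ 2 = (x - b j) / a j"
  by (simp_all add: transfer_matrix_def)

lemma step_matrix_Suc_component:
  "step_matrix a b (Suc N) n x $ 1 $ k = step_matrix a b N n x $ 2 $ k"
  "step_matrix a b (Suc N) n x $ 2 $ k =
     - (a (n + N - 1) / a (n + N)) * step_matrix a b N n x $ 1 $ k + (x - b (n + N)) / a (n + N) * step_matrix a b N n x $ 2 $ k"
  by (simp_all add: vec2_mult_component transfer_matrix_component)

lemma step_matrix_0_component:
  "step_matrix a b 0 n x $ 1 $ 1 = 1" "step_matrix a b 0 n x $ 1 $ 2 = 0"
  "step_matrix a b 0 n x $ 2 $ 1 = 0" "step_matrix a b 0 n x $ 2 $ 2 = 1"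
  by (simp_all add: mat_def)

text \<open>The degree bound does not depend on \<open>n\<close>. It is what lets convergence and
  bounds at finitely many points of \<open>K\<close> extend to a neighbourhood of
  \<open>K\<close>.\<close>

lemma step_matrix_poly:
  "\<exists>q :: real poly. degree q \<le> N \<and> (\<forall>x. step_matrix a b N n x $ i $ k = poly q x)"
proof (induction N arbitrary: i)
  case 0
  have "\<exists>c. \<forall>x. step_matrix a b 0 n x $ i $ k = c" by simp
  then obtain c where "\<forall>x. step_matrix a b 0 n x $ i $ k = c" by blast
  then show ?case by (intro exI[of _ "[:c:]"]) auto
next
  case (Suc N)
  obtain q1 where q1: "degree q1 \<le> N" "\<And>x. step_matrix a b N n x $ 1 $ k = poly q1 x" using Suc by metis
  obtain q2 where q2: "degree q2 \<le> N" "\<And>x. step_matrix a b N n x $ 2 $ k = poly q2 x" using Suc by metis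
  show ?case
  proof (cases "i = 1")
    case True
    then show ?thesis using q2 by (intro exI[of _ q2]) (auto simp: step_matrix_Suc_component simp del: step_matrix.simps)
  next
    case False
    then have i: "i = 2" using exhaust_2 by blast
    let ?q = "smult (- (a (n + N - 1) / a (n + N))) q1 + smult (1 / a (n + N)) ([:- b (n + N), 1:] * q2)"
    have "degree ?q \<le> Suc N"
    proof (rule degree_add_le)
      show "degree (smult (- (a (n + N - 1) / a (n + N))) q1) \<le> Suc N"
        using q1(1) by (intro order_trans[OF degree_smult_le]) auto
      show "degree (smult (1 / a (n + N)) ([:- b (n + N), 1:] * q2)) \<le> Suc N"
        using degree_mult_le[of "[:- b (n + N), 1:]" q2] q2(1) by (intro order_trans[OF degree_smult_le]) simp
    qed
    moreover have "step_matrix a b (Suc N) n x $ i $ k = poly ?q x" for x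
      unfolding i step_matrix_Suc_component q1(2) q2(2) by (simp add: diff_divide_distrib algebra_simps)
    ultimately show ?thesis by blast
  qed
qed

context jacobi
begin

lemma det_step_matrix:
  assumes "n \<ge> 1"
  shows "det (step_matrix a b N n x) = a (n - 1) / a (n + N - 1)"
proof (induction N)
  case 0
  then show ?case using a_nz[of "n - 1"] by simp
next
  case (Suc N)
  have "det (transfer_matrix a b (n + N) x) = a (n + N - 1) / a (n + N)"
    by (simp add: det_2 transfer_matrix_component)
  then show ?case using Suc a_nz[of "n + N - 1"] by (simp add: det_mul)
qed

lemma step_matrix_orth_poly:
  assumes "n \<ge> 1"
  shows "poly (P (n + N - 1)) x = step_matrix a b N n x $ 1 $ 1 * poly (P (n - 1)) x + step_matrix a b N n x $ 1 $ 2 * poly (P n) x"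
    and "poly (P (n + N)) x = step_matrix a b N n x $ 2 $ 1 * poly (P (n - 1)) x + step_matrix a b N n x $ 2 $ 2 * poly (P n) x"
proof (induction N)
  case 0
  case 1 show ?case by (simp add: step_matrix_0_component del: step_matrix.simps)
  case 2 show ?case by (simp add: step_matrix_0_component del: step_matrix.simps)
next
  case (Suc N)
  case 1 show ?case using Suc.IH(2) by (simp add: step_matrix_Suc_component del: step_matrix.simps)
  case 2
  have nN: "n + N \<ge> 1" using assms by simp
  have "poly (P (Suc (n + N))) x = - (a (n + N - 1) / a (n + N)) * poly (P (n + N - 1)) x + (x - b (n + N)) / a (n + N) * poly (P (n + N)) x"
    unfolding orth_poly_Suc[OF nN] using a_nz[of "n + N"] by (simp add: field_simps)
  also have "\<dots> = step_matrix a b (Suc N) n x $ 2 $ 1 * poly (P (n - 1)) x + step_matrix a b (Suc N) n x $ 2 $ 2 * poly (P n) x"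
    unfolding Suc.IH step_matrix_Suc_component by (simp add: algebra_simps)
  finally show ?case by simp
qed

text \<open>With \<open>J\<close> the standard symplectic matrix, the derivative of a transfer matrix \<open>X\<close> is
  \<open>X J\<^sup>-\<^sup>1 S\<close> for a positive semidefinite \<open>S\<close>; \<open>u, v, w\<close> are the entries of \<open>S\<close>.\<close>

lemma step_matrix_derivative:
  assumes n: "n \<ge> 1"
  shows "\<exists>u v w. u \<ge> 0 \<and> w \<ge> 0 \<and> v\<^sup>2 \<le> u * w \<and>
    ((\<lambda>x. step_matrix a b N n x $ 1 $ 1) has_real_derivative step_matrix a b N n x $ 1 $ 2 * u - step_matrix a b N n x $ 1 $ 1 * v) (at x) \<and>
    ((\<lambda>x. step_matrix a b N n x $ 1 $ 2) has_real_derivative step_matrix a b N n x $ 1 $ 2 * v - step_matrix a b N n x $ 1 $ 1 * w) (at x) \<and>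
    ((\<lambda>x. step_matrix a b N n x $ 2 $ 1) has_real_derivative step_matrix a b N n x $ 2 $ 2 * u - step_matrix a b N n x $ 2 $ 1 * v) (at x) \<and>
    ((\<lambda>x. step_matrix a b N n x $ 2 $ 2) has_real_derivative step_matrix a b N n x $ 2 $ 2 * v - step_matrix a b N n x $ 2 $ 1 * w) (at x)"
proof (induction N)
  case 0
  show ?case by (intro exI[of _ 0]) (simp add: step_matrix_0_component)
next
  case (Suc N)
  then obtain u v w where S: "u \<ge> 0" "w \<ge> 0" "v\<^sup>2 \<le> u * w"
    and d: "((\<lambda>x. step_matrix a b N n x $ 1 $ 1) has_real_derivative step_matrix a b N n x $ 1 $ 2 * u - step_matrix a b N n x $ 1 $ 1 * v) (at x)"
      "((\<lambda>x. step_matrix a b N n x $ 1 $ 2) has_real_derivative step_matrix a b N n x $ 1 $ 2 * v - step_matrix a b N n x $ 1 $ 1 * w) (at x)"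
      "((\<lambda>x. step_matrix a b N n x $ 2 $ 1) has_real_derivative step_matrix a b N n x $ 2 $ 2 * u - step_matrix a b N n x $ 2 $ 1 * v) (at x)"
      "((\<lambda>x. step_matrix a b N n x $ 2 $ 2) has_real_derivative step_matrix a b N n x $ 2 $ 2 * v - step_matrix a b N n x $ 2 $ 1 * w) (at x)"
    by blast
  define X where "X = step_matrix a b N n x"
  \<comment> \<open>The new leftmost factor adds to \<open>S\<close> the rank one matrix with
    entries \<open>c * r\<^sup>2\<close>, \<open>c * r * s\<close>, \<open>c * s\<^sup>2\<close>,
    where \<open>(r, s)\<close> is the second row of \<open>X\<close>. The constant is the
    derivative \<open>1 / a (n + N)\<close> of the new corner entry divided by the determinant of
    the new product.\<close>
  define c where "c = 1 / a (n - 1)"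
  have c: "c > 0" by (simp add: c_def)
  define r s where "r = X $ 2 $ 1" and "s = X $ 2 $ 2"
  define A where "A = a (n + N - 1) / a (n + N)"
  define Y where "Y = (x - b (n + N)) / a (n + N)"
  have dX: "X $ 1 $ 1 * s - X $ 1 $ 2 * r = a (n - 1) / a (n + N - 1)"
    using det_step_matrix[OF n, of N x] by (simp add: det_2 X_def r_def s_def)
  have cA: "c * (A * (X $ 1 $ 1 * s - X $ 1 $ 2 * r)) = 1 / a (n + N)"
    unfolding dX c_def A_def by simp
  have E: "step_matrix a b (Suc N) n x $ 1 $ k = X $ 2 $ k" "step_matrix a b (Suc N) n x $ 2 $ k = - A * X $ 1 $ k + Y * X $ 2 $ k" for k
    unfolding step_matrix_Suc_component X_def A_def Y_def by auto
  have dY: "((\<lambda>x. (x - b (n + N)) / a (n + N)) has_real_derivative 1 / a (n + N)) (at x)"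
    by (auto intro!: derivative_eq_intros)
  \<comment> \<open>A sum of positive semidefinite matrices has nonnegative determinant; the mixed
    term is handled by the inequality of arithmetic and geometric means.\<close>
  have cs: "(v + c * r * s)\<^sup>2 \<le> (u + c * r\<^sup>2) * (w + c * s\<^sup>2)"
  proof -
    have "2 * (r * s) * v \<le> u * s\<^sup>2 + r\<^sup>2 * w"
    proof -
      have "(2 * (r * s) * v)\<^sup>2 \<le> (u * s\<^sup>2 + r\<^sup>2 * w)\<^sup>2"
      proof -
        have "(2 * (r * s) * v)\<^sup>2 = 4 * r\<^sup>2 * s\<^sup>2 * v\<^sup>2" by (simp add: power_mult_distrib)
        also have "\<dots> \<le> 4 * r\<^sup>2 * s\<^sup>2 * (u * w)" using S(3) by (intro mult_left_mono) auto
        also have "\<dots> \<le> (u * s\<^sup>2 + r\<^sup>2 * w)\<^sup>2"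
          using zero_le_power2[of "u * s\<^sup>2 - r\<^sup>2 * w"] by (simp add: power2_eq_square algebra_simps)
        finally show ?thesis .
      qed
      then show ?thesis using S(1,2) by (intro power2_le_imp_le[of "2 * (r * s) * v"]) auto
    qed
    then have "c * (2 * (r * s) * v) \<le> c * (u * s\<^sup>2 + r\<^sup>2 * w)" using c by (intro mult_left_mono) auto
    with S(3) show ?thesis by (simp add: power2_eq_square algebra_simps)
  qed
  show ?case
  proof (intro exI conjI)
    show "u + c * r\<^sup>2 \<ge> 0" "w + c * s\<^sup>2 \<ge> 0" using S c by auto
    show "(v + c * r * s)\<^sup>2 \<le> (u + c * r\<^sup>2) * (w + c * s\<^sup>2)" by (rule cs)
    have k1: "step_matrix a b (Suc N) n x $ 2 $ 2 * r - step_matrix a b (Suc N) n x $ 2 $ 1 * s = - (A * (X $ 1 $ 2 * r - X $ 1 $ 1 * s))"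
      unfolding E by (simp add: r_def s_def algebra_simps)
    show "((\<lambda>x. step_matrix a b (Suc N) n x $ 1 $ 1) has_real_derivative step_matrix a b (Suc N) n x $ 1 $ 2 * (u + c * r\<^sup>2) - step_matrix a b (Suc N) n x $ 1 $ 1 * (v + c * r * s)) (at x)"
      unfolding E(1) unfolding step_matrix_Suc_component
      by (rule DERIV_cong[OF d(3)]) (simp add: X_def[symmetric] r_def s_def power2_eq_square algebra_simps)
    show "((\<lambda>x. step_matrix a b (Suc N) n x $ 1 $ 2) has_real_derivative step_matrix a b (Suc N) n x $ 1 $ 2 * (v + c * r * s) - step_matrix a b (Suc N) n x $ 1 $ 1 * (w + c * s\<^sup>2)) (at x)"
      unfolding E(1) unfolding step_matrix_Suc_component
      by (rule DERIV_cong[OF d(4)]) (simp add: X_def[symmetric] r_def s_def power2_eq_square algebra_simps)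
    have e1: "1 / a (n + N) * r = c * r * (A * (X $ 1 $ 1 * s - X $ 1 $ 2 * r))"
      unfolding cA[symmetric] by simp
    have e2: "1 / a (n + N) * s = c * s * (A * (X $ 1 $ 1 * s - X $ 1 $ 2 * r))"
      unfolding cA[symmetric] by simp
    show "((\<lambda>x. step_matrix a b (Suc N) n x $ 2 $ 1) has_real_derivative step_matrix a b (Suc N) n x $ 2 $ 2 * (u + c * r\<^sup>2) - step_matrix a b (Suc N) n x $ 2 $ 1 * (v + c * r * s)) (at x)"
      unfolding E(2) unfolding step_matrix_Suc_component
    proof (rule DERIV_cong[OF DERIV_add[OF DERIV_cmult[OF d(1)] DERIV_mult[OF dY d(3)]]], fold X_def Y_def A_def r_def s_def)
      show "- A * (X $ 1 $ 2 * u - X $ 1 $ 1 * v) + (1 / a (n + N) * r + (s * u - r * v) * Y) =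
        (- A * X $ 1 $ 2 + Y * s) * (u + c * r\<^sup>2) - (- A * X $ 1 $ 1 + Y * r) * (v + c * r * s)"
        unfolding e1 by (simp add: power2_eq_square algebra_simps)
    qed
    show "((\<lambda>x. step_matrix a b (Suc N) n x $ 2 $ 2) has_real_derivative step_matrix a b (Suc N) n x $ 2 $ 2 * (v + c * r * s) - step_matrix a b (Suc N) n x $ 2 $ 1 * (w + c * s\<^sup>2)) (at x)"
      unfolding E(2) unfolding step_matrix_Suc_component
    proof (rule DERIV_cong[OF DERIV_add[OF DERIV_cmult[OF d(2)] DERIV_mult[OF dY d(4)]]], fold X_def Y_def A_def r_def s_def)
      show "- A * (X $ 1 $ 2 * v - X $ 1 $ 1 * w) + (1 / a (n + N) * s + (s * v - r * w) * Y) =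
        (- A * X $ 1 $ 2 + Y * s) * (v + c * r * s) - (- A * X $ 1 $ 1 + Y * r) * (w + c * s\<^sup>2)"
        unfolding e2 by (simp add: power2_eq_square algebra_simps)
    qed
  qed
qed

end

section \<open>Derivatives controlled by the derivative of the trace\<close>

lemma psd_quadratic_nonneg:
  fixes u v w :: real
  assumes "u \<ge> 0" "w \<ge> 0" "v\<^sup>2 \<le> u * w"
  shows "\<alpha>\<^sup>2 * u + 2 * \<alpha> * \<beta> * v + \<beta>\<^sup>2 * w \<ge> 0"
proof (cases "u = 0")
  case True
  then show ?thesis using assms by simp
next
  case False
  then have u: "u > 0" using assms by simp
  have "u * (\<alpha>\<^sup>2 * u + 2 * \<alpha> * \<beta> * v + \<beta>\<^sup>2 * w) = (\<alpha> * u + \<beta> * v)\<^sup>2 + \<beta>\<^sup>2 * (u * w - v\<^sup>2)"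
    by (simp add: power2_eq_square algebra_simps)
  also have "\<dots> \<ge> 0" using assms by simp
  finally show ?thesis using u by (simp add: zero_le_mult_iff)
qed

text \<open>The trace \<open>F\<close> of \<open>X J\<^sup>-\<^sup>1 S\<close> pairs \<open>S\<close> with a quadratic form of
  determinant \<open>- discr X / 4\<close>; when this form is definite, \<open>F\<close> controls all of \<open>S\<close>.\<close>

lemma elliptic_trace_bound:
  fixes p q r s u v w m :: real
  assumes uvw: "u \<ge> 0" "w \<ge> 0" "v\<^sup>2 \<le> u * w"
    and m: "\<bar>p\<bar> \<le> m" "\<bar>q\<bar> \<le> m" "\<bar>r\<bar> \<le> m" "\<bar>s\<bar> \<le> m"
    and xy: "\<bar>x\<bar> \<le> m" "\<bar>y\<bar> \<le> m"
  shows "(4 * (p * s - q * r) - (p + s)\<^sup>2) * \<bar>y * u - x * v\<bar> \<le> 16 * m\<^sup>2 * \<bar>(q * u - p * v) + (s * v - r * w)\<bar>"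
    and "(4 * (p * s - q * r) - (p + s)\<^sup>2) * \<bar>y * v - x * w\<bar> \<le> 16 * m\<^sup>2 * \<bar>(q * u - p * v) + (s * v - r * w)\<bar>"
proof -
  define D where "D = 4 * (p * s - q * r) - (p + s)\<^sup>2"
  define F where "F = (q * u - p * v) + (s * v - r * w)"
  have m0: "m \<ge> 0" using m(1) by linarith
  \<comment> \<open>The quadratic form of \<open>S\<close> at \<open>(2 * q, s - p)\<close> equals
    \<open>4 * q * F - D * w\<close>, and at \<open>(s - p, - 2 * r)\<close> it equals
    \<open>- 4 * r * F - D * u\<close>.\<close>
  have "D * w \<le> 4 * q * F"
    using psd_quadratic_nonneg[OF uvw, of "2 * q" "s - p"] by (simp add: D_def F_def power2_eq_square algebra_simps)
  also have "\<dots> \<le> 4 * (\<bar>q\<bar> * \<bar>F\<bar>)" by (simp add: abs_mult[symmetric])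
  also have "\<dots> \<le> 4 * (m * \<bar>F\<bar>)" using m by (intro mult_left_mono mult_right_mono) auto
  finally have 1: "D * w \<le> 4 * m * \<bar>F\<bar>" by simp
  have "D * u \<le> 4 * (- r) * F"
    using psd_quadratic_nonneg[OF uvw, of "s - p" "- 2 * r"] by (simp add: D_def F_def power2_eq_square algebra_simps)
  also have "\<dots> \<le> 4 * (\<bar>r\<bar> * \<bar>F\<bar>)" using abs_ge_minus_self[of "r * F"] unfolding abs_mult by linarith
  also have "\<dots> \<le> 4 * (m * \<bar>F\<bar>)" using m by (intro mult_left_mono mult_right_mono) auto
  finally have 2: "D * u \<le> 4 * m * \<bar>F\<bar>" by simp
  have "v\<^sup>2 \<le> (u + w)\<^sup>2"
  proof -
    have "(u + w)\<^sup>2 = u * w + (u\<^sup>2 + w\<^sup>2 + u * w)" by (simp add: power2_eq_square algebra_simps)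
    moreover have "u\<^sup>2 + w\<^sup>2 + u * w \<ge> 0" using uvw by simp
    ultimately show ?thesis using uvw(3) by linarith
  qed
  then have v: "\<bar>v\<bar> \<le> u + w" using uvw abs_le_square_iff[of v "u + w"] by simp
  have key: "D * g \<le> 16 * m\<^sup>2 * \<bar>F\<bar>" if g: "g \<le> 2 * m * (u + w)" "g \<ge> 0" for g
  proof (cases "D \<ge> 0")
    case True
    then have "D * g \<le> D * (2 * m * (u + w))" using g by (intro mult_left_mono) auto
    also have "\<dots> = 2 * m * (D * u + D * w)" by (simp add: algebra_simps)
    also have "\<dots> \<le> 2 * m * (4 * m * \<bar>F\<bar> + 4 * m * \<bar>F\<bar>)" using 1 2 m0 by (intro mult_left_mono add_mono) auto
    finally show ?thesis by (simp add: power2_eq_square)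
  next
    case False
    then have "D * g \<le> 0" using g by (simp add: mult_nonpos_nonneg)
    then show ?thesis by (rule order_trans) simp
  qed
  have b: "\<bar>y * c - x * d\<bar> \<le> 2 * m * (u + w)" if "\<bar>c\<bar> \<le> u + w" "\<bar>d\<bar> \<le> u + w" for c d
  proof -
    have "\<bar>y * c - x * d\<bar> \<le> \<bar>y\<bar> * \<bar>c\<bar> + \<bar>x\<bar> * \<bar>d\<bar>" using abs_triangle_ineq4[of "y * c" "x * d"] by (simp add: abs_mult)
    also have "\<dots> \<le> m * (u + w) + m * (u + w)" using that xy m0 by (intro add_mono mult_mono) auto
    finally show ?thesis by simp
  qed
  show "(4 * (p * s - q * r) - (p + s)\<^sup>2) * \<bar>y * u - x * v\<bar> \<le> 16 * m\<^sup>2 * \<bar>(q * u - p * v) + (s * v - r * w)\<bar>"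
    using key[OF b[of u v]] uvw v unfolding D_def F_def by simp
  show "(4 * (p * s - q * r) - (p + s)\<^sup>2) * \<bar>y * v - x * w\<bar> \<le> 16 * m\<^sup>2 * \<bar>(q * u - p * v) + (s * v - r * w)\<bar>"
    using key[OF b[of v w]] uvw v unfolding D_def F_def by simp
qed

text \<open>Each row of the matrix plays the part of \<open>(x, y)\<close> in
  \<open>elliptic_trace_bound\<close> for the same row of the derivative. One \<open>m\<close> can
  serve all large indices when the entries converge, so the inequality passes to the limit
  matrix.\<close>

lemma (in jacobi) step_matrix_pderiv_bound:
  assumes n: "n \<ge> 1" and q: "\<And>i k x. step_matrix a b N n x $ i $ k = poly (q i k) x"
    and m: "\<And>i k. \<bar>poly (q i k) x\<bar> \<le> m"
  shows "- discr (step_matrix a b N n x) * \<bar>poly (pderiv (q i k)) x\<bar> \<le> 16 * m\<^sup>2 * \<bar>poly (pderiv (q 1 1 + q 2 2)) x\<bar>"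
proof -
  obtain u v w where S: "u \<ge> 0" "w \<ge> 0" "v\<^sup>2 \<le> u * w"
    and d: "(poly (q 1 1) has_real_derivative poly (q 1 2) x * u - poly (q 1 1) x * v) (at x)"
      "(poly (q 1 2) has_real_derivative poly (q 1 2) x * v - poly (q 1 1) x * w) (at x)"
      "(poly (q 2 1) has_real_derivative poly (q 2 2) x * u - poly (q 2 1) x * v) (at x)"
      "(poly (q 2 2) has_real_derivative poly (q 2 2) x * v - poly (q 2 1) x * w) (at x)"
    using step_matrix_derivative[OF n, of N x] unfolding q by blast
  have e: "poly (pderiv (q 1 1)) x = poly (q 1 2) x * u - poly (q 1 1) x * v"
    "poly (pderiv (q 1 2)) x = poly (q 1 2) x * v - poly (q 1 1) x * w"
    "poly (pderiv (q 2 1)) x = poly (q 2 2) x * u - poly (q 2 1) x * v"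
    "poly (pderiv (q 2 2)) x = poly (q 2 2) x * v - poly (q 2 1) x * w"
    using d poly_DERIV DERIV_unique by blast+
  have D: "- discr (step_matrix a b N n x) = 4 * (poly (q 1 1) x * poly (q 2 2) x - poly (q 1 2) x * poly (q 2 1) x) - (poly (q 1 1) x + poly (q 2 2) x)\<^sup>2"
    by (simp add: discr_def trace_2 det_2 q)
  have "(i = 1 \<or> i = 2) \<and> (k = 1 \<or> k = 2)" using exhaust_2 by blast
  then show ?thesis
    unfolding D pderiv_add poly_add
    using elliptic_trace_bound[OF S m[of 1 1] m[of 1 2] m[of 2 1] m[of 2 2] m[of 1 1] m[of 1 2]]
      elliptic_trace_bound[OF S m[of 1 1] m[of 1 2] m[of 2 1] m[of 2 2] m[of 2 1] m[of 2 2]]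
    unfolding e[symmetric] by (elim conjE disjE) (simp_all only: e[symmetric])
qed

section \<open>Polynomials of bounded degree\<close>

lemma lagrange_basis:
  fixes A :: "real set"
  assumes A: "finite A" "card A = Suc N"
  shows "\<exists>l. \<forall>q. degree q \<le> N \<longrightarrow> q = (\<Sum>c\<in>A. smult (poly q c) (l c))"
proof -
  define l where "l c = smult (1 / (\<Prod>d\<in>A-{c}. c - d)) (\<Prod>d\<in>A-{c}. [:-d, 1:])" for c
  have dl: "degree (l c) \<le> N" if "c \<in> A" for c
  proof -
    have "degree (\<Prod>d\<in>A-{c}. [:-d, 1:]) \<le> (\<Sum>d\<in>A-{c}. degree [:-d, 1:])"
      using degree_prod_sum_le[of "A - {c}" "\<lambda>d. [:-d, 1:]"] A by (simp add: comp_def)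
    also have "\<dots> = N" using A that by simp
    finally show ?thesis unfolding l_def by (rule order_trans[OF degree_smult_le])
  qed
  have ev: "poly (l c) y = (if y = c then 1 else 0)" if "c \<in> A" "y \<in> A" for c y
    using that A by (auto simp: l_def poly_prod)
  have "q = (\<Sum>c\<in>A. smult (poly q c) (l c))" if q: "degree q \<le> N" for q
  proof (rule ccontr)
    define r where "r = q - (\<Sum>c\<in>A. smult (poly q c) (l c))"
    assume "q \<noteq> (\<Sum>c\<in>A. smult (poly q c) (l c))"
    then have r0: "r \<noteq> 0" by (simp add: r_def)
    have "degree r \<le> N" unfolding r_def
      by (intro degree_diff_le q degree_sum_le order_trans[OF degree_smult_le dl] A)
    moreover have "A \<subseteq> {x. poly r x = 0}"
    proof
      fix y assume y: "y \<in> A"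
      have "(\<Sum>c\<in>A. poly q c * poly (l c) y) = (\<Sum>c\<in>A. if c = y then poly q c else 0)"
        by (intro sum.cong refl) (use ev y in auto)
      also have "\<dots> = poly q y" using A y by simp
      finally show "y \<in> {x. poly r x = 0}" by (simp add: r_def poly_sum)
    qed
    then have "card A \<le> card {x. poly r x = 0}" by (intro card_mono poly_roots_finite r0)
    moreover have "card {x. poly r x = 0} \<le> degree r" using card_poly_roots_bound[OF r0] .
    ultimately show False using A by simp
  qed
  then show ?thesis by blast
qed

lemma pderiv_sum: "pderiv (\<Sum>c\<in>A. f c) = (\<Sum>c\<in>A. pderiv (f c))"
  by (induction A rule: infinite_finite_induct) (auto simp: pderiv_add)

text \<open>Lagrange interpolation at fixed nodes is a finite linear formula, so convergence at the
  nodes passes to values and derivatives at every point.\<close>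

lemma poly_limit:
  fixes q :: "nat \<Rightarrow> real poly"
  assumes A: "finite A" "card A = Suc N" and q: "\<And>k. degree (q k) \<le> N"
    and lim: "\<And>c. c \<in> A \<Longrightarrow> (\<lambda>k. poly (q k) c) \<longlonglongrightarrow> f c"
  shows "\<exists>Q. \<forall>x. (\<lambda>k. poly (q k) x) \<longlonglongrightarrow> poly Q x \<and> (\<lambda>k. poly (pderiv (q k)) x) \<longlonglongrightarrow> poly (pderiv Q) x"
proof -
  obtain l where l: "\<And>q. degree q \<le> N \<Longrightarrow> q = (\<Sum>c\<in>A. smult (poly q c) (l c))"
    using lagrange_basis[OF A] by blast
  define Q where "Q = (\<Sum>c\<in>A. smult (f c) (l c))"
  have 1: "poly (q k) x = (\<Sum>c\<in>A. poly (q k) c * poly (l c) x)" for k x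
    by (subst l[OF q]) (simp add: poly_sum)
  have 2: "poly (pderiv (q k)) x = (\<Sum>c\<in>A. poly (q k) c * poly (pderiv (l c)) x)" for k x
    by (subst l[OF q]) (simp add: poly_sum pderiv_sum pderiv_smult)
  have 3: "poly Q x = (\<Sum>c\<in>A. f c * poly (l c) x)" "poly (pderiv Q) x = (\<Sum>c\<in>A. f c * poly (pderiv (l c)) x)" for x
    by (simp_all add: Q_def poly_sum pderiv_sum pderiv_smult)
  show ?thesis
  proof (intro exI[of _ Q] allI conjI)
    fix x
    have "(\<lambda>k. \<Sum>c\<in>A. poly (q k) c * poly (l c) x) \<longlonglongrightarrow> (\<Sum>c\<in>A. f c * poly (l c) x)"
      by (intro tendsto_sum tendsto_mult tendsto_const lim)
    then show "(\<lambda>k. poly (q k) x) \<longlonglongrightarrow> poly Q x" using 1[of _ x] 3(1)[of x] by presburger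
    have "(\<lambda>k. \<Sum>c\<in>A. poly (q k) c * poly (pderiv (l c)) x) \<longlonglongrightarrow> (\<Sum>c\<in>A. f c * poly (pderiv (l c)) x)"
      by (intro tendsto_sum tendsto_mult tendsto_const lim)
    then show "(\<lambda>k. poly (pderiv (q k)) x) \<longlonglongrightarrow> poly (pderiv Q) x" using 2[of _ x] 3(2)[of x] by presburger
  qed
qed

text \<open>The constant depends on the nodes and on \<open>S\<close> but not on the polynomial; it
  is the price of carrying variation bounds from \<open>K\<close> to a larger interval.\<close>

lemma poly_compact_bound:
  fixes A S :: "real set"
  assumes A: "finite A" "card A = Suc N" and S: "compact S"
  shows "\<exists>C>0. \<forall>q B. degree q \<le> N \<longrightarrow> (\<forall>c\<in>A. \<bar>poly q c\<bar> \<le> B) \<longrightarrow> (\<forall>x\<in>S. \<bar>poly q x\<bar> \<le> C * B)"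
proof -
  obtain l where l: "\<And>q. degree q \<le> N \<Longrightarrow> q = (\<Sum>c\<in>A. smult (poly q c) (l c))"
    using lagrange_basis[OF A] by blast
  have "\<exists>b. \<forall>x\<in>S. \<bar>poly (l c) x\<bar> \<le> b" for c
  proof -
    have "compact (poly (l c) ` S)" by (intro compact_continuous_image S continuous_on_poly continuous_on_id)
    then have "bounded (poly (l c) ` S)" by (rule compact_imp_bounded)
    then show ?thesis unfolding bounded_iff by auto
  qed
  then obtain b where b: "\<And>c x. x \<in> S \<Longrightarrow> \<bar>poly (l c) x\<bar> \<le> b c" by metis
  show ?thesis
  proof (intro exI[of _ "(\<Sum>c\<in>A. \<bar>b c\<bar>) + 1"] conjI allI impI ballI)
    show "(\<Sum>c\<in>A. \<bar>b c\<bar>) + 1 > 0" by (simp add: add_nonneg_pos sum_nonneg)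
    fix q B x assume q: "degree q \<le> N" "\<forall>c\<in>A. \<bar>poly q c\<bar> \<le> B" and x: "x \<in> S"
    have "A \<noteq> {}" using A by auto
    then have B: "B \<ge> 0" using q(2) by fastforce
    have "\<bar>poly q x\<bar> = \<bar>\<Sum>c\<in>A. poly q c * poly (l c) x\<bar>"
      by (subst l[OF q(1)]) (simp add: poly_sum)
    also have "\<dots> \<le> (\<Sum>c\<in>A. B * \<bar>b c\<bar>)"
      by (rule order_trans[OF sum_abs], rule sum_mono, unfold abs_mult, rule mult_mono)
        (use q(2) b[OF x] B in \<open>auto intro: order_trans[OF _ abs_ge_self]\<close>)
    also have "\<dots> \<le> ((\<Sum>c\<in>A. \<bar>b c\<bar>) + 1) * B" using B by (simp add: sum_distrib_left[symmetric] algebra_simps)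
    finally show "\<bar>poly q x\<bar> \<le> ((\<Sum>c\<in>A. \<bar>b c\<bar>) + 1) * B" .
  qed
qed

section \<open>The orthogonality measure\<close>

context jacobi
begin

lemma bs_weight_wlog:
  assumes "Im \<rho> \<noteq> 0"
  obtains \<rho>' where "Im \<rho>' > 0" "bs_weight \<rho> = bs_weight \<rho>'"
proof (cases "Im \<rho> > 0")
  case True
  with that show thesis by blast
next
  case False
  then have "Im (cnj \<rho>) > 0" using assms by simp
  moreover have "bs_weight \<rho> = bs_weight (cnj \<rho>)" by (intro ext) (simp add: bs_weight_cnj)
  ultimately show thesis by (rule that)
qed

text \<open>Subtracting a multiple of \<open>P d\<close>, whose integral is known from pairing it
  with \<open>P 0 = 1\<close>, lowers the degree. By induction every moment is independent of
  \<open>n\<close> once \<open>n\<close> is large compared with the degree.\<close>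

lemma bs_weight_moments:
  assumes \<rho>: "Im \<rho> \<noteq> 0"
  shows "\<exists>C. \<forall>n\<ge>degree f + 2. integrable lborel (\<lambda>x. poly f x * bs_weight \<rho> n x) \<and>
      (\<integral>x. poly f x * bs_weight \<rho> n x \<partial>lborel) = C"
proof -
  obtain \<rho>' where \<rho>': "Im \<rho>' > 0" "bs_weight \<rho> = bs_weight \<rho>'" using bs_weight_wlog[OF \<rho>] by metis
  have int: "integrable lborel (\<lambda>x. poly f x * bs_weight \<rho>' n x)" if "n \<ge> degree f + 2" for f n
    by (rule bs_weight_integrable[OF \<rho>'(1)]) (use that in auto)
  have "\<exists>C. \<forall>n\<ge>degree f + 2. (\<integral>x. poly f x * bs_weight \<rho>' n x \<partial>lborel) = C"
  proof (induction "degree f" arbitrary: f rule: less_induct)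
    case less
    define d where "d = degree f"
    define c where "c = coeff f d / coeff (P d) d"
    define g where "g = f - smult c (P d)"
    have Pd0: "coeff (P d) d \<noteq> 0" using lead_coeff_P_pos[of d] by simp
    have f: "poly f x = poly g x + c * poly (P d) x" for x by (simp add: g_def)
    have dg: "degree g \<le> d" unfolding g_def d_def
      by (intro degree_diff_le order_trans[OF degree_smult_le]) auto
    have cg: "coeff g d = 0" using Pd0 by (simp add: g_def c_def)
    have intP: "integrable lborel (\<lambda>x. poly (P d) x * bs_weight \<rho>' n x)" if "n \<ge> d + 2" for n
      using int[of "P d" n] that by simp
    have oP: "(\<integral>x. poly (P d) x * bs_weight \<rho>' n x \<partial>lborel) = (if d = 0 then 1 else 0)" if "n \<ge> d + 2" for n
      using bs_orthonormal[OF \<rho>'(1), of d n 0] that by simp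
    have "\<exists>C. \<forall>n\<ge>d + 2. (\<integral>x. poly g x * bs_weight \<rho>' n x \<partial>lborel) = C"
    proof (cases "d = 0")
      case True
      then have "g = 0" using dg cg by (metis degree_0 le_zero_eq leading_coeff_0_iff)
      then show ?thesis by simp
    next
      case False
      have "degree g < d" using dg cg False
        by (metis le_neq_implies_less leading_coeff_0_iff degree_0 neq0_conv)
      then obtain C where C: "\<forall>n\<ge>degree g + 2. (\<integral>x. poly g x * bs_weight \<rho>' n x \<partial>lborel) = C"
        using less d_def by blast
      with \<open>degree g < d\<close> show ?thesis by (intro exI[of _ C]) auto
    qed
    then obtain C where C: "\<And>n. n \<ge> d + 2 \<Longrightarrow> (\<integral>x. poly g x * bs_weight \<rho>' n x \<partial>lborel) = C" by blast
    show ?case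
    proof (intro exI[of _ "C + c * (if d = 0 then 1 else 0)"] allI impI)
      fix n assume "n \<ge> degree f + 2"
      then have n: "n \<ge> d + 2" by (simp add: d_def)
      have "(\<integral>x. poly f x * bs_weight \<rho>' n x \<partial>lborel) =
        (\<integral>x. poly g x * bs_weight \<rho>' n x + c * (poly (P d) x * bs_weight \<rho>' n x) \<partial>lborel)"
        by (intro Bochner_Integration.integral_cong refl) (simp add: f algebra_simps)
      also have "\<dots> = (\<integral>x. poly g x * bs_weight \<rho>' n x \<partial>lborel) + c * (\<integral>x. poly (P d) x * bs_weight \<rho>' n x \<partial>lborel)"
        using int[of g n] intP[OF n] n dg by simp
      finally show "(\<integral>x. poly f x * bs_weight \<rho>' n x \<partial>lborel) = C + c * (if d = 0 then 1 else 0)"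
        unfolding C[OF n] oP[OF n] .
    qed
  qed
  then show ?thesis unfolding \<rho>'(2) using int by blast
qed

text \<open>The window starts at \<open>Suc n\<close>, which avoids division by zero. When
  \<open>k \<le> m k\<close>, every averaged weight makes \<open>P 0\<close>, ...,
  \<open>P n\<close> orthonormal, and so does the average.\<close>

definition bs_average :: "complex \<Rightarrow> (nat \<Rightarrow> nat) \<Rightarrow> nat \<Rightarrow> real \<Rightarrow> real" where
  "bs_average \<rho> m n x = block_average (\<lambda>k. bs_weight \<rho> (m k) x) (Suc n)"

definition bs_average_measure :: "complex \<Rightarrow> (nat \<Rightarrow> nat) \<Rightarrow> nat \<Rightarrow> real measure" where
  "bs_average_measure \<rho> m n = density lborel (\<lambda>x. ennreal (bs_average \<rho> m n x))"

context
  fixes \<rho> :: complex and m :: "nat \<Rightarrow> nat"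
  assumes \<rho>: "Im \<rho> \<noteq> 0" and m: "\<And>k. k \<le> m k"
begin

lemma bs_average_nonneg: "bs_average \<rho> m n x \<ge> 0"
proof -
  have "bs_weight \<rho> (m k) x \<ge> 0" if "k \<in> {Suc n..<2 * Suc n}" for k
    using bs_weight_pos[OF \<rho>, of "m k" x] m[of k] that by simp
  then have "(\<Sum>k=Suc n..<2 * Suc n. bs_weight \<rho> (m k) x) \<ge> 0" by (rule sum_nonneg)
  then show ?thesis unfolding bs_average_def block_average_def by simp
qed

lemma borel_measurable_bs_average [measurable]: "bs_average \<rho> m n \<in> borel_measurable borel"
proof (rule borel_measurable_continuous_onI)
  have "continuous_on UNIV (\<lambda>x. (\<Sum>k=Suc n..<2 * Suc n. bs_weight \<rho> (m k) x) /\<^sub>R real (Suc n))"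
  proof (intro continuous_intros continuous_bs_weight \<rho>)
    show "m k \<ge> 1" if "k \<in> {Suc n..<2 * Suc n}" for k using m[of k] that by simp
  qed
  then show "continuous_on UNIV (bs_average \<rho> m n)" by (simp add: bs_average_def[abs_def] block_average_def)
qed

lemma bs_average_moments:
  shows "\<exists>C. \<forall>n\<ge>degree f + 2. integrable lborel (\<lambda>x. poly f x * bs_average \<rho> m n x) \<and>
      (\<integral>x. poly f x * bs_average \<rho> m n x \<partial>lborel) = C"
proof -
  obtain C where C: "\<And>n. n \<ge> degree f + 2 \<Longrightarrow> integrable lborel (\<lambda>x. poly f x * bs_weight \<rho> n x)"
      "\<And>n. n \<ge> degree f + 2 \<Longrightarrow> (\<integral>x. poly f x * bs_weight \<rho> n x \<partial>lborel) = C"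
    using bs_weight_moments[OF \<rho>, of f] by blast
  have eq: "poly f x * bs_average \<rho> m n x = (\<Sum>k=Suc n..<2 * Suc n. poly f x * bs_weight \<rho> (m k) x) /\<^sub>R real (Suc n)" for x n
    by (simp add: bs_average_def block_average_def sum_distrib_left mult_ac del: sum.op_ivl_Suc)
  have "integrable lborel (\<lambda>x. poly f x * bs_average \<rho> m n x) \<and> (\<integral>x. poly f x * bs_average \<rho> m n x \<partial>lborel) = C"
    if n: "n \<ge> degree f + 2" for n
  proof -
    have k: "m k \<ge> degree f + 2" if "k \<in> {Suc n..<2 * Suc n}" for k
      using m[of k] that n by auto
    have "integrable lborel (\<lambda>x. \<Sum>k=Suc n..<2 * Suc n. poly f x * bs_weight \<rho> (m k) x)"
      by (intro Bochner_Integration.integrable_sum C k)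
    moreover have "(\<integral>x. (\<Sum>k=Suc n..<2 * Suc n. poly f x * bs_weight \<rho> (m k) x) \<partial>lborel) = (\<Sum>k=Suc n..<2 * Suc n. C)"
      by (subst Bochner_Integration.integral_sum, intro C k, assumption) (intro sum.cong refl C k)
    ultimately show ?thesis unfolding eq by (simp del: sum.op_ivl_Suc)
  qed
  then show ?thesis by blast
qed

lemma bs_average_orthonormal:
  assumes "i < n" "j < n"
  shows "(\<integral>x. poly (P i) x * poly (P j) x * bs_average \<rho> m n x \<partial>lborel) = (if i = j then 1 else 0)"
    "integrable lborel (\<lambda>x. poly (P i) x * poly (P j) x * bs_average \<rho> m n x)"
proof -
  obtain \<rho>' where \<rho>': "Im \<rho>' > 0" "bs_weight \<rho> = bs_weight \<rho>'" using bs_weight_wlog[OF \<rho>] by metis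
  have eq: "poly (P i) x * poly (P j) x * bs_average \<rho> m n x = (\<Sum>k=Suc n..<2 * Suc n. poly (P i) x * poly (P j) x * bs_weight \<rho>' (m k) x) /\<^sub>R real (Suc n)" for x
    by (simp add: bs_average_def block_average_def sum_distrib_left \<rho>'(2) mult_ac del: sum.op_ivl_Suc)
  have k: "m k \<ge> Suc n" if "k \<in> {Suc n..<2 * Suc n}" for k using m[of k] that by auto
  have int: "integrable lborel (\<lambda>x. poly (P i) x * poly (P j) x * bs_weight \<rho>' (m k) x)" if "k \<in> {Suc n..<2 * Suc n}" for k
    using bs_weight_integrable[OF \<rho>'(1), of "m k" "P i * P j"] k[OF that] assms degree_mult_le[of "P i" "P j"] by auto
  have o: "(\<integral>x. poly (P i) x * poly (P j) x * bs_weight \<rho>' (m k) x \<partial>lborel) = (if i = j then 1 else 0)" if "k \<in> {Suc n..<2 * Suc n}" for k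
    by (rule bs_orthonormal[OF \<rho>'(1)]) (use k[OF that] assms in auto)
  have "integrable lborel (\<lambda>x. \<Sum>k=Suc n..<2 * Suc n. poly (P i) x * poly (P j) x * bs_weight \<rho>' (m k) x)"
    by (intro Bochner_Integration.integrable_sum int)
  moreover have "(\<integral>x. (\<Sum>k=Suc n..<2 * Suc n. poly (P i) x * poly (P j) x * bs_weight \<rho>' (m k) x) \<partial>lborel) = (\<Sum>k=Suc n..<2 * Suc n. (if i = j then 1 else 0))"
    by (subst Bochner_Integration.integral_sum, intro int, assumption) (intro sum.cong refl o)
  ultimately show "(\<integral>x. poly (P i) x * poly (P j) x * bs_average \<rho> m n x \<partial>lborel) = (if i = j then 1 else 0)"
    "integrable lborel (\<lambda>x. poly (P i) x * poly (P j) x * bs_average \<rho> m n x)"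
    unfolding eq by (simp_all del: sum.op_ivl_Suc)
qed

lemma bs_average_measure_integral:
  fixes f :: "real \<Rightarrow> real"
  assumes [measurable]: "f \<in> borel_measurable borel"
  shows "(\<integral>x. f x \<partial>bs_average_measure \<rho> m n) = (\<integral>x. f x * bs_average \<rho> m n x \<partial>lborel)"
    "integrable (bs_average_measure \<rho> m n) f \<longleftrightarrow> integrable lborel (\<lambda>x. f x * bs_average \<rho> m n x)"
  unfolding bs_average_measure_def
  by (subst integral_real_density integrable_real_density; simp add: bs_average_nonneg mult.commute)+

lemma real_distribution_bs_average_measure: "n \<ge> 1 \<Longrightarrow> real_distribution (bs_average_measure \<rho> m n)"
proof -
  assume n: "n \<ge> 1"
  have int: "integrable lborel (bs_average \<rho> m n)" "(\<integral>x. bs_average \<rho> m n x \<partial>lborel) = 1"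
    using bs_average_orthonormal[of 0 n 0] n by auto
  have "emeasure (bs_average_measure \<rho> m n) UNIV = (\<integral>\<^sup>+x. ennreal (bs_average \<rho> m n x) \<partial>lborel)"
    unfolding bs_average_measure_def by (subst emeasure_density) auto
  also have "\<dots> = 1" using nn_integral_eq_integral[OF int(1)] int(2) bs_average_nonneg by simp
  finally have "prob_space (bs_average_measure \<rho> m n)"
    by (intro prob_spaceI) (simp add: bs_average_measure_def)
  then show ?thesis
    by (simp add: real_distribution_def real_distribution_axioms_def bs_average_measure_def)
qed

text \<open>Each orthogonality relation holds exactly from some index on, so in the limit of the
  moments it is preserved.\<close>

lemma orthonormal_weak_limit:
  obtains r \<nu> where "strict_mono (r :: nat \<Rightarrow> nat)" "real_distribution \<nu>" "weak_conv_m (\<lambda>n. bs_average_measure \<rho> m (Suc (r n))) \<nu>"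
    "orthonormal_L2 \<nu> (\<lambda>n. poly (P n))"
proof -
  have pm: "poly f \<in> borel_measurable borel" for f :: "real poly"
    using continuous_on_poly[of UNIV "\<lambda>x. x" f] by (intro borel_measurable_continuous_onI) simp
  have mom: "\<exists>C. \<forall>\<^sub>F n in sequentially. integrable (bs_average_measure \<rho> m (Suc n)) (poly f) \<and> (\<integral>x. poly f x \<partial>bs_average_measure \<rho> m (Suc n)) = C" for f
  proof -
    obtain C where C: "\<forall>n\<ge>degree f + 2. integrable lborel (\<lambda>x. poly f x * bs_average \<rho> m n x) \<and> (\<integral>x. poly f x * bs_average \<rho> m n x \<partial>lborel) = C"
      using bs_average_moments[of f] by blast
    then have "\<forall>n\<ge>degree f + 2. integrable (bs_average_measure \<rho> m (Suc n)) (poly f) \<and> (\<integral>x. poly f x \<partial>bs_average_measure \<rho> m (Suc n)) = C"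
      by (simp add: bs_average_measure_integral pm)
    then show ?thesis unfolding eventually_sequentially by blast
  qed
  have rd: "real_distribution (bs_average_measure \<rho> m (Suc n))" for n
    by (rule real_distribution_bs_average_measure) simp
  obtain r \<nu> where r: "strict_mono r" and \<nu>: "real_distribution \<nu>" and conv: "weak_conv_m ((\<lambda>n. bs_average_measure \<rho> m (Suc n)) \<circ> r) \<nu>"
    and int: "\<And>f. integrable \<nu> (poly f)" and lim: "\<And>f. (\<lambda>n. \<integral>x. poly f x \<partial>bs_average_measure \<rho> m (Suc (r n))) \<longlonglongrightarrow> (\<integral>x. poly f x \<partial>\<nu>)"
    using weak_limit_with_moments[of "\<lambda>n. bs_average_measure \<rho> m (Suc n)", OF rd mom] by blast
  interpret \<nu>: real_distribution \<nu> by fact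
  have "orthonormal_L2 \<nu> (\<lambda>n. poly (P n))"
    unfolding orthonormal_L2_def
  proof (intro conjI allI)
    fix j k :: nat
    show "poly (P j) \<in> borel_measurable \<nu>" using pm by (rule \<nu>.measurable_finite_borel)
    show "integrable \<nu> (\<lambda>x. (poly (P j) x)\<^sup>2)" using int[of "(P j)\<^sup>2"] by (simp add: poly_power[abs_def])
    have "\<forall>\<^sub>F n in sequentially. (\<integral>x. poly (P j * P k) x \<partial>bs_average_measure \<rho> m (Suc (r n))) = (if j = k then 1 else 0)"
      using eventually_ge_at_top[of "max j k"]
    proof eventually_elim
      case (elim n)
      have "r n \<ge> n" using r by (rule seq_suble)
      with elim have "j < Suc (r n)" "k < Suc (r n)" by auto
      then show ?case by (subst bs_average_measure_integral(1)[OF pm]) (simp add: bs_average_orthonormal(1))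
    qed
    with lim[of "P j * P k"] have "(\<lambda>n::nat. if j = k then 1 else 0) \<longlonglongrightarrow> (\<integral>x. poly (P j * P k) x \<partial>\<nu>)"
      by (rule Lim_transform_eventually)
    then have "(if j = k then 1 else 0) = (\<integral>x. poly (P j * P k) x \<partial>\<nu>)" unfolding LIMSEQ_const_iff .
    then show "(\<integral>x. poly (P j) x * poly (P k) x \<partial>\<nu>) = (if j = k then 1 else 0)" by simp
  qed
  with r \<nu> conv that show thesis by (simp add: comp_def)
qed

end

end

text \<open>\<open>z\<close> and \<open>cnj z\<close> serve as coordinates for
  \<open>(v1, v2)\<close>, independent because \<open>Im \<gamma> \<noteq> 0\<close>; in them the
  denominator of the weight takes the form treated by \<open>block_average_elliptic\<close>. The
  coefficient \<open>t\<close> vanishes exactly when \<open>\<rho>0\<close> is the eigenvector ratio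
  \<open>\<rho>\<close>.\<close>

lemma elliptic_coordinates:
  fixes \<gamma> \<rho>0 :: complex and \<beta> v1 v2 :: real
  assumes "\<beta> \<noteq> 0" "Im \<gamma> \<noteq> 0"
  defines "\<rho> \<equiv> \<gamma> / of_real \<beta>" and "z \<equiv> of_real (\<beta> * v1) + \<gamma> * of_real v2"
  defines "s \<equiv> (\<rho>0 - cnj \<rho>) / (2 * \<i> * Im \<gamma>)" and "t \<equiv> (\<rho> - \<rho>0) / (2 * \<i> * Im \<gamma>)"
  shows "of_real v1 + \<rho>0 * of_real v2 = s * z + t * cnj z"
    and "(norm s)\<^sup>2 - (norm t)\<^sup>2 = Im \<rho>0 * Im \<rho> / (Im \<gamma>)\<^sup>2"
proof -
  define d where "d = 2 * \<i> * complex_of_real (Im \<gamma>)"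
  have d: "d = \<gamma> - cnj \<gamma>" by (simp add: d_def complex_eq_iff)
  have d0: "d \<noteq> 0" using assms(2) by (simp add: d_def)
  have 1: "z - cnj z = d * of_real v2" by (simp add: z_def d algebra_simps)
  have 2: "\<rho> * cnj z - cnj \<rho> * z = d * of_real v1"
    using assms(1) by (simp add: \<rho>_def z_def d field_simps)
  have "d * (s * z + t * cnj z) = (\<rho>0 - cnj \<rho>) * z + (\<rho> - \<rho>0) * cnj z"
    using d0 by (simp add: s_def t_def d_def[symmetric] distrib_left)
  also have "\<dots> = \<rho>0 * (z - cnj z) + (\<rho> * cnj z - cnj \<rho> * z)" by (simp add: algebra_simps)
  also have "\<dots> = d * (of_real v1 + \<rho>0 * of_real v2)" unfolding 1 2 by (simp add: algebra_simps)
  finally show "of_real v1 + \<rho>0 * of_real v2 = s * z + t * cnj z" using d0 by simp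
  have nd: "(norm d)\<^sup>2 = 4 * (Im \<gamma>)\<^sup>2" by (simp add: d_def norm_mult power_mult_distrib)
  have "(norm s)\<^sup>2 - (norm t)\<^sup>2 = ((norm (\<rho>0 - cnj \<rho>))\<^sup>2 - (norm (\<rho> - \<rho>0))\<^sup>2) / (norm d)\<^sup>2"
    unfolding s_def t_def d_def[symmetric] norm_divide power_divide by (simp only: diff_divide_distrib)
  also have "(norm (\<rho>0 - cnj \<rho>))\<^sup>2 - (norm (\<rho> - \<rho>0))\<^sup>2 = 4 * (Im \<rho>0 * Im \<rho>)"
    unfolding cmod_power2 by (simp add: power2_eq_square algebra_simps)
  finally show "(norm s)\<^sup>2 - (norm t)\<^sup>2 = Im \<rho>0 * Im \<rho> / (Im \<gamma>)\<^sup>2" unfolding nd by simp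
qed

text \<open>The real linear map \<open>(v1, v2) \<mapsto> v1 + \<rho> * v2\<close> is invertible for
  nonreal \<rho>. With the lower bound on the vectors in \<open>asymptotics\<close> this bounds the
  weights uniformly, as dominated convergence requires.\<close>

lemma norm_sq_ge:
  fixes \<rho> :: complex
  assumes "Im \<rho> \<noteq> 0"
  shows "v1\<^sup>2 + v2\<^sup>2 \<le> (2 + (2 * (Re \<rho>)\<^sup>2 + 1) / (Im \<rho>)\<^sup>2) * (norm (of_real v1 + \<rho> * of_real v2))\<^sup>2"
proof -
  define A B where "A = v1 + Re \<rho> * v2" and "B = Im \<rho> * v2"
  have n: "(norm (of_real v1 + \<rho> * of_real v2))\<^sup>2 = A\<^sup>2 + B\<^sup>2" unfolding cmod_power2 by (simp add: A_def B_def)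
  have v2: "v2\<^sup>2 = B\<^sup>2 / (Im \<rho>)\<^sup>2" using assms by (simp add: B_def power_mult_distrib)
  have "v1\<^sup>2 = (A - Re \<rho> * v2)\<^sup>2" by (simp add: A_def)
  also have "\<dots> \<le> 2 * A\<^sup>2 + 2 * (Re \<rho> * v2)\<^sup>2"
    using zero_le_power2[of "A + Re \<rho> * v2"] by (simp add: power2_eq_square algebra_simps)
  finally have "v1\<^sup>2 + v2\<^sup>2 \<le> 2 * A\<^sup>2 + (2 * (Re \<rho>)\<^sup>2 + 1) * v2\<^sup>2" by (simp add: power_mult_distrib algebra_simps)
  also have "\<dots> = 2 * A\<^sup>2 + (2 * (Re \<rho>)\<^sup>2 + 1) / (Im \<rho>)\<^sup>2 * B\<^sup>2" unfolding v2 by simp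
  also have "\<dots> \<le> (2 + (2 * (Re \<rho>)\<^sup>2 + 1) / (Im \<rho>)\<^sup>2) * (A\<^sup>2 + B\<^sup>2)"
  proof -
    have *: "g * A\<^sup>2 \<ge> 0 \<Longrightarrow> 2 * A\<^sup>2 + g * B\<^sup>2 \<le> (2 + g) * (A\<^sup>2 + B\<^sup>2)" for g
      by (simp add: distrib_left distrib_right)
    show ?thesis by (rule *) simp
  qed
  finally show ?thesis unfolding n .
qed

text \<open>The sequence \<open>m\<close> is \<open>k \<mapsto> k N + i\<close>. The last assumption says that, almost everywhere, either the
  phases equidistribute or the limit matrix has the same left eigenvector as at \<open>l\<close>.\<close>

locale elliptic_jacobi = jacobi a b +
  E: elliptic_recurrence "{l..u}" \<delta> x11 x12 x21 x22 y11 y12 y21 y22 "\<lambda>k. a (m k - 1)"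
    "\<lambda>k. poly (orth_poly a b (m k - 1))" "\<lambda>k. poly (orth_poly a b (m k))"
  for a b l u \<delta> x11 x12 x21 x22 y11 y12 y21 y22 m +
  assumes lu: "l < u" and m: "\<And>k. k \<le> m k"
    and generic: "AE x in lborel. x \<in> {l..u} \<longrightarrow>
      (y11 x = y11 l \<and> y21 x = y21 l \<and> y22 x = y22 l) \<or> (\<forall>j\<ge>1. E.\<epsilon> x ^ (2 * j) \<noteq> 1)"
begin

text \<open>The weights take one parameter for all \<open>x\<close>, hence the evaluation at the
  left endpoint; if the limit matrix is constant, this is the eigenvector ratio at every
  point.\<close>

definition \<rho>0 where "\<rho>0 = (E.\<epsilon> l - of_real (y11 l)) / of_real (y21 l)"

lemma \<sigma>_pos: "x \<in> {l..u} \<Longrightarrow> E.\<sigma> x > 0"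
  using E.\<tau>_bound[of x] by (simp add: E.\<sigma>_def)

lemma Im_\<rho>0: "Im \<rho>0 \<noteq> 0"
  using \<sigma>_pos[of l] E.y21_nz[of l] lu by (simp add: \<rho>0_def E.\<epsilon>_def)

lemma bs_weight_v: "bs_weight \<rho>0 (m k) x = \<bar>Im \<rho>0\<bar> / pi * (1 / (norm (of_real (E.v1 k x) + \<rho>0 * of_real (E.v2 k x)))\<^sup>2)"
proof -
  have "of_real (E.v1 k x) + \<rho>0 * of_real (E.v2 k x) =
     of_real (sqrt (a (m k - 1))) * (of_real (poly (P (m k - 1)) x) + \<rho>0 * of_real (poly (P (m k)) x))"
    unfolding E.v1_def E.v2_def by (simp only: of_real_mult distrib_left mult_ac)
  then have "(norm (of_real (E.v1 k x) + \<rho>0 * of_real (E.v2 k x)))\<^sup>2 =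
     a (m k - 1) * (norm (of_real (poly (P (m k - 1)) x) + \<rho>0 * of_real (poly (P (m k)) x)))\<^sup>2"
    by (simp add: norm_mult power_mult_distrib)
  then show ?thesis unfolding bs_weight_def by simp
qed

text \<open>The factor \<open>\<bar>Im \<rho>0\<bar>\<close> of the weight cancels against
  \<open>\<bar>(norm s)\<^sup>2 - (norm t)\<^sup>2\<bar>\<close>, so the limit does not depend on
  the choice of \<open>\<rho>0\<close>.\<close>

lemma bs_average_tendsto:
  assumes x: "x \<in> {l..u}" and \<zeta>: "\<zeta> \<noteq> 0"
    and t1: "\<And>k. k \<ge> M \<Longrightarrow> \<bar>E.t k x\<bar> \<le> 1"
    and lim: "(\<lambda>k. of_real (y21 x * E.v1 k x) + (E.\<epsilon> x - of_real (y11 x)) * of_real (E.v2 k x) - \<zeta> * cis (E.phase M k x)) \<longlonglongrightarrow> 0"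
    and gen: "(y11 x = y11 l \<and> y21 x = y21 l \<and> y22 x = y22 l) \<or> (\<forall>j\<ge>1. E.\<epsilon> x ^ (2 * j) \<noteq> 1)"
  shows "block_average (\<lambda>k. bs_weight \<rho>0 (m k) x) \<longlonglongrightarrow> \<bar>y21 x\<bar> * E.\<sigma> x / (pi * (norm \<zeta>)\<^sup>2)"
proof -
  define \<gamma> where "\<gamma> = E.\<epsilon> x - of_real (y11 x)"
  define \<rho> where "\<rho> = \<gamma> / of_real (y21 x)"
  define s where "s = (\<rho>0 - cnj \<rho>) / (2 * \<i> * Im \<gamma>)"
  define t where "t = (\<rho> - \<rho>0) / (2 * \<i> * Im \<gamma>)"
  define z where "z k = of_real (y21 x * E.v1 k x) + \<gamma> * of_real (E.v2 k x)" for k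
  \<comment> \<open>The phase at \<open>Suc k\<close> exceeds that at \<open>k\<close> by the angle
    with index \<open>Suc k\<close>. Below \<open>M\<close> the phase sum is empty, and the value
    \<open>1\<close> keeps the product recursion valid for every \<open>k\<close>.\<close>
  define e where "e k = (if k \<ge> M then cis (E.\<theta> (Suc k) x) else 1)" for k
  have y0: "y21 x \<noteq> 0" by (rule E.y21_nz[OF x])
  have Im\<gamma>: "Im \<gamma> = E.\<sigma> x" by (simp add: \<gamma>_def E.\<epsilon>_def)
  have sp: "E.\<sigma> x > 0" by (rule \<sigma>_pos[OF x])
  have Im\<gamma>0: "Im \<gamma> \<noteq> 0" using sp Im\<gamma> by simp
  have Im\<rho>: "Im \<rho> = E.\<sigma> x / y21 x" by (simp add: \<rho>_def Im\<gamma>)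
  have vz: "of_real (E.v1 k x) + \<rho>0 * of_real (E.v2 k x) = s * z k + t * cnj (z k)" for k
    unfolding s_def t_def z_def \<rho>_def by (rule elliptic_coordinates(1)[OF y0 Im\<gamma>0])
  have st: "(norm s)\<^sup>2 - (norm t)\<^sup>2 = Im \<rho>0 * Im \<rho> / (Im \<gamma>)\<^sup>2"
    unfolding s_def t_def \<rho>_def by (rule elliptic_coordinates(2)[OF y0 Im\<gamma>0])
  have st_abs: "\<bar>(norm s)\<^sup>2 - (norm t)\<^sup>2\<bar> = \<bar>Im \<rho>0\<bar> / (\<bar>y21 x\<bar> * E.\<sigma> x)"
    unfolding st Im\<rho> Im\<gamma> using sp by (simp add: abs_mult power2_eq_square)
  have "\<bar>(norm s)\<^sup>2 - (norm t)\<^sup>2\<bar> > 0" unfolding st_abs using sp y0 Im_\<rho>0 by simp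
  then have ne: "norm t \<noteq> norm s" by auto
  have elim: "e \<longlonglongrightarrow> E.\<epsilon> x"
  proof (rule Lim_transform_eventually[OF LIMSEQ_Suc[OF E.e_lim[OF x]]])
    show "\<forall>\<^sub>F k in sequentially. E.e (Suc k) x = e k"
      using eventually_ge_at_top[of M]
    proof eventually_elim
      case (elim k)
      have "1 - (E.t (Suc k) x)\<^sup>2 \<ge> 0" using t1[of "Suc k"] elim by (simp add: abs_square_le_1)
      then show ?case using E.e_eq_cis(1)[of "Suc k" x] elim by (simp add: e_def)
    qed
  qed
  have tz: "t = 0 \<or> s = 0 \<or> (\<forall>j\<ge>1. E.\<epsilon> x ^ (2 * j) \<noteq> 1)"
  proof (cases "y11 x = y11 l \<and> y21 x = y21 l \<and> y22 x = y22 l")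
    case True
    then have "\<rho> = \<rho>0" by (simp add: \<rho>_def \<rho>0_def \<gamma>_def E.\<epsilon>_def E.\<tau>_def E.\<sigma>_def)
    then show ?thesis by (simp add: t_def)
  next
    case False
    with gen show ?thesis by blast
  qed
  have "block_average (\<lambda>k. 1 / (norm (s * z k + t * cnj (z k)))\<^sup>2) \<longlonglongrightarrow> 1 / (\<bar>(norm s)\<^sup>2 - (norm t)\<^sup>2\<bar> * (norm \<zeta>)\<^sup>2)"
  proof (rule block_average_elliptic[where E = "\<lambda>k. cis (E.phase M k x)" and e = e and ?e0.0 = "E.\<epsilon> x"])
    show "(\<lambda>k. z k - \<zeta> * cis (E.phase M k x)) \<longlonglongrightarrow> 0" using lim by (simp add: z_def \<gamma>_def)
    show "cis (E.phase M (Suc k) x) = e k * cis (E.phase M k x)" for k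
    proof (cases "k \<ge> M")
      case True
      then show ?thesis by (simp add: e_def E.phase_def cis_mult add.commute)
    next
      case False
      then show ?thesis by (simp add: e_def E.phase_def)
    qed
  qed (use \<zeta> elim ne tz in \<open>auto simp: e_def\<close>)
  from tendsto_mult_left[OF this, of "\<bar>Im \<rho>0\<bar> / pi"]
  have "(\<lambda>n. \<bar>Im \<rho>0\<bar> / pi * block_average (\<lambda>k. 1 / (norm (s * z k + t * cnj (z k)))\<^sup>2) n)
     \<longlonglongrightarrow> \<bar>Im \<rho>0\<bar> / pi * (1 / (\<bar>(norm s)\<^sup>2 - (norm t)\<^sup>2\<bar> * (norm \<zeta>)\<^sup>2))" .
  moreover have "\<bar>Im \<rho>0\<bar> / pi * (1 / (\<bar>(norm s)\<^sup>2 - (norm t)\<^sup>2\<bar> * (norm \<zeta>)\<^sup>2)) = \<bar>y21 x\<bar> * E.\<sigma> x / (pi * (norm \<zeta>)\<^sup>2)"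
    unfolding st_abs using Im_\<rho>0 by simp
  moreover have "(\<lambda>n. \<bar>Im \<rho>0\<bar> / pi * block_average (\<lambda>k. 1 / (norm (s * z k + t * cnj (z k)))\<^sup>2) n) = block_average (\<lambda>k. bs_weight \<rho>0 (m k) x)"
    unfolding bs_weight_v vz
    by (rule ext, rule block_average_linear[OF bounded_linear.linear[OF bounded_linear_mult_right], symmetric])
  ultimately show ?thesis by simp
qed

theorem orthogonality_measure:
  obtains M \<zeta> C \<nu> where "M \<ge> 1" "continuous_on {l..u} \<zeta>" "\<And>x. x \<in> {l..u} \<Longrightarrow> \<zeta> x \<noteq> 0" "C \<ge> 0"
    "\<And>k x. k \<ge> M \<Longrightarrow> x \<in> {l..u} \<Longrightarrow> \<bar>E.t k x\<bar> \<le> 1"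
    "\<And>k x. k \<ge> M \<Longrightarrow> x \<in> {l..u} \<Longrightarrow> \<bar>sqrt (a (m (Suc k) - 1)) * poly (P (m k)) x - Im (\<zeta> x * cis (E.phase M k x)) / E.\<sigma> x\<bar> \<le> C * E.tail k"
    "real_distribution \<nu>" "orthonormal_L2 \<nu> (\<lambda>n. poly (P n))"
    "\<And>l' u'. l < l' \<Longrightarrow> l' < u' \<Longrightarrow> u' < u \<Longrightarrow>
       abs_cont_density_on \<nu> {l'..u'} (\<lambda>x. \<bar>y21 x\<bar> * E.\<sigma> x / (pi * (norm (\<zeta> x))\<^sup>2))"
proof -
  obtain M \<zeta> C c where A: "M \<ge> 1" "continuous_on {l..u} \<zeta>" "\<And>x. x \<in> {l..u} \<Longrightarrow> \<zeta> x \<noteq> 0" "C \<ge> 0" "c > 0"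
    "\<And>k x. k \<ge> M \<Longrightarrow> x \<in> {l..u} \<Longrightarrow> \<bar>E.t k x\<bar> \<le> 1"
    "\<And>k x. k \<ge> M \<Longrightarrow> x \<in> {l..u} \<Longrightarrow> \<bar>sqrt (a (m (Suc k) - 1)) * poly (P (m k)) x - Im (\<zeta> x * cis (E.phase M k x)) / E.\<sigma> x\<bar> \<le> C * E.tail k"
    "\<And>x. x \<in> {l..u} \<Longrightarrow> (\<lambda>k. of_real (y21 x * E.v1 k x) + (E.\<epsilon> x - of_real (y11 x)) * of_real (E.v2 k x) - \<zeta> x * cis (E.phase M k x)) \<longlonglongrightarrow> 0"
    "\<And>k x. k \<ge> M \<Longrightarrow> x \<in> {l..u} \<Longrightarrow> (E.v1 k x)\<^sup>2 + (E.v2 k x)\<^sup>2 \<ge> c"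
    using E.asymptotics by blast
  define w where "w x = \<bar>y21 x\<bar> * E.\<sigma> x / (pi * (norm (\<zeta> x))\<^sup>2)" for x
  have contw: "continuous_on {l..u} w"
    unfolding w_def E.\<sigma>_def E.\<tau>_def using A(3) by (intro continuous_intros E.conty A(2)) auto
  have w0: "w x \<ge> 0" if "x \<in> {l..u}" for x unfolding w_def using \<sigma>_pos[OF that] by simp
  obtain r \<nu> where r: "strict_mono (r :: nat \<Rightarrow> nat)" and \<nu>: "real_distribution \<nu>"
    and conv: "weak_conv_m (\<lambda>n. bs_average_measure \<rho>0 m (Suc (r n))) \<nu>" and orth: "orthonormal_L2 \<nu> (\<lambda>n. poly (P n))"
    using orthonormal_weak_limit[OF Im_\<rho>0 m] by blast
  define B where "B = \<bar>Im \<rho>0\<bar> / pi * ((2 + (2 * (Re \<rho>0)\<^sup>2 + 1) / (Im \<rho>0)\<^sup>2) / c)"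
  have wB: "norm (bs_weight \<rho>0 (m k) x) \<le> B" if "k \<ge> M" "x \<in> {l..u}" for k x
  proof -
    define N2 where "N2 = (norm (of_real (E.v1 k x) + \<rho>0 * of_real (E.v2 k x)))\<^sup>2"
    define G where "G = 2 + (2 * (Re \<rho>0)\<^sup>2 + 1) / (Im \<rho>0)\<^sup>2"
    have G: "G > 0" unfolding G_def by (intro add_pos_nonneg divide_nonneg_nonneg) auto
    have le: "c \<le> G * N2" using A(9)[OF that] norm_sq_ge[OF Im_\<rho>0, of "E.v1 k x" "E.v2 k x"] unfolding N2_def G_def by linarith
    then have "N2 > 0" using A(5) G by (smt (verit) mult_nonneg_nonpos)
    then have "1 / N2 \<le> G / c" using le A(5) by (simp add: field_simps)
    then have "bs_weight \<rho>0 (m k) x \<le> B"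
      unfolding bs_weight_v B_def N2_def[symmetric] G_def[symmetric] by (intro mult_left_mono) auto
    moreover have "bs_weight \<rho>0 (m k) x \<ge> 0" unfolding bs_weight_v by simp
    ultimately show ?thesis by simp
  qed
  have rge: "r n \<ge> n" for n by (rule seq_suble[OF r])
  have avgB: "norm (bs_average \<rho>0 m (Suc (r n)) x) \<le> B" if "n \<ge> M" "x \<in> {l..u}" for n x
    unfolding bs_average_def
    by (rule block_average_norm_le) (use wB that rge[of n] in auto)
  have rsub: "strict_mono (\<lambda>n. Suc (Suc (r n)))" using r by (simp add: strict_mono_def)
  have avg_lim: "(\<lambda>n. bs_average \<rho>0 m (Suc (r n)) x) \<longlonglongrightarrow> w x"
    if x: "x \<in> {l..u}" and g: "(y11 x = y11 l \<and> y21 x = y21 l \<and> y22 x = y22 l) \<or> (\<forall>j\<ge>1. E.\<epsilon> x ^ (2 * j) \<noteq> 1)" for x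
  proof -
    have "block_average (\<lambda>k. bs_weight \<rho>0 (m k) x) \<longlonglongrightarrow> w x"
      unfolding w_def by (rule bs_average_tendsto[OF x A(3)[OF x] A(6)[OF _ x] A(8)[OF x] g])
    from LIMSEQ_subseq_LIMSEQ[OF this rsub] show ?thesis by (simp add: bs_average_def comp_def)
  qed
  have lim: "(\<lambda>n. measure (bs_average_measure \<rho>0 m (Suc (r n))) {c'..d'}) \<longlonglongrightarrow> (\<integral>x. indicator {c'..d'} x * w x \<partial>lborel)"
    if cd: "l < c'" "c' < d'" "d' < u" for c' d'
  proof -
    have eq: "measure (bs_average_measure \<rho>0 m n) {c'..d'} = (\<integral>x. indicator {c'..d'} x * bs_average \<rho>0 m n x \<partial>lborel)" for n
    proof -
      have "measure (bs_average_measure \<rho>0 m n) {c'..d'} = (\<integral>x. indicator {c'..d'} x \<partial>bs_average_measure \<rho>0 m n)"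
        by (simp add: bs_average_measure_def)
      also have "\<dots> = (\<integral>x. indicator {c'..d'} x * bs_average \<rho>0 m n x \<partial>lborel)"
        by (rule bs_average_measure_integral(1)[OF Im_\<rho>0 m]) simp
      finally show ?thesis .
    qed
    \<comment> \<open>The weights are known to be bounded by \<open>B\<close> only from
      \<open>M\<close> on, so dominated convergence is applied to the shifted sequence.\<close>
    have "(\<lambda>n. \<integral>x. indicator {c'..d'} x * bs_average \<rho>0 m (Suc (r (n + M))) x \<partial>lborel) \<longlonglongrightarrow> (\<integral>x. indicator {c'..d'} x * w x \<partial>lborel)"
    proof (rule integral_dominated_convergence[where w = "\<lambda>x. B * indicator {c'..d'} x"])
      show "(\<lambda>x. indicator {c'..d'} x * w x) \<in> borel_measurable lborel"
      proof -
        have "(\<lambda>x. if x \<in> {c'..d'} then w x else 0) \<in> borel_measurable borel"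
          by (rule borel_measurable_continuous_on_if) (use cd in \<open>auto intro: continuous_on_subset[OF contw]\<close>)
        moreover have "(\<lambda>x. indicator {c'..d'} x * w x) = (\<lambda>x. if x \<in> {c'..d'} then w x else 0)" by (auto simp: indicator_def)
        ultimately show ?thesis by simp
      qed
      show "(\<lambda>x. indicator {c'..d'} x * bs_average \<rho>0 m (Suc (r (n + M))) x) \<in> borel_measurable lborel" for n
        using borel_measurable_bs_average[OF Im_\<rho>0 m] by simp
      show "integrable lborel (\<lambda>x. B * indicator {c'..d'} x)"
        by (rule integrable_mult_right[OF integrable_real_indicator]) (auto simp: emeasure_lborel_Icc_eq)
      show "AE x in lborel. (\<lambda>n. indicator {c'..d'} x * bs_average \<rho>0 m (Suc (r (n + M))) x) \<longlonglongrightarrow> indicator {c'..d'} x * w x"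
        using generic
      proof eventually_elim
        case (elim x)
        show ?case
        proof (cases "x \<in> {c'..d'}")
          case True
          then have "x \<in> {l..u}" using cd by auto
          with elim avg_lim[of x] have "(\<lambda>n. bs_average \<rho>0 m (Suc (r n)) x) \<longlonglongrightarrow> w x" by blast
          from LIMSEQ_ignore_initial_segment[OF this, of M] show ?thesis by (intro tendsto_mult tendsto_const)
        qed simp
      qed
      show "AE x in lborel. norm (indicator {c'..d'} x * bs_average \<rho>0 m (Suc (r (n + M))) x) \<le> B * indicator {c'..d'} x" for n
      proof (rule AE_I2)
        fix x
        show "norm (indicator {c'..d'} x * bs_average \<rho>0 m (Suc (r (n + M))) x) \<le> B * indicator {c'..d'} x"
          using avgB[of "n + M" x] cd by (cases "x \<in> {c'..d'}") auto
      qed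
    qed
    from LIMSEQ_offset[OF this] show ?thesis unfolding eq .
  qed
  have rd: "real_distribution (bs_average_measure \<rho>0 m (Suc (r n)))" for n
    by (rule real_distribution_bs_average_measure[OF Im_\<rho>0 m]) simp
  have "abs_cont_density_on \<nu> {l'..u'} w" if "l < l'" "l' < u'" "u' < u" for l' u'
    unfolding abs_cont_density_on_def
    by (rule weak_limit_density[OF rd \<nu> conv contw w0 lim that])
  then show thesis
    by (intro that[OF A(1-4,6,7) \<nu> orth]) (auto simp: w_def[abs_def])
qed

end

text \<open>If the trace polynomial \<open>T\<close> is constant, \<open>dom\<close> makes the
  derivatives of the other polynomials vanish on an interval, so these are constant too. Otherwise
  \<open>T\<close> takes each value finitely often, and the doubled real parts of roots of unity are
  countably many, so the exceptional points form a null set.\<close>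

lemma elliptic_polynomial_generic:
  fixes T Q1 Q2 Q3 :: "real poly" and l u :: real
  assumes lu: "l < u"
    and dom: "\<And>x. x \<in> {l..u} \<Longrightarrow> poly (pderiv T) x = 0 \<Longrightarrow>
      poly (pderiv Q1) x = 0 \<and> poly (pderiv Q2) x = 0 \<and> poly (pderiv Q3) x = 0"
    and e: "\<And>x. Re (e x) = poly T x / 2"
  shows "AE x in lborel. x \<in> {l..u} \<longrightarrow>
     (poly Q1 x = poly Q1 l \<and> poly Q2 x = poly Q2 l \<and> poly Q3 x = poly Q3 l) \<or> (\<forall>j\<ge>1. e x ^ (2 * j) \<noteq> (1::complex))"
proof (cases "pderiv T = 0")
  case True
  have const: "poly Q x = poly Q l" if "\<And>x. x \<in> {l..u} \<Longrightarrow> poly (pderiv Q) x = 0" for Q x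
  proof -
    have "infinite {x. poly (pderiv Q) x = 0}"
      by (rule infinite_super[of "{l..u}"]) (use that lu in auto)
    then have "pderiv Q = 0" using poly_roots_finite by blast
    then have "degree Q = 0" by (simp add: pderiv_eq_0_iff)
    then obtain c where "Q = [:c:]" by (rule degree_eq_zeroE)
    then show ?thesis by simp
  qed
  have "poly Q1 x = poly Q1 l \<and> poly Q2 x = poly Q2 l \<and> poly Q3 x = poly Q3 l" for x
    using dom True by (intro conjI const) auto
  then show ?thesis by simp
next
  case False
  have fin: "finite {x. poly T x = c}" for c
  proof -
    have "T - [:c:] \<noteq> 0" using False by auto
    then have "finite {x. poly (T - [:c:]) x = 0}" by (rule poly_roots_finite)
    then show ?thesis by simp
  qed
  define Z where "Z = (\<Union>j\<in>{1..}. \<Union>z\<in>{z::complex. z ^ (2 * j) = 1}. {x. poly T x = 2 * Re z})"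
  have "countable Z" unfolding Z_def
  proof (intro countable_UN)
    fix j :: nat assume "j \<in> {1..}"
    then show "countable {z::complex. z ^ (2 * j) = 1}" by (intro countable_finite finite_roots_unity) auto
  qed (auto intro: countable_finite fin)
  then have "AE x in lborel. x \<notin> Z" by (intro AE_not_in countable_imp_null_set_lborel)
  then show ?thesis
  proof eventually_elim
    case (elim x)
    have "e x ^ (2 * j) \<noteq> 1" if "j \<ge> 1" for j
    proof
      assume "e x ^ (2 * j) = 1"
      moreover have "poly T x = 2 * Re (e x)" using e[of x] by simp
      ultimately have "x \<in> Z" unfolding Z_def using that by blast
      with elim show False by simp
    qed
    then show ?case by blast
  qed
qed

section \<open>Application to the given transfer matrices\<close>

lemma ivl_extension:
  fixes h :: "real \<Rightarrow> real"
  assumes cont: "continuous_on UNIV h" and h: "\<And>x. x \<in> {l..u} \<Longrightarrow> h x < c" and lu: "l \<le> u"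
  obtains l' u' where "l' < l" "u < u'" "\<And>x. x \<in> {l'..u'} \<Longrightarrow> h x < c"
proof -
  have op: "open {x. h x < c}" using cont by (intro open_Collect_less) auto
  obtain e1 where e1: "e1 > 0" "ball l e1 \<subseteq> {x. h x < c}" using op h[of l] lu unfolding open_contains_ball by auto
  obtain e2 where e2: "e2 > 0" "ball u e2 \<subseteq> {x. h x < c}" using op h[of u] lu unfolding open_contains_ball by auto
  show thesis
  proof (rule that[of "l - e1 / 2" "u + e2 / 2"])
    fix x assume x: "x \<in> {l - e1 / 2..u + e2 / 2}"
    consider "x < l" | "x \<in> {l..u}" | "u < x" by fastforce
    then show "h x < c"
    proof cases
      case 1
      then have "x \<in> ball l e1" using x e1(1) by (simp add: dist_real_def)
      then show ?thesis using e1(2) by blast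
    next
      case 3
      then have "x \<in> ball u e2" using x e2(1) by (simp add: dist_real_def)
      then show ?thesis using e2(2) by blast
    qed (rule h)
  qed (use e1 e2 in auto)
qed

lemma spectral_norm_component: "\<bar>A $ i $ j\<bar> \<le> spectral_norm A"
  unfolding spectral_norm_def by (rule matrix_component_le_onorm)

lemma spectral_norm_diff: "spectral_norm (A - B) \<le> spectral_norm A + spectral_norm B"
proof -
  have bl: "bounded_linear ((*v) A)" for A :: "real^2^2" by (rule matrix_vector_mul_bounded_linear)
  have "(\<lambda>v. (A - B) *v v) = (\<lambda>v. A *v v + - (B *v v))"
    by (simp add: matrix_vector_mult_diff_rdistrib)
  then have "spectral_norm (A - B) \<le> onorm ((*v) A) + onorm (\<lambda>v. - (B *v v))"
    unfolding spectral_norm_def using onorm_triangle[OF bl bounded_linear_minus[OF bl], of A B] by simp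
  then show ?thesis by (simp add: spectral_norm_def onorm_neg)
qed

theorem theorem5p1:
  fixes a b :: "nat \<Rightarrow> real" and N i :: nat and K :: "real set"
    and X :: "nat \<Rightarrow> real \<Rightarrow> real^2^2" and \<X> :: "real \<Rightarrow> real^2^2"
    and p :: "nat \<Rightarrow> real \<Rightarrow> real"
  assumes a_pos: "\<And>n. a n > 0"
    and N_pos: "N > 0" and i_less: "i < N"
    and X_def: "X = step_matrix a b N"
    and p_def: "p = (\<lambda>n. poly (orth_poly a b n))"
    and K: "compact K" "is_interval K" "interior K \<noteq> {}"
    and K_sub: "K \<subseteq> {x. \<exists>L<0. (\<lambda>j. discr (X (j * N + i) x)) \<longlonglongrightarrow> L}"
    and a_ratio: "(\<lambda>j. a ((j + 1) * N + i - 1) / a (j * N + i - 1)) \<longlonglongrightarrow> 1"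
    and D1: "stolz_class_1 K GL2 (\<lambda>j. X (j * N + i))"
    and X_lim: "\<And>x. x \<in> K \<Longrightarrow> (\<lambda>j. X (j * N + i) x) \<longlonglongrightarrow> \<X> x"
  shows "\<exists>(\<nu> :: real measure) (\<nu>' :: real \<Rightarrow> real).
     prob_space \<nu> \<and> sets \<nu> = sets borel \<and> orthonormal_L2 \<nu> p \<and>
     abs_cont_density_on \<nu> K \<nu>' \<and> continuous_on K \<nu>' \<and> (\<forall>x\<in>K. \<nu>' x > 0) \<and>
     (\<exists>(M :: nat) (c :: real) (\<eta> :: real \<Rightarrow> real) (E :: nat \<Rightarrow> real \<Rightarrow> real).
        M > 0 \<and> c > 0 \<and> continuous_on K \<eta> \<and>
        (\<forall>j>M. \<forall>x\<in>K. \<bar>trace (X (j * N + i) x) / (2 * sqrt (det (X (j * N + i) x)))\<bar> \<le> 1) \<and>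
        (\<forall>k\<ge>M. \<forall>x\<in>K.
           sqrt (a ((k + 1) * N + i - 1)) * p (k * N + i) x =
             sqrt (2 * \<bar>\<X> x $ 2 $ 1\<bar> / (pi * \<nu>' x * sqrt (- discr (\<X> x)))) *
               sin ((\<Sum>j=M+1..k. transfer_angle a b N (j * N + i) x) + \<eta> x)
             + E (k * N + i) x) \<and>
        (\<forall>k\<ge>M.
           bdd_above ((\<lambda>x. \<bar>E (k * N + i) x\<bar>) ` K) \<and>
           (SUP x\<in>K. \<bar>E (k * N + i) x\<bar>) \<le>
             c * (\<Sum>j. SUP x\<in>K.
                    spectral_norm (X ((k + j + 1) * N + i) x - X ((k + j) * N + i) x))))"
proof -
  interpret jacobi a b by standard (rule a_pos)
  define m where "m k = k * N + i" for k
  have mk: "k \<le> m k" for k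
  proof -
    have "k * 1 \<le> k * N" using N_pos by (intro mult_left_mono) auto
    then have "k \<le> k * N" by (simp only: mult_1_right)
    then show ?thesis unfolding m_def by (rule trans_le_add1)
  qed
  have mSuc: "m (Suc k) = m k + N" for k by (simp add: m_def)
  obtain l u where Kivl: "K = {l..u}" using K(1,2) connected_compact_interval_1[of K] is_interval_connected_1 by blast
  have lu: "l < u" using K(3) unfolding Kivl by auto
  have "\<exists>q :: real poly. degree q \<le> N \<and> (\<forall>x. X (m k) x $ r $ s = poly q x)" for k r s
    unfolding X_def by (rule step_matrix_poly)
  then obtain q where q: "\<And>k r s. degree (q k r s :: real poly) \<le> N" "\<And>k r s x. X (m k) x $ r $ s = poly (q k r s) x"
    by metis
  have qX: "step_matrix a b N (m k) x $ r $ s = poly (q k r s) x" for k r s x using q(2) by (simp add: X_def)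
  have "infinite K" unfolding Kivl using lu by simp
  \<comment> \<open>Interpolation nodes inside \<open>K\<close>: limits and variation bounds near
    \<open>K\<close> are all deduced from these \<open>N + 1\<close> points.\<close>
  then obtain A where A: "finite A" "card A = Suc N" "A \<subseteq> K" using infinite_arbitrarily_large by metis
  have limK: "(\<lambda>k. poly (q k r s) x) \<longlonglongrightarrow> \<X> x $ r $ s" if "x \<in> K" for r s x
    using tendsto_vec_nth[OF tendsto_vec_nth[OF X_lim[OF that]]] q(2) by (simp add: m_def)
  have "\<exists>Q. \<forall>x. (\<lambda>k. poly (q k r s) x) \<longlonglongrightarrow> poly Q x \<and> (\<lambda>k. poly (pderiv (q k r s)) x) \<longlonglongrightarrow> poly (pderiv Q) x" for r s
    by (rule poly_limit[OF A(1,2) q(1), where f = "\<lambda>x. \<X> x $ r $ s"]) (use limK A(3) in auto)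
  then obtain Q where Q: "\<And>r s x. (\<lambda>k. poly (q k r s) x) \<longlonglongrightarrow> poly (Q r s) x"
    "\<And>r s x. (\<lambda>k. poly (pderiv (q k r s)) x) \<longlonglongrightarrow> poly (pderiv (Q r s)) x" by metis
  have XQ: "\<X> x $ r $ s = poly (Q r s) x" if "x \<in> K" for r s x
    using LIMSEQ_unique[OF limK[OF that] Q(1)] .
  \<comment> \<open>For \<open>k \<ge> 1\<close> this ratio is the determinant of the matrix with
    index \<open>m k\<close>, so the limit matrix has determinant \<open>1\<close>.\<close>
  have \<alpha>_ratio: "(\<lambda>k. a (m k - 1) / a (m (Suc k) - 1)) \<longlonglongrightarrow> 1"
    using tendsto_inverse[OF a_ratio] by (simp add: m_def add.commute add.left_commute)
  have det: "poly (q k 1 1) x * poly (q k 2 2) x - poly (q k 1 2) x * poly (q k 2 1) x = a (m k - 1) / a (m (Suc k) - 1)"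
    if "k \<ge> 1" for k x
  proof -
    have "m k \<ge> 1" using mk[of k] that by simp
    from det_step_matrix[OF this, of N x] show ?thesis by (simp add: det_2 qX mSuc)
  qed
  have detQ: "poly (Q 1 1) x * poly (Q 2 2) x - poly (Q 1 2) x * poly (Q 2 1) x = 1" for x
  proof -
    have "(\<lambda>k. poly (q k 1 1) x * poly (q k 2 2) x - poly (q k 1 2) x * poly (q k 2 1) x)
      \<longlonglongrightarrow> poly (Q 1 1) x * poly (Q 2 2) x - poly (Q 1 2) x * poly (Q 2 1) x"
      by (intro tendsto_intros Q)
    moreover have "\<forall>\<^sub>F k in sequentially. poly (q k 1 1) x * poly (q k 2 2) x - poly (q k 1 2) x * poly (q k 2 1) x = a (m k - 1) / a (m (Suc k) - 1)"
      using eventually_ge_at_top[of 1] by eventually_elim (rule det)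
    ultimately have "(\<lambda>k. a (m k - 1) / a (m (Suc k) - 1)) \<longlonglongrightarrow> poly (Q 1 1) x * poly (Q 2 2) x - poly (Q 1 2) x * poly (Q 2 1) x"
      by (rule Lim_transform_eventually)
    from LIMSEQ_unique[OF this \<alpha>_ratio] show ?thesis .
  qed
  have discr_lim: "(\<lambda>k. discr (X (m k) x)) \<longlonglongrightarrow> (poly (Q 1 1) x + poly (Q 2 2) x)\<^sup>2 - 4" for x
  proof -
    have "(\<lambda>k. (poly (q k 1 1) x + poly (q k 2 2) x)\<^sup>2 - 4 * (poly (q k 1 1) x * poly (q k 2 2) x - poly (q k 1 2) x * poly (q k 2 1) x))
      \<longlonglongrightarrow> (poly (Q 1 1) x + poly (Q 2 2) x)\<^sup>2 - 4 * (poly (Q 1 1) x * poly (Q 2 2) x - poly (Q 1 2) x * poly (Q 2 1) x)"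
      by (intro tendsto_intros Q)
    then show ?thesis by (simp add: discr_def trace_2 det_2 q(2) detQ)
  qed
  have ellK: "(poly (Q 1 1) x + poly (Q 2 2) x)\<^sup>2 < 4" if "x \<in> K" for x
  proof -
    have "\<exists>L<0. (\<lambda>j. discr (X (m j) x)) \<longlonglongrightarrow> L" using K_sub that unfolding m_def by blast
    then obtain L where L: "L < 0" "(\<lambda>j. discr (X (m j) x)) \<longlonglongrightarrow> L" by blast
    have "L = (poly (Q 1 1) x + poly (Q 2 2) x)\<^sup>2 - 4" by (rule LIMSEQ_unique[OF L(2) discr_lim])
    with L(1) show ?thesis by simp
  qed
  txt \<open>The analysis takes place on a slightly larger interval, so that the weak limit has no atoms at the
    endpoints of \<open>K\<close>. The bounded variation carries over because the entries of the transfer matrices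
    are polynomials of degree at most \<open>N\<close>.\<close>
  obtain l' u' where lu': "l' < l" "u < u'" and ell: "\<And>x. x \<in> {l'..u'} \<Longrightarrow> (poly (Q 1 1) x + poly (Q 2 2) x)\<^sup>2 < 4"
    by (rule ivl_extension[of "\<lambda>x. (poly (Q 1 1) x + poly (Q 2 2) x)\<^sup>2" l u 4])
      (use ellK lu in \<open>auto simp: Kivl intro!: continuous_intros\<close>)
  obtain C where C: "C > 0" "\<And>q B x. degree q \<le> N \<Longrightarrow> (\<And>c. c \<in> A \<Longrightarrow> \<bar>poly q c\<bar> \<le> B) \<Longrightarrow> x \<in> {l'..u'} \<Longrightarrow> \<bar>poly q x\<bar> \<le> C * B"
    using poly_compact_bound[OF A(1,2) compact_Icc, of l' u'] by metis
  define \<sigma> where "\<sigma> k = (SUP x\<in>K. spectral_norm (X (m (Suc k)) x - X (m k) x))" for k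
  obtain B where B: "\<And>j x. j \<ge> 1 \<Longrightarrow> x \<in> K \<Longrightarrow> spectral_norm (X (m j) x) \<le> B"
    using D1 unfolding stolz_class_1_def m_def by blast
  have "summable (\<lambda>j. \<sigma> (Suc j))"
    using D1 unfolding stolz_class_1_def \<sigma>_def m_def by simp
  then have sum\<sigma>: "summable \<sigma>" by (simp add: summable_Suc_iff)
  have \<sigma>_upper: "spectral_norm (X (m (Suc k)) x - X (m k) x) \<le> \<sigma> k" if "k \<ge> 1" "x \<in> K" for k x
    unfolding \<sigma>_def
  proof (rule cSUP_upper[OF \<open>x \<in> K\<close>], rule bdd_aboveI2)
    fix y assume "y \<in> K"
    then show "spectral_norm (X (m (Suc k)) y - X (m k) y) \<le> B + B"
      using spectral_norm_diff[of "X (m (Suc k)) y" "X (m k) y"] B[of "Suc k" y] B[of k y] that(1) by simp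
  qed
  have \<sigma>_nonneg: "\<sigma> k \<ge> 0" if "k \<ge> 1" for k
    using order_trans[OF abs_ge_zero order_trans[OF spectral_norm_component \<sigma>_upper[OF that, of l]]] lu by (simp add: Kivl)
  \<comment> \<open>The hypotheses on the variation start at index \<open>1\<close>, so index
    \<open>0\<close> receives the value \<open>0\<close>; the tails in the final estimates begin at
    \<open>k \<ge> M \<ge> 1\<close> and do not see it. The factor \<open>C\<close> is the loss in
    passing from \<open>K\<close> to the larger interval.\<close>
  define \<delta> where "\<delta> k = (if k = 0 then 0 else C * \<sigma> k)" for k
  have var: "\<bar>poly (q (Suc k) r s) x - poly (q k r s) x\<bar> \<le> \<delta> k" if "k \<ge> 1" "x \<in> {l'..u'}" for k x r s
  proof -
    have "\<bar>poly (q (Suc k) r s - q k r s) x\<bar> \<le> C * \<sigma> k"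
    proof (rule C(2)[OF _ _ that(2)])
      show "degree (q (Suc k) r s - q k r s) \<le> N" by (intro degree_diff_le q)
      fix c assume "c \<in> A"
      then have "c \<in> K" using A(3) by blast
      from order_trans[OF spectral_norm_component \<sigma>_upper[OF that(1) this]]
      show "\<bar>poly (q (Suc k) r s - q k r s) c\<bar> \<le> \<sigma> k" by (simp add: q(2)[symmetric])
    qed
    then show ?thesis using that(1) by (simp add: \<delta>_def)
  qed
  have sum\<delta>: "summable \<delta>"
  proof -
    have "summable (\<lambda>k. \<delta> (Suc k))" using sum\<sigma> by (simp add: \<delta>_def summable_Suc_iff summable_mult)
    then show ?thesis by (simp add: summable_Suc_iff)
  qed
  have contp: "continuous_on S (poly f)" for S and f :: "real poly"
    using continuous_on_poly[of S "\<lambda>x. x" f] by simp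
  interpret R: elliptic_recurrence "{l'..u'}" \<delta> "\<lambda>k. poly (q k 1 1)" "\<lambda>k. poly (q k 1 2)" "\<lambda>k. poly (q k 2 1)" "\<lambda>k. poly (q k 2 2)"
    "poly (Q 1 1)" "poly (Q 1 2)" "poly (Q 2 1)" "poly (Q 2 2)" "\<lambda>k. a (m k - 1)" "\<lambda>k. poly (P (m k - 1))" "\<lambda>k. poly (P (m k))"
  proof (unfold_locales, goal_cases)
    case (1 k) then show ?case using \<sigma>_nonneg[of k] C(1) by (simp add: \<delta>_def)
  next
    case (24 k x)
    have "m k \<ge> 1" using mk[of k] 24 by simp
    from step_matrix_orth_poly(1)[OF this, of N x] show ?case by (simp add: qX mSuc)
  next
    case (25 k x)
    have "m k \<ge> 1" using mk[of k] 25 by simp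
    from step_matrix_orth_poly(2)[OF this, of N x] show ?case by (simp add: qX mSuc)
  next
    case (28 k x)
    have "m k \<ge> 1" using mk[of k] 28 by simp
    then show ?case using P_adjacent_nonzero[of "m k - 1" x] by simp
  qed (use sum\<delta> var Q(1) contp \<alpha>_ratio det ell in auto)
  have R_discr: "- discr (\<X> x) = 4 * (R.\<sigma> x)\<^sup>2" if "x \<in> K" for x
  proof -
    have "x \<in> {l'..u'}" using that lu' by (auto simp: Kivl)
    then have "1 - (R.\<tau> x)\<^sup>2 > 0" by (rule R.\<tau>_bound)
    then have "(R.\<sigma> x)\<^sup>2 = 1 - (R.\<tau> x)\<^sup>2" by (simp add: R.\<sigma>_def)
    moreover have "discr (\<X> x) = 4 * (R.\<tau> x)\<^sup>2 - 4"
      using detQ[of x] by (simp add: discr_def trace_2 det_2 XQ[OF that] R.\<tau>_def power_divide)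
    ultimately show ?thesis by simp
  qed
  interpret E: elliptic_jacobi a b l' u' \<delta> "\<lambda>k. poly (q k 1 1)" "\<lambda>k. poly (q k 1 2)" "\<lambda>k. poly (q k 2 1)" "\<lambda>k. poly (q k 2 2)"
    "poly (Q 1 1)" "poly (Q 1 2)" "poly (Q 2 1)" "poly (Q 2 2)" m
  proof unfold_locales
    show "l' < u'" using lu lu' by simp
    show "k \<le> m k" for k by (rule mk)
    show "AE x in lborel. x \<in> {l'..u'} \<longrightarrow> poly (Q 1 1) x = poly (Q 1 1) l' \<and> poly (Q 2 1) x = poly (Q 2 1) l' \<and> poly (Q 2 2) x = poly (Q 2 2) l' \<or> (\<forall>j\<ge>1. R.\<epsilon> x ^ (2 * j) \<noteq> 1)"
    proof (rule elliptic_polynomial_generic[where T = "Q 1 1 + Q 2 2"])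
      show "l' < u'" using lu lu' by simp
      show "Re (R.\<epsilon> x) = poly (Q 1 1 + Q 2 2) x / 2" for x by (simp add: R.\<epsilon>_def R.\<tau>_def)
      fix x assume x: "x \<in> {l'..u'}" and T0: "poly (pderiv (Q 1 1 + Q 2 2)) x = 0"
      \<comment> \<open>The sum bounds every entry of the limit, and the \<open>+ 1\<close> makes
        the bound strict, so that it holds for the approximating entries from some index on.\<close>
      define B' where "B' = (\<Sum>r\<in>UNIV. \<Sum>s\<in>UNIV. \<bar>poly (Q r s) x\<bar>) + 1"
      have ev: "\<forall>\<^sub>F k in sequentially. \<forall>r s. \<bar>poly (q k r s) x\<bar> \<le> B'"
      proof (intro eventually_all_finite)
        fix r s
        have "\<bar>poly (Q r s) x\<bar> \<le> (\<Sum>s\<in>UNIV. \<bar>poly (Q r s) x\<bar>)" by (rule member_le_sum) auto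
        also have "\<dots> \<le> (\<Sum>r\<in>UNIV. \<Sum>s\<in>UNIV. \<bar>poly (Q r s) x\<bar>)"
          by (rule member_le_sum[where f = "\<lambda>r. \<Sum>s\<in>UNIV. \<bar>poly (Q r s) x\<bar>"]) (auto intro: sum_nonneg)
        finally have "\<bar>poly (Q r s) x\<bar> < B'" by (simp add: B'_def)
        from order_tendstoD(2)[OF tendsto_rabs[OF Q(1)] this]
        show "\<forall>\<^sub>F k in sequentially. \<bar>poly (q k r s) x\<bar> \<le> B'" by eventually_elim simp
      qed
      have dom: "poly (pderiv (Q r s)) x = 0" for r s
      proof -
        \<comment> \<open>The limit of \<open>step_matrix_pderiv_bound\<close>. The left factor is
          minus the limiting discriminant, positive on the larger interval, so a stationary trace
          forces the derivatives of all entries to vanish.\<close>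
        have "(4 - (poly (Q 1 1) x + poly (Q 2 2) x)\<^sup>2) * \<bar>poly (pderiv (Q r s)) x\<bar> \<le> 16 * B'\<^sup>2 * \<bar>poly (pderiv (Q 1 1)) x + poly (pderiv (Q 2 2)) x\<bar>"
        proof (rule tendsto_le[OF sequentially_bot])
          have "(\<lambda>k. - discr (X (m k) x) * \<bar>poly (pderiv (q k r s)) x\<bar>) \<longlonglongrightarrow> - ((poly (Q 1 1) x + poly (Q 2 2) x)\<^sup>2 - 4) * \<bar>poly (pderiv (Q r s)) x\<bar>"
            by (intro tendsto_intros discr_lim Q)
          then show "(\<lambda>k. - discr (X (m k) x) * \<bar>poly (pderiv (q k r s)) x\<bar>) \<longlonglongrightarrow> (4 - (poly (Q 1 1) x + poly (Q 2 2) x)\<^sup>2) * \<bar>poly (pderiv (Q r s)) x\<bar>"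
            by simp
          show "(\<lambda>k. 16 * B'\<^sup>2 * \<bar>poly (pderiv (q k 1 1)) x + poly (pderiv (q k 2 2)) x\<bar>) \<longlonglongrightarrow> 16 * B'\<^sup>2 * \<bar>poly (pderiv (Q 1 1)) x + poly (pderiv (Q 2 2)) x\<bar>"
            by (intro tendsto_intros Q)
          show "\<forall>\<^sub>F k in sequentially. - discr (X (m k) x) * \<bar>poly (pderiv (q k r s)) x\<bar> \<le> 16 * B'\<^sup>2 * \<bar>poly (pderiv (q k 1 1)) x + poly (pderiv (q k 2 2)) x\<bar>"
            using ev eventually_ge_at_top[of 1]
          proof eventually_elim
            case (elim k)
            then have "m k \<ge> 1" using mk[of k] by simp
            from step_matrix_pderiv_bound[OF this qX, of x B' r s] elim(1)
            show ?case by (simp add: X_def pderiv_add)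
          qed
        qed
        also have "\<dots> = 0" using T0 by (simp add: pderiv_add)
        finally show ?thesis using ell[OF x] by (simp add: mult_le_0_iff)
      qed
      show "poly (pderiv (Q 1 1)) x = 0 \<and> poly (pderiv (Q 2 1)) x = 0 \<and> poly (pderiv (Q 2 2)) x = 0"
        using dom by blast
    qed
  qed
  obtain M \<zeta> Ca \<nu> where M: "M \<ge> 1" and \<zeta>: "continuous_on {l'..u'} \<zeta>" "\<And>x. x \<in> {l'..u'} \<Longrightarrow> \<zeta> x \<noteq> 0" and Ca: "Ca \<ge> 0"
    and t1: "\<And>k x. k \<ge> M \<Longrightarrow> x \<in> {l'..u'} \<Longrightarrow> \<bar>R.t k x\<bar> \<le> 1"
    and asym: "\<And>k x. k \<ge> M \<Longrightarrow> x \<in> {l'..u'} \<Longrightarrow> \<bar>sqrt (a (m (Suc k) - 1)) * poly (P (m k)) x - Im (\<zeta> x * cis (R.phase M k x)) / R.\<sigma> x\<bar> \<le> Ca * R.tail k"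
    and \<nu>: "real_distribution \<nu>" "orthonormal_L2 \<nu> (\<lambda>n. poly (P n))"
    and dens: "\<And>l'' u''. l' < l'' \<Longrightarrow> l'' < u'' \<Longrightarrow> u'' < u' \<Longrightarrow>
       abs_cont_density_on \<nu> {l''..u''} (\<lambda>x. \<bar>poly (Q 2 1) x\<bar> * R.\<sigma> x / (pi * (norm (\<zeta> x))\<^sup>2))"
    using E.orthogonality_measure by blast
  interpret \<nu>: real_distribution \<nu> by fact
  have KK: "x \<in> {l'..u'}" if "x \<in> K" for x using that lu' by (auto simp: Kivl)
  define w where "w x = \<bar>poly (Q 2 1) x\<bar> * R.\<sigma> x / (pi * (norm (\<zeta> x))\<^sup>2)" for x
  have \<sigma>p: "R.\<sigma> x > 0" if "x \<in> K" for x by (rule E.\<sigma>_pos[OF KK[OF that]])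
  have w_pos: "w x > 0" if "x \<in> K" for x
    unfolding w_def using \<sigma>p[OF that] \<zeta>(2)[OF KK[OF that]] R.y21_nz[OF KK[OF that]] by simp
  have contw: "continuous_on K w"
    unfolding w_def R.\<sigma>_def R.\<tau>_def using \<zeta>(2) KK
    by (intro continuous_intros contp continuous_on_subset[OF \<zeta>(1)]) auto
  have dens_K: "abs_cont_density_on \<nu> K w" unfolding Kivl w_def[abs_def] by (rule dens[OF lu'(1) lu lu'(2)])
  have "contractible {l'..u'}" by (intro convex_imp_contractible) auto
  \<comment> \<open>Since \<zeta> has no zero on the interval it has a continuous logarithm, whose
    imaginary part is a continuous argument: the phase shift of the theorem.\<close>
  then obtain g where g: "continuous_on {l'..u'} g" "\<And>x. x \<in> {l'..u'} \<Longrightarrow> \<zeta> x = exp (g x)"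
    using continuous_logarithm_on_contractible[OF \<zeta>(1) _ \<zeta>(2)] by metis
  define \<eta> where "\<eta> x = Im (g x)" for x
  have cont\<eta>: "continuous_on K \<eta>" unfolding \<eta>_def using KK by (intro continuous_intros continuous_on_subset[OF g(1)]) auto
  have R_t: "R.t k x = trace (X (m k) x) / (2 * sqrt (det (X (m k) x)))" for k x
    by (simp add: R.t_def R.D_def trace_2 det_2 q(2))
  have phase: "R.phase M k x = (\<Sum>j=M+1..k. transfer_angle a b N (j * N + i) x)" for k x
    unfolding R.phase_def R.\<theta>_def R_t transfer_angle_def by (simp add: X_def m_def)
  \<comment> \<open>As \<open>sqrt (- discr (\<X> x)) = 2 * R.\<sigma> x\<close>, the density
    \<open>w\<close> cancels everything under the root except the square of
    \<open>norm (\<zeta> x) / R.\<sigma> x\<close>.\<close>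
  have amp: "Im (\<zeta> x * cis \<phi>) / R.\<sigma> x = sqrt (2 * \<bar>\<X> x $ 2 $ 1\<bar> / (pi * w x * sqrt (- discr (\<X> x)))) * sin (\<phi> + \<eta> x)"
    if x: "x \<in> K" for x \<phi>
  proof -
    have "\<zeta> x * cis \<phi> = of_real (norm (\<zeta> x)) * cis (\<phi> + \<eta> x)"
      using g(2)[OF KK[OF x]] by (simp add: exp_eq_polar[of "g x"] \<eta>_def norm_mult mult.assoc cis_mult add.commute)
    then have "Im (\<zeta> x * cis \<phi>) / R.\<sigma> x = (norm (\<zeta> x) / R.\<sigma> x) * sin (\<phi> + \<eta> x)" by simp
    moreover have "2 * \<bar>\<X> x $ 2 $ 1\<bar> / (pi * w x * sqrt (- discr (\<X> x))) = (norm (\<zeta> x) / R.\<sigma> x)\<^sup>2"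
    proof -
      have "sqrt (- discr (\<X> x)) = 2 * R.\<sigma> x"
        unfolding R_discr[OF x] using \<sigma>p[OF x] by (simp add: real_sqrt_mult)
      then show ?thesis
        unfolding w_def XQ[OF x] using \<sigma>p[OF x] \<zeta>(2)[OF KK[OF x]] R.y21_nz[OF KK[OF x]]
        by (simp add: field_simps power2_eq_square)
    qed
    ultimately show ?thesis using \<sigma>p[OF x] by simp
  qed
  \<comment> \<open>The error term is indexed by the degree of the polynomial; as
    \<open>i < N\<close>, the quotient \<open>n div N\<close> recovers \<open>k\<close> from
    \<open>n = k * N + i\<close>.\<close>
  define E' where "E' n x = sqrt (a (n + N - 1)) * p n x - sqrt (2 * \<bar>\<X> x $ 2 $ 1\<bar> / (pi * w x * sqrt (- discr (\<X> x)))) *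
      sin ((\<Sum>j=M+1..n div N. transfer_angle a b N (j * N + i) x) + \<eta> x)" for n x
  have divN: "(k * N + i) div N = k" for k using i_less by simp
  have idx: "(k + 1) * N + i - 1 = k * N + i + N - 1" for k by simp
  have tail: "R.tail k = C * (\<Sum>j. SUP x\<in>K. spectral_norm (X ((k + j + 1) * N + i) x - X ((k + j) * N + i) x))" if "k \<ge> 1" for k
  proof -
    have "R.tail k = (\<Sum>j. C * \<sigma> (j + k))" unfolding R.tail_def using that by (simp add: \<delta>_def)
    also have "\<dots> = C * (\<Sum>j. \<sigma> (j + k))" using sum\<sigma> by (intro suminf_mult) (simp add: summable_iff_shift)
    finally show ?thesis by (simp add: \<sigma>_def m_def add.commute add.left_commute)
  qed
  have bound: "\<bar>E' (k * N + i) x\<bar> \<le> Ca * R.tail k" if "k \<ge> M" "x \<in> K" for k x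
    using asym[OF that(1) KK[OF that(2)]] unfolding E'_def divN amp[OF that(2)] phase
    by (simp add: p_def mSuc m_def add.commute add.left_commute)
  \<comment> \<open>\<open>Ca\<close> refers to the tail of \<open>\<delta>\<close>, which is
    \<open>C\<close> times the tail of the suprema over \<open>K\<close>; the \<open>+ 1\<close>
    makes the resulting constant positive.\<close>
  have Ebound: "bdd_above ((\<lambda>x. \<bar>E' (k * N + i) x\<bar>) ` K)"
    "(SUP x\<in>K. \<bar>E' (k * N + i) x\<bar>) \<le> (Ca * C + 1) * (\<Sum>j. SUP x\<in>K. spectral_norm (X ((k + j + 1) * N + i) x - X ((k + j) * N + i) x))"
    if k: "k \<ge> M" for k
  proof -
    show "bdd_above ((\<lambda>x. \<bar>E' (k * N + i) x\<bar>) ` K)" using bound[OF k] by (rule bdd_aboveI2)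
    let ?T = "\<Sum>j. SUP x\<in>K. spectral_norm (X ((k + j + 1) * N + i) x - X ((k + j) * N + i) x)"
    have k1: "k \<ge> 1" using k M by simp
    have T0: "?T \<ge> 0" using tail[OF k1] R.tail_nonneg[of k] C(1) by (simp add: zero_le_mult_iff)
    have "(SUP x\<in>K. \<bar>E' (k * N + i) x\<bar>) \<le> Ca * R.tail k"
      by (rule cSUP_least) (use bound[OF k] lu Kivl in auto)
    also have "\<dots> \<le> (Ca * C + 1) * ?T" unfolding tail[OF k1] using T0 by (simp add: distrib_right)
    finally show "(SUP x\<in>K. \<bar>E' (k * N + i) x\<bar>) \<le> (Ca * C + 1) * ?T" .
  qed
  have 1: "\<bar>trace (X (j * N + i) x) / (2 * sqrt (det (X (j * N + i) x)))\<bar> \<le> 1" if "M < j" "x \<in> K" for j x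
    using t1[of j x] that KK unfolding R_t m_def by simp
  have 2: "sqrt (a ((k + 1) * N + i - 1)) * p (k * N + i) x =
        sqrt (2 * \<bar>\<X> x $ 2 $ 1\<bar> / (pi * w x * sqrt (- discr (\<X> x)))) *
          sin ((\<Sum>j=M+1..k. transfer_angle a b N (j * N + i) x) + \<eta> x) + E' (k * N + i) x" for k x
    unfolding E'_def divN idx by simp
  show ?thesis
    apply (rule exI[of _ \<nu>], rule exI[of _ w])
    apply (intro conjI \<nu>.prob_space_axioms \<nu>.events_eq_borel \<nu>(2)[folded p_def] dens_K contw ballI w_pos, assumption)
    apply (rule exI[of _ M], rule exI[of _ "Ca * C + 1"], rule exI[of _ \<eta>], rule exI[of _ E'])
    using M Ca C(1) by (intro conjI allI impI ballI cont\<eta> 1 2 Ebound) (auto simp: add_nonneg_pos)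
qed

end
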